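(* Let $f:[-1,1]\to\mathbb{C}$ and $g:[-1,1]\to\mathbb{R}$ admit infinitely differentiable extensions to a neighborhood of $[-1,1]$, and suppose that the derivative of the extension of $g$ is nonzero in an open interval containing $[-1,1]$. Let $$G_0=\min_{-1\le x\le 1}|g'(x)|,\qquad W=\frac12\int_{-1}^1 g'(x)\,dx,$$ define $u:[-1,1]\to[-1,1]$ by $u(x)=-1+\frac1W\int_{-1}^x g'(y)\,dy$ (which is invertible), and define $h:[-1,1]\to\mathbb{C}$ by $$h(z)=\frac{f(u^{-1}(z))}{u'(u^{-1}(z))}=f(u^{-1}(z))\,\frac{du^{-1}}{dz}(z).$$ Then for every $0<\epsilon<1$ there exists a function $p_b:[-1,1]\to\mathbb{C}$ such that: 1. the Fourier transform of $p_b(u^{-1}(z))$ is a tempered distribution of order at most $1$ supported on the interval $[-c_h(\epsilon),c_h(\epsilon)]$ (that is, $p_b\circ u^{-1}$ is the restriction to $[-1,1]$ of an entire function, tempered on $\mathbb{R}$, whose Fourier transform has this property); 2. $\left|p_b'(x)+ig'(x)p_b(x)-f(x)\right|\le \epsilon\,\dfrac{|W|}{G_0}\,\|f\|_{L^\infty([-1,1])}$ for all $x\in[-1,1]$; 3. $\|p_b\|_{L^\infty([-1,1])}\lesssim \dfrac{|W|}{G_0}\min\left\{1,\dfrac1{|W|}\right\}\|f\|_{L^\infty([-1,1])}$; 4. $\|p_b'\|_{L^\infty([-1,1])}\lesssim \dfrac{|W|}{G_0}\min\left\{1,\dfrac1{|W|}\right\}\|f\|_{L^\infty([-1,1])}$.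 Here the constants implied by $\lesssim$ do not depend on the magnitude of $g'$: they may depend on $f$, $\epsilon$ and the normalized function $u$, but the same constants are valid when $g$ is replaced by $\lambda g$ for any real $\lambda\ne0$ (which leaves $u$ and $h$ unchanged).
   Context: Fourier transform convention: for $\varphi\in S(\mathbb{R})$ (Schwartz space), $\widehat{\varphi}(\xi)=\frac1{2\pi}\int_{-\infty}^\infty \varphi(x)e^{-i\xi x}\,dx$, so that $\varphi(x)=\int_{-\infty}^\infty\widehat\varphi(\xi)e^{i\xi x}\,d\xi$; it is extended to tempered distributions $S'(\mathbb{R})$ by $\langle\widehat\varphi,\psi\rangle=\langle\varphi,\widehat\psi\rangle$. The order of a tempered distribution $\varphi$ is the least nonnegative integer $n$ such that for each compact $K\subset\mathbb{R}$ there is a constant $M_K$ with $|\langle\varphi,\psi\rangle|\le M_K\sup_{0\le k\le n}\sup_{x\in K}|D^k\psi(x)|$ for every $\psi\in S(\mathbb{R})$ supported in $K$. A tempered distribution has bandlimit $c$ if its Fourier transform is supported in $[-c,c]$ ($c$ is not required to be the smallest such number). Definition of $c_F(\epsilon)$: if $F:[-1,1]\to\mathbb{C}$ admits an infinitely differentiable extension to an open interval containing $[-1,1]$ and $0<\epsilon<1$, then $c_F(\epsilon)$ is the smallest positive real number $c$ such that there exists $F_b\in S(\mathbb{R})$ of bandlimit $c$ with: (1) $\|F-F_b\|_{L^\infty([-1,1])}\le\epsilon\|F\|_{L^\infty([-1,1])}$; (2) $\|F_b\|_{L^\infty(\mathbb{R})}\le 4\|F\|_{L^\infty([-1,1])}$;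 (3) $\|\widehat{F_b}\|_{L^\infty(\mathbb{R})}\le 4\|F\|_{L^\infty([-1,1])}$; (4) $\|\widehat{F_b}'\|_{L^\infty(\mathbb{R})}\le 4\|F\|_{L^\infty([-1,1])}$. The notation $x\lesssim y$ means $x\le Cy$ for some constant $C$; dependence of $C$ is as specified in the claim. *)

theory Defs
  imports "HOL-Analysis.Analysis" "HOL-Probability.Essential_Supremum"
begin

section \<open>Smooth functions and the Schwartz space\<close>

definition vderiv :: "(real \<Rightarrow> 'a::real_normed_vector) \<Rightarrow> real \<Rightarrow> 'a" where
  "vderiv F = (\<lambda>x. vector_derivative F (at x))"

definition smooth_on :: "real set \<Rightarrow> (real \<Rightarrow> 'a::real_normed_vector) \<Rightarrow> bool" where
  "smooth_on U F \<longleftrightarrow> open U \<and> (\<forall>n. \<forall>x\<in>U. (vderiv ^^ n) F differentiable (at x))"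

definition schwartz :: "(real \<Rightarrow> complex) set" where
  "schwartz = {\<phi>. smooth_on UNIV \<phi> \<and>
     (\<forall>m n. bounded (range (\<lambda>x. x ^ m *\<^sub>R (vderiv ^^ n) \<phi> x)))}"

definition schwartz_seminorm :: "nat \<Rightarrow> nat \<Rightarrow> (real \<Rightarrow> complex) \<Rightarrow> real" where
  "schwartz_seminorm m n \<phi> = (SUP x. norm (x ^ m *\<^sub>R (vderiv ^^ n) \<phi> x))"

definition supp :: "(real \<Rightarrow> complex) \<Rightarrow> real set" where
  "supp \<phi> = closure {x. \<phi> x \<noteq> 0}"

text \<open>The value is \<open>\<infinity>\<close> for non-measurable or essentially unbounded functions.\<close>

definition Linf_norm :: "real set \<Rightarrow> (real \<Rightarrow> complex) \<Rightarrow> ereal" where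
  "Linf_norm S F = esssup (lebesgue_on S) (\<lambda>x. ereal (norm (F x)))"

section \<open>Tempered distributions\<close>

text \<open>
  A tempered distribution is a functional on the Schwartz space; it is represented by a function
  on all of \<^typ>\<open>real \<Rightarrow> complex\<close> whose values outside \<^const>\<open>schwartz\<close> are irrelevant.
  Continuity is expressed by domination by finitely many Schwartz seminorms.
\<close>

definition tempered_distribution :: "((real \<Rightarrow> complex) \<Rightarrow> complex) \<Rightarrow> bool" where
  "tempered_distribution T \<longleftrightarrow>
     (\<forall>\<phi>\<in>schwartz. \<forall>\<psi>\<in>schwartz. T (\<lambda>x. \<phi> x + \<psi> x) = T \<phi> + T \<psi>) \<and>
     (\<forall>a. \<forall>\<phi>\<in>schwartz. T (\<lambda>x. a * \<phi> x) = a * T \<phi>) \<and>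
     (\<exists>C N. \<forall>\<phi>\<in>schwartz.
        norm (T \<phi>) \<le> C * (\<Sum>m\<le>N. \<Sum>n\<le>N. schwartz_seminorm m n \<phi>))"

definition dist_of_fun :: "(real \<Rightarrow> complex) \<Rightarrow> (real \<Rightarrow> complex) \<Rightarrow> complex" where
  "dist_of_fun F \<phi> = (\<integral>x. F x * \<phi> x \<partial>lborel)"

text \<open>
  Integrability has to be demanded separately, because the integral of a non-integrable function
  is \<open>0\<close> by convention.
\<close>

definition tempered_function :: "(real \<Rightarrow> complex) \<Rightarrow> bool" where
  "tempered_function F \<longleftrightarrow>
     (\<forall>\<phi>\<in>schwartz. integrable lborel (\<lambda>x. F x * \<phi> x)) \<and> tempered_distribution (dist_of_fun F)"

definition fourier :: "(real \<Rightarrow> complex) \<Rightarrow> real \<Rightarrow> complex" where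
  "fourier \<phi> \<xi> = (1 / (2 * pi)) * (\<integral>x. \<phi> x * exp (- \<i> * of_real (\<xi> * x)) \<partial>lborel)"

definition fourier_dist :: "((real \<Rightarrow> complex) \<Rightarrow> complex) \<Rightarrow> (real \<Rightarrow> complex) \<Rightarrow> complex" where
  "fourier_dist T \<psi> = T (fourier \<psi>)"

definition dist_vanishes_on :: "((real \<Rightarrow> complex) \<Rightarrow> complex) \<Rightarrow> real set \<Rightarrow> bool" where
  "dist_vanishes_on T U \<longleftrightarrow>
     (\<forall>\<psi>\<in>schwartz. compact (supp \<psi>) \<and> supp \<psi> \<subseteq> U \<longrightarrow> T \<psi> = 0)"

definition dist_support :: "((real \<Rightarrow> complex) \<Rightarrow> complex) \<Rightarrow> real set" where
  "dist_support T = - \<Union>{U. open U \<and> dist_vanishes_on T U}"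

text \<open>A number \<open>n\<close> as below exists for every tempered distribution.\<close>

definition dist_order :: "((real \<Rightarrow> complex) \<Rightarrow> complex) \<Rightarrow> nat" where
  "dist_order T = (LEAST n. \<forall>K. compact K \<longrightarrow> (\<exists>M. \<forall>\<psi>\<in>schwartz. supp \<psi> \<subseteq> K \<longrightarrow>
     norm (T \<psi>) \<le> M * (SUP k\<in>{0..n}. SUP x\<in>K. norm ((vderiv ^^ k) \<psi> x))))"

definition bandlimit :: "((real \<Rightarrow> complex) \<Rightarrow> complex) \<Rightarrow> real \<Rightarrow> bool" where
  "bandlimit T c \<longleftrightarrow> dist_support (fourier_dist T) \<subseteq> {-c..c}"

section \<open>Bandlimited approximation on \<open>[-1, 1]\<close>\<close>

text \<open>
  \<open>approx_band F \<epsilon>\<close> is \<open>c\<^sub>F(\<epsilon>)\<close>. The least \<open>c\<close> is rendered as an infimum: a minimum need not be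
  attained (for \<open>F = 0\<close> every \<open>c > 0\<close> is admissible, and in general limits of admissible \<open>F\<^sub>b\<close> may
  leave the Schwartz space). Where the minimum exists, the two agree.
\<close>

definition approx_band :: "(real \<Rightarrow> complex) \<Rightarrow> real \<Rightarrow> real" where
  "approx_band F \<epsilon> = Inf {c. 0 < c \<and> (\<exists>Fb\<in>schwartz. bandlimit (dist_of_fun Fb) c \<and>
     Linf_norm {-1..1} (\<lambda>x. F x - Fb x) \<le> ereal \<epsilon> * Linf_norm {-1..1} F \<and>
     Linf_norm UNIV Fb \<le> 4 * Linf_norm {-1..1} F \<and>
     Linf_norm UNIV (fourier Fb) \<le> 4 * Linf_norm {-1..1} F \<and>
     Linf_norm UNIV (vderiv (fourier Fb)) \<le> 4 * Linf_norm {-1..1} F)}"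

section \<open>The change of variables\<close>

text \<open>
  Functions on \<open>[-1, 1]\<close> are represented by total functions of which only the values on \<open>[-1, 1]\<close>
  matter; derivatives are one-sided at the end points.
\<close>

definition deriv_I :: "(real \<Rightarrow> 'a::real_normed_vector) \<Rightarrow> real \<Rightarrow> 'a" where
  "deriv_I F x = vector_derivative F (at x within {-1..1})"

definition min_deriv :: "(real \<Rightarrow> real) \<Rightarrow> real" where
  "min_deriv g = (INF x\<in>{-1..1}. \<bar>deriv_I g x\<bar>)"

definition mean_deriv :: "(real \<Rightarrow> real) \<Rightarrow> real" where
  "mean_deriv g = (1 / 2) * integral {-1..1} (deriv_I g)"

definition phase :: "(real \<Rightarrow> real) \<Rightarrow> real \<Rightarrow> real" where
  "phase g x = - 1 + (1 / mean_deriv g) * integral {-1..x} (deriv_I g)"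

definition phase_inv :: "(real \<Rightarrow> real) \<Rightarrow> real \<Rightarrow> real" where
  "phase_inv g = inv_into {-1..1} (phase g)"

definition transformed :: "(real \<Rightarrow> complex) \<Rightarrow> (real \<Rightarrow> real) \<Rightarrow> real \<Rightarrow> complex" where
  "transformed f g z = f (phase_inv g z) / of_real (deriv_I (phase g) (phase_inv g z))"

end

theory Submission
  imports Defs "HOL-Probability.Sinc_Integral" "HOL-Probability.Characteristic_Functions"
begin

text \<open>
  Under the substitution \<open>p = P \<circ> u\<close> the equation \<open>p' + i g' p = f\<close> becomes the equation
  \<open>P' + i W P = h\<close> with constant coefficients. If \<open>h\<close> is replaced by an exponential sum
  \<open>F(z) = \<Sum> a\<^sub>j e\<^sup>i\<^sup>\<xi>\<^sup>z\<close> with frequencies \<open>\<xi> = \<xi>\<^sub>j\<close>, the function \<open>P\<close> with the coefficients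
  \<open>a\<^sub>j / (i (\<xi>\<^sub>j + W))\<close> solves it exactly, is entire and bounded on the line, and its Fourier
  transform is a combination of point masses at the \<open>\<xi>\<^sub>j\<close>, a distribution of order \<open>0\<close>.

  The choice of \<open>F\<close> has a lot of freedom. On \<open>[- 1, 1]\<close> every continuous function is a uniform limit
  of exponential sums with frequencies in any given interval, however short (\<open>exp_sum_dense\<close>). The
  price is the size of the coefficients, and the constants may depend on \<open>f\<close>, \<open>\<epsilon>\<close> and \<open>u\<close>. Hence
  \<open>h\<close> can be approximated to within \<open>\<epsilon> \<parallel>f\<parallel> / max u'\<close>, which absorbs the factor \<open>u'\<close> that the
  residual acquires in the original variable; recall that \<open>|W| / G\<^sub>0 \<ge> 1\<close> by the mean value theorem.
  Moreover the frequencies can be put into \<open>[m, 2 m]\<close> or \<open>[- 2 m, - m]\<close>, according to the sign of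
  \<open>W\<close>, for a small \<open>m > 0\<close>. Then \<open>|\<xi>\<^sub>j + W| \<ge> m + |W|\<close>: there is no resonance, and the bounds for \<open>p\<close>
  and \<open>p'\<close> with the factor \<open>min {1, 1 / |W|}\<close> follow (\<open>exp_sum_solution\<close>). The two sums depend on
  \<open>f\<close>, \<open>\<epsilon>\<close> and \<open>u\<close> only, so the constants survive a scaling of \<open>g\<close>.

  What is left is that the frequencies fit into the band, that is, \<open>2 m \<le> c\<^sub>h(\<epsilon>)\<close> unless \<open>h = 0\<close>;
  \<open>approx_band_ge\<close> shows \<open>c\<^sub>h(\<epsilon>) \<ge> (1 - \<epsilon>) / 8\<close>. An admissible \<open>F\<^sub>b\<close> with bandlimit \<open>c\<close> has a transform
  bounded by \<open>4 \<parallel>h\<parallel>\<close> and vanishing outside \<open>[- c, c]\<close>, so \<open>|F\<^sub>b| \<le> 8 c \<parallel>h\<parallel>\<close>, although \<open>F\<^sub>b\<close> has to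
  reach \<open>(1 - \<epsilon>) \<parallel>h\<parallel>\<close> (\<open>admissible_bandlimit_ge\<close>). Since the infimum of an empty set would be
  meaningless, admissible functions must also be exhibited (\<open>admissible_exists\<close>). Both steps rest on
  Fourier inversion and on smooth bump functions, which are developed below as far as needed.
\<close>

section \<open>Smooth functions on the line\<close>

lemma vderiv_eqI:
  assumes "\<And>x. (F has_vector_derivative F' x) (at x)"
  shows "vderiv F = F'"
  unfolding vderiv_def using assms by (auto intro: vector_derivative_at)

lemma funpow_vderiv_eqI:
  assumes "\<And>n x. (D n has_vector_derivative D (Suc n) x) (at x)"
  shows "(vderiv ^^ n) (D 0) = D n"
  by (induction n) (auto simp: vderiv_eqI[OF assms])

lemma smooth_onI:
  assumes "\<And>n x. (D n has_vector_derivative D (Suc n) x) (at x)"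
  shows "smooth_on UNIV (D 0)"
  unfolding smooth_on_def funpow_vderiv_eqI[of D, OF assms]
  using assms by (auto intro: differentiableI_vector)

lemma smooth_on_has_vector_derivative:
  assumes "smooth_on U F" "x \<in> U"
  shows "((vderiv ^^ n) F has_vector_derivative (vderiv ^^ Suc n) F x) (at x)"
  using assms unfolding smooth_on_def vderiv_def
  by (auto simp: vector_derivative_works)

lemma smooth_on_vderiv: "smooth_on U F \<Longrightarrow> smooth_on U (vderiv F)"
  unfolding smooth_on_def by (metis comp_apply funpow_Suc_right)

lemma smooth_imp_continuous: "smooth_on UNIV F \<Longrightarrow> continuous_on UNIV F"
  unfolding smooth_on_def
  by (metis UNIV_I continuous_at_imp_continuous_on differentiable_imp_continuous_within funpow_0)

text \<open>
  Differentiability of order \<open>n\<close> peels off the first derivative, whereas iterating \<^const>\<open>vderiv\<close>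
  peels off the last one. Sums, products and affine substitutions change the derivatives in a way
  that is expressed by the same operations, so closure under them is an induction on \<open>n\<close>.
\<close>

primrec times_differentiable :: "nat \<Rightarrow> (real \<Rightarrow> complex) \<Rightarrow> bool" where
  "times_differentiable 0 F \<longleftrightarrow> True"
| "times_differentiable (Suc n) F \<longleftrightarrow>
     (\<exists>F'. (\<forall>x. (F has_vector_derivative F' x) (at x)) \<and> times_differentiable n F')"

lemma smooth_iff_times_differentiable:
  "smooth_on UNIV F \<longleftrightarrow> (\<forall>n. times_differentiable n F)"
proof (intro iffI allI)
  show "times_differentiable n F" if "smooth_on UNIV F" for n
    using that
  proof (induction n arbitrary: F)
    case (Suc n)
    have "(F has_vector_derivative vderiv F x) (at x)" for x
      using smooth_on_has_vector_derivative[OF Suc.prems, of x 0] by simp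
    with Suc show ?case by (auto intro!: exI[of _ "vderiv F"] smooth_on_vderiv)
  qed auto
  have *: "(vderiv ^^ n) F differentiable at x" if "times_differentiable (Suc n) F" for n F x
    using that
  proof (induction n arbitrary: F)
    case 0
    then show ?case by (auto intro: differentiableI_vector)
  next
    case (Suc n)
    then obtain F' where F': "\<And>x. (F has_vector_derivative F' x) (at x)" "times_differentiable (Suc n) F'"
      by auto
    show ?case using Suc.IH[OF F'(2)] vderiv_eqI[of F F', OF F'(1)]
      by (simp del: funpow.simps add: funpow_Suc_right)
  qed
  show "smooth_on UNIV F" if "\<forall>n. times_differentiable n F"
    unfolding smooth_on_def using that * by blast
qed

lemma times_differentiable_Suc_imp: "times_differentiable (Suc n) F \<Longrightarrow> times_differentiable n F"
proof (induction n arbitrary: F)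
  case (Suc n)
  then show ?case by (metis times_differentiable.simps(2))
qed auto

lemma times_differentiable_add:
  "times_differentiable n F \<Longrightarrow> times_differentiable n G \<Longrightarrow> times_differentiable n (\<lambda>x. F x + G x)"
proof (induction n arbitrary: F G)
  case (Suc n)
  obtain F' where F': "\<And>x. (F has_vector_derivative F' x) (at x)" "times_differentiable n F'"
    using Suc.prems(1) by auto
  obtain G' where G': "\<And>x. (G has_vector_derivative G' x) (at x)" "times_differentiable n G'"
    using Suc.prems(2) by auto
  show ?case
    unfolding times_differentiable.simps
    by (intro exI[of _ "\<lambda>x. F' x + G' x"] conjI allI has_vector_derivative_add Suc.IH F' G')
qed auto

lemma times_differentiable_mult:
  "times_differentiable n F \<Longrightarrow> times_differentiable n G \<Longrightarrow> times_differentiable n (\<lambda>x. F x * G x)"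
proof (induction n arbitrary: F G)
  case (Suc n)
  obtain F' where F': "\<And>x. (F has_vector_derivative F' x) (at x)" "times_differentiable n F'"
    using Suc.prems(1) by auto
  obtain G' where G': "\<And>x. (G has_vector_derivative G' x) (at x)" "times_differentiable n G'"
    using Suc.prems(2) by auto
  have FG: "times_differentiable n F" "times_differentiable n G"
    using Suc.prems times_differentiable_Suc_imp by blast+
  have "times_differentiable n (\<lambda>x. F x * G' x + F' x * G x)"
    by (intro times_differentiable_add Suc.IH F' G' FG)
  then show ?case
    unfolding times_differentiable.simps
    using has_vector_derivative_mult[OF F'(1) G'(1)]
    by (intro exI[of _ "\<lambda>x. F x * G' x + F' x * G x"]) auto
qed auto

lemma smooth_mult:
  "smooth_on UNIV F \<Longrightarrow> smooth_on UNIV G \<Longrightarrow> smooth_on UNIV (\<lambda>x. F x * G x :: complex)"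
  using times_differentiable_mult unfolding smooth_iff_times_differentiable by blast

lemma times_differentiable_affine:
  "times_differentiable n F \<Longrightarrow> times_differentiable n (\<lambda>x. z * F (a * x + b))"
proof (induction n arbitrary: F z)
  case (Suc n)
  obtain F' where F': "\<And>x. (F has_vector_derivative F' x) (at x)" "times_differentiable n F'"
    using Suc.prems(1) by auto
  have "((\<lambda>x. z * F (a * x + b)) has_vector_derivative (z * a) * F' (a * x + b)) (at x)" for x
  proof -
    have "((\<lambda>x. a * x + b) has_real_derivative a) (at x)"
      by (auto intro!: derivative_eq_intros)
    then have "((F \<circ> (\<lambda>x. a * x + b)) has_vector_derivative a *\<^sub>R F' (a * x + b)) (at x)"
      by (intro vector_diff_chain_at F' has_real_derivative_iff_has_vector_derivative[THEN iffD1])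
    then show ?thesis
      by (auto simp: o_def scaleR_conv_of_real mult_ac dest: has_vector_derivative_mult_right[of _ _ _ z])
  qed
  moreover have "times_differentiable n (\<lambda>x. (z * a) * F' (a * x + b))"
    using Suc.IH F'(2) by blast
  ultimately show ?case
    unfolding times_differentiable.simps
    by (intro exI[of _ "\<lambda>x. (z * a) * F' (a * x + b)"]) auto
qed auto

lemma smooth_affine:
  "smooth_on UNIV F \<Longrightarrow> smooth_on UNIV (\<lambda>x. F (a * x + b) :: complex)"
  using times_differentiable_affine[of _ F 1] unfolding smooth_iff_times_differentiable by simp

section \<open>Schwartz functions\<close>

text \<open>
  A Schwartz function is usually recognised from a sequence of its would-be derivatives that is
  known in closed form.
\<close>

lemma schwartzI:
  assumes "\<And>n x. (D n has_vector_derivative D (Suc n) x) (at x)"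
    and "\<And>m n. \<exists>B. \<forall>x. \<bar>x\<bar> ^ m * norm (D n x) \<le> B"
  shows "D 0 \<in> schwartz"
  unfolding schwartz_def mem_Collect_eq funpow_vderiv_eqI[of D, OF assms(1)]
  using smooth_onI[of D, OF assms(1)] assms(2)
  by (fastforce simp: bounded_iff power_abs)

lemma schwartz_derivative:
  "\<phi> \<in> schwartz \<Longrightarrow> ((vderiv ^^ n) \<phi> has_vector_derivative (vderiv ^^ Suc n) \<phi> x) (at x)"
  using smooth_on_has_vector_derivative[of UNIV \<phi>] by (simp add: schwartz_def)

lemma schwartz_has_vector_derivative:
  "\<phi> \<in> schwartz \<Longrightarrow> (\<phi> has_vector_derivative vderiv \<phi> x) (at x)"
  using schwartz_derivative[of \<phi> 0] by simp

lemma schwartz_bdd_above: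
  assumes "\<phi> \<in> schwartz"
  shows "bdd_above (range (\<lambda>x. norm (x ^ m *\<^sub>R (vderiv ^^ n) \<phi> x)))"
  using assms unfolding schwartz_def bounded_iff bdd_above_def by fastforce

lemma schwartz_seminorm_upper:
  fixes x :: real
  assumes "\<phi> \<in> schwartz"
  shows "\<bar>x\<bar> ^ m * norm ((vderiv ^^ n) \<phi> x) \<le> schwartz_seminorm m n \<phi>"
  using cSUP_upper[OF UNIV_I schwartz_bdd_above[OF assms, of m n], of x]
  by (simp add: schwartz_seminorm_def power_abs)

lemma schwartz_seminorm_nonneg: "\<phi> \<in> schwartz \<Longrightarrow> 0 \<le> schwartz_seminorm m n \<phi>"
  by (rule order_trans[OF _ schwartz_seminorm_upper[of _ 0]]) auto

lemma schwartz_continuous: "\<phi> \<in> schwartz \<Longrightarrow> continuous_on UNIV \<phi>"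
  by (simp add: schwartz_def smooth_imp_continuous)

lemma schwartz_vderiv:
  assumes "\<phi> \<in> schwartz" shows "vderiv \<phi> \<in> schwartz"
  using schwartzI[of "\<lambda>n. (vderiv ^^ Suc n) \<phi>"] schwartz_derivative[OF assms]
    schwartz_seminorm_upper[OF assms]
  by (fastforce simp del: funpow.simps(2) simp add: funpow_Suc_right)

lemma schwartz_cmult:
  assumes "\<phi> \<in> schwartz" shows "(\<lambda>x. z * \<phi> x) \<in> schwartz"
proof -
  have "(\<lambda>x. z * (vderiv ^^ 0) \<phi> x) \<in> schwartz"
  proof (rule schwartzI[of "\<lambda>n x. z * (vderiv ^^ n) \<phi> x"])
    fix m n :: nat
    have "\<bar>x\<bar> ^ m * norm (z * (vderiv ^^ n) \<phi> x) \<le> norm z * schwartz_seminorm m n \<phi>" for x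
      using mult_left_mono[OF schwartz_seminorm_upper[OF assms, of x m n], of "norm z"]
      by (simp add: norm_mult mult_ac)
    then show "\<exists>B. \<forall>x. \<bar>x\<bar> ^ m * norm (z * (vderiv ^^ n) \<phi> x) \<le> B" by blast
  qed (intro has_vector_derivative_mult_right schwartz_derivative[OF assms])
  then show ?thesis by simp
qed

lemma schwartz_add:
  assumes "\<phi> \<in> schwartz" "\<psi> \<in> schwartz" shows "(\<lambda>x. \<phi> x + \<psi> x) \<in> schwartz"
proof -
  have "(\<lambda>x. (vderiv ^^ 0) \<phi> x + (vderiv ^^ 0) \<psi> x) \<in> schwartz"
  proof (rule schwartzI[of "\<lambda>n x. (vderiv ^^ n) \<phi> x + (vderiv ^^ n) \<psi> x"])
    fix m n :: nat
    have "\<bar>x\<bar> ^ m * norm ((vderiv ^^ n) \<phi> x + (vderiv ^^ n) \<psi> x)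
        \<le> schwartz_seminorm m n \<phi> + schwartz_seminorm m n \<psi>" for x :: real
    proof -
      have "\<bar>x\<bar> ^ m * norm ((vderiv ^^ n) \<phi> x + (vderiv ^^ n) \<psi> x)
          \<le> \<bar>x\<bar> ^ m * (norm ((vderiv ^^ n) \<phi> x) + norm ((vderiv ^^ n) \<psi> x))"
        by (intro mult_left_mono norm_triangle_ineq) auto
      then show ?thesis
        using schwartz_seminorm_upper[OF assms(1), of x m n] schwartz_seminorm_upper[OF assms(2), of x m n]
        by (simp add: distrib_left)
    qed
    then show "\<exists>B. \<forall>x. \<bar>x\<bar> ^ m * norm ((vderiv ^^ n) \<phi> x + (vderiv ^^ n) \<psi> x) \<le> B" by blast
  qed (intro has_vector_derivative_add schwartz_derivative assms)
  then show ?thesis by simp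
qed

text \<open>
  The \<open>n\<close>-th derivative of \<open>x \<phi>(x)\<close> is \<open>x \<phi>\<^sup>(\<^sup>n\<^sup>)(x) + n \<phi>\<^sup>(\<^sup>n\<^sup>-\<^sup>1\<^sup>)(x)\<close>, so its seminorms are controlled
  by those of \<open>\<phi>\<close> with one more power of \<open>x\<close> or one derivative less.
\<close>

lemma schwartz_mult_id:
  assumes "\<phi> \<in> schwartz" shows "(\<lambda>x. of_real x * \<phi> x) \<in> schwartz"
proof -
  define D where "D n x = of_real x * (vderiv ^^ n) \<phi> x + of_nat n * (vderiv ^^ (n - 1)) \<phi> x" for n x
  have "D 0 \<in> schwartz"
  proof (rule schwartzI)
    fix n :: nat and x :: real
    have "((\<lambda>x. of_nat n * (vderiv ^^ (n - 1)) \<phi> x) has_vector_derivative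
        of_nat n * (vderiv ^^ n) \<phi> x) (at x)"
      using has_vector_derivative_mult_right[OF schwartz_derivative[OF assms, of "n - 1" x], of "of_nat n"]
      by (cases "n = 0") (auto simp del: funpow.simps)
    moreover have "((\<lambda>x. of_real x * (vderiv ^^ n) \<phi> x) has_vector_derivative
        of_real x * (vderiv ^^ Suc n) \<phi> x + 1 * (vderiv ^^ n) \<phi> x) (at x)"
      using has_vector_derivative_of_real[OF DERIV_ident]
      by (intro has_vector_derivative_mult schwartz_derivative[OF assms]) simp
    ultimately have "(D n has_vector_derivative (of_real x * (vderiv ^^ Suc n) \<phi> x
        + 1 * (vderiv ^^ n) \<phi> x) + of_nat n * (vderiv ^^ n) \<phi> x) (at x)"
      unfolding D_def by (intro has_vector_derivative_add)
    then show "(D n has_vector_derivative D (Suc n) x) (at x)"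
      by (simp add: D_def algebra_simps)
  next
    fix m n :: nat
    have "\<bar>x\<bar> ^ m * norm (D n x)
        \<le> schwartz_seminorm (Suc m) n \<phi> + real n * schwartz_seminorm m (n - 1) \<phi>" for x
    proof -
      have "norm (D n x) \<le> \<bar>x\<bar> * norm ((vderiv ^^ n) \<phi> x) + real n * norm ((vderiv ^^ (n - 1)) \<phi> x)"
        unfolding D_def by (rule order_trans[OF norm_triangle_ineq]) (simp add: norm_mult)
      then have "\<bar>x\<bar> ^ m * norm (D n x) \<le> \<bar>x\<bar> ^ m *
          (\<bar>x\<bar> * norm ((vderiv ^^ n) \<phi> x) + real n * norm ((vderiv ^^ (n - 1)) \<phi> x))"
        by (intro mult_left_mono) auto
      also have "\<dots> = \<bar>x\<bar> ^ Suc m * norm ((vderiv ^^ n) \<phi> x)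
          + real n * (\<bar>x\<bar> ^ m * norm ((vderiv ^^ (n - 1)) \<phi> x))"
        by (simp add: algebra_simps)
      also have "\<dots> \<le> schwartz_seminorm (Suc m) n \<phi> + real n * schwartz_seminorm m (n - 1) \<phi>"
        by (intro add_mono mult_left_mono schwartz_seminorm_upper assms) auto
      finally show ?thesis .
    qed
    then show "\<exists>B. \<forall>x. \<bar>x\<bar> ^ m * norm (D n x) \<le> B" by blast
  qed
  then show ?thesis unfolding D_def by simp
qed

lemma schwartz_if_compact_support:
  assumes "smooth_on UNIV \<phi>" "\<And>x. r < \<bar>x\<bar> \<Longrightarrow> \<phi> x = 0"
  shows "\<phi> \<in> schwartz"
proof -
  have zero: "(vderiv ^^ n) \<phi> x = 0" if "r < \<bar>x\<bar>" for n x
    using that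
  proof (induction n arbitrary: x)
    case (Suc n)
    have "eventually (\<lambda>y. y \<in> {y. r < \<bar>y\<bar>}) (nhds x)"
      by (rule eventually_nhds_in_open) (use Suc.prems in \<open>auto intro!: open_Collect_less continuous_intros\<close>)
    then have "eventually (\<lambda>y. (vderiv ^^ n) \<phi> y = 0) (nhds x)"
      by eventually_elim (use Suc.IH in auto)
    then have "((vderiv ^^ n) \<phi> has_vector_derivative 0) (at x)"
      using has_vector_derivative_cong_ev[of UNIV "(vderiv ^^ n) \<phi>" "\<lambda>_. 0" x 0]
      Suc by (auto elim: eventually_mono simp del: funpow.simps)
    then show ?case by (simp add: vderiv_def[of "(vderiv ^^ n) \<phi>"] vector_derivative_at)
  qed (use assms in auto)
  have "(vderiv ^^ 0) \<phi> \<in> schwartz"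
  proof (rule schwartzI)
    fix n x show "((vderiv ^^ n) \<phi> has_vector_derivative (vderiv ^^ Suc n) \<phi> x) (at x)"
      by (rule smooth_on_has_vector_derivative[OF assms(1) UNIV_I])
  next
    fix m n :: nat
    have "continuous_on {-r..r} (\<lambda>x. \<bar>x\<bar> ^ m * norm ((vderiv ^^ n) \<phi> x))"
      by (intro continuous_intros continuous_at_imp_continuous_on ballI
          has_vector_derivative_continuous[OF smooth_on_has_vector_derivative[OF assms(1) UNIV_I]])
    then have "bounded ((\<lambda>x. \<bar>x\<bar> ^ m * norm ((vderiv ^^ n) \<phi> x)) ` {-r..r})"
      by (intro compact_imp_bounded compact_continuous_image) auto
    then obtain B where B: "\<And>x. x \<in> {-r..r} \<Longrightarrow> \<bar>x\<bar> ^ m * norm ((vderiv ^^ n) \<phi> x) \<le> B"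
      unfolding bounded_iff by fastforce
    have "\<bar>x\<bar> ^ m * norm ((vderiv ^^ n) \<phi> x) \<le> max B 0" for x
    proof (cases "r < \<bar>x\<bar>")
      case False
      then have "x \<in> {-r..r}" by auto
      then show ?thesis using B[of x] by linarith
    qed (simp add: zero)
    then show "\<exists>B. \<forall>x. \<bar>x\<bar> ^ m * norm ((vderiv ^^ n) \<phi> x) \<le> B" by blast
  qed
  then show ?thesis by simp
qed

lemma integrable_inverse_1_plus_square: "integrable lborel (\<lambda>x::real. inverse (1 + x\<^sup>2))"
proof -
  have 1: "set_integrable lborel {0<..} (\<lambda>x::real. inverse (1 + x\<^sup>2))"
    using integrable_I0i_1_div_plus_square by (simp add: interval_lebesgue_integrable_def einterval_def inverse_eq_divide greaterThan_def)
  then have "integrable lborel (\<lambda>x. (\<lambda>x. indicator {0<..} x *\<^sub>R inverse (1 + x\<^sup>2)) (0 + (-1) * x) :: real)"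
    unfolding set_integrable_def by (intro lborel_integrable_real_affine) auto
  then have "integrable lborel (\<lambda>x. indicator {..<0} x *\<^sub>R inverse (1 + x\<^sup>2) :: real)"
    by (rule Bochner_Integration.integrable_cong[THEN iffD1, rotated -1]) (auto simp: indicator_def)
  then have "integrable lborel (\<lambda>x. indicator {..<0} x *\<^sub>R inverse (1 + x\<^sup>2) +
      indicator {0<..} x *\<^sub>R inverse (1 + x\<^sup>2) :: real)"
    using 1 unfolding set_integrable_def by (rule Bochner_Integration.integrable_add)
  moreover have "AE x in lborel. indicator {..<0} x *\<^sub>R inverse (1 + x\<^sup>2) +
      indicator {0<..} x *\<^sub>R inverse (1 + x\<^sup>2) = inverse (1 + x\<^sup>2 :: real)"
    by (rule AE_mp[OF AE_lborel_singleton[of 0]]) (auto simp: indicator_def)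
  ultimately show ?thesis
    by (subst integrable_cong_AE[symmetric]) auto
qed

lemma integrable_if_decay:
  fixes \<phi> :: "real \<Rightarrow> complex"
  assumes [measurable]: "\<phi> \<in> borel_measurable borel" and "\<And>x. (1 + x\<^sup>2) * norm (\<phi> x) \<le> B"
  shows "integrable lborel \<phi>"
    and "(\<integral>x. norm (\<phi> x) \<partial>lborel) \<le> B * (\<integral>x. inverse (1 + x\<^sup>2) \<partial>lborel)"
proof -
  have le: "norm (\<phi> x) \<le> B * inverse (1 + x\<^sup>2)" for x
    using assms(2)[of x] by (simp add: field_simps add_pos_nonneg)
  show i: "integrable lborel \<phi>"
    by (rule Bochner_Integration.integrable_bound[OF integrable_mult_right[OF integrable_inverse_1_plus_square, of B]])
      (auto intro!: order_trans[OF le])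
  show "(\<integral>x. norm (\<phi> x) \<partial>lborel) \<le> B * (\<integral>x. inverse (1 + x\<^sup>2) \<partial>lborel)"
    using integral_mono[OF integrable_norm[OF i] integrable_mult_right[OF integrable_inverse_1_plus_square, of B]] le
    by simp
qed

lemma continuous_measurable_lborel: "continuous_on UNIV F \<Longrightarrow> F \<in> borel_measurable borel"
  for F :: "real \<Rightarrow> complex"
  by (rule borel_measurable_continuous_onI)

lemma
  assumes "\<phi> \<in> schwartz"
  shows schwartz_integrable: "integrable lborel \<phi>"
    and schwartz_norm_integral_le: "(\<integral>x. norm (\<phi> x) \<partial>lborel)
      \<le> (schwartz_seminorm 0 0 \<phi> + schwartz_seminorm 2 0 \<phi>) * (\<integral>x. inverse (1 + x\<^sup>2) \<partial>lborel)"
proof -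
  have "(1 + x\<^sup>2) * norm (\<phi> x) \<le> schwartz_seminorm 0 0 \<phi> + schwartz_seminorm 2 0 \<phi>" for x
    using schwartz_seminorm_upper[OF assms, of x 0 0] schwartz_seminorm_upper[OF assms, of x 2 0]
    by (simp add: algebra_simps)
  note * = integrable_if_decay[OF continuous_measurable_lborel[OF schwartz_continuous[OF assms]] this]
  show "integrable lborel \<phi>" "(\<integral>x. norm (\<phi> x) \<partial>lborel)
      \<le> (schwartz_seminorm 0 0 \<phi> + schwartz_seminorm 2 0 \<phi>) * (\<integral>x. inverse (1 + x\<^sup>2) \<partial>lborel)"
    by (fact *)+
qed

section \<open>The Fourier transform\<close>

lemma norm_exp_imaginary [simp]:
  "norm (exp (- (\<i> * of_real t))) = 1" "norm (exp (\<i> * of_real t)) = 1"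
  by (simp_all add: norm_exp_eq_Re)

lemma exp_imaginary_measurable [measurable]:
  fixes f :: "'a \<Rightarrow> real"
  assumes [measurable]: "f \<in> borel_measurable M"
  shows "(\<lambda>x. exp (- (\<i> * of_real (f x)))) \<in> borel_measurable M"
    "(\<lambda>x. exp (\<i> * of_real (f x))) \<in> borel_measurable M"
proof -
  have "(\<lambda>t::real. exp (- (\<i> * of_real t))) \<in> borel_measurable borel"
    "(\<lambda>t::real. exp (\<i> * of_real t)) \<in> borel_measurable borel"
    by (intro borel_measurable_continuous_onI continuous_intros)+
  from measurable_compose[OF assms this(1)] measurable_compose[OF assms this(2)]
  show "(\<lambda>x. exp (- (\<i> * of_real (f x)))) \<in> borel_measurable M"
    "(\<lambda>x. exp (\<i> * of_real (f x))) \<in> borel_measurable M" by simp_all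
qed

lemma
  assumes "integrable lborel \<phi>"
  shows integrable_mult_exp_neg: "integrable lborel (\<lambda>x. \<phi> x * exp (- (\<i> * of_real (\<xi> * x))))"
    and integrable_mult_exp: "integrable lborel (\<lambda>x. \<phi> x * exp (\<i> * of_real (\<xi> * x)))"
  using borel_measurable_integrable[OF assms]
  by (auto intro!: Bochner_Integration.integrable_bound[OF assms] simp: norm_mult simp del: of_real_mult)

lemma fourier_eq: "fourier \<phi> \<xi> = (1 / (2 * pi)) * (\<integral>x. \<phi> x * exp (- (\<i> * of_real (\<xi> * x))) \<partial>lborel)"
  by (simp add: fourier_def)

lemma norm_fourier_le:
  "norm (fourier \<phi> \<xi>) \<le> (\<integral>x. norm (\<phi> x) \<partial>lborel) / (2 * pi)"
proof -
  have "norm (\<integral>x. \<phi> x * exp (- (\<i> * of_real (\<xi> * x))) \<partial>lborel) \<le> (\<integral>x. norm (\<phi> x) \<partial>lborel)"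
    by (rule order_trans[OF integral_norm_bound]) (simp add: norm_mult del: of_real_mult)
  then show ?thesis
    unfolding fourier_eq by (simp add: norm_mult norm_divide field_simps del: of_real_mult)
qed

lemma fourier_cmult: "fourier (\<lambda>x. z * \<phi> x) \<xi> = z * fourier \<phi> \<xi>"
  unfolding fourier_eq by (simp add: mult.assoc)

lemma fourier_modulation:
  "fourier (\<lambda>x. exp (\<i> * of_real (a * x)) * \<phi> x) \<xi> = fourier \<phi> (\<xi> - a)"
proof -
  have "exp (\<i> * of_real (a * x)) * \<phi> x * exp (- (\<i> * of_real (\<xi> * x)))
      = \<phi> x * exp (- (\<i> * of_real ((\<xi> - a) * x)))" for x
  proof -
    have "exp (\<i> * of_real (a * x)) * \<phi> x * exp (- (\<i> * of_real (\<xi> * x)))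
        = \<phi> x * (exp (\<i> * of_real (a * x)) * exp (- (\<i> * of_real (\<xi> * x))))"
      by algebra
    also have "exp (\<i> * of_real (a * x)) * exp (- (\<i> * of_real (\<xi> * x))) = exp (- (\<i> * of_real ((\<xi> - a) * x)))"
      by (simp add: exp_add[symmetric] algebra_simps)
    finally show ?thesis .
  qed
  then show ?thesis unfolding fourier_eq by presburger
qed

lemma fourier_dilation:
  assumes "0 < r"
  shows "fourier (\<lambda>x. \<phi> (x / r)) \<xi> = r * fourier \<phi> (r * \<xi>)"
proof -
  have "(\<integral>x. \<phi> (x / r) * exp (- (\<i> * of_real (\<xi> * x))) \<partial>lborel)
      = r *\<^sub>R (\<integral>x. \<phi> x * exp (- (\<i> * of_real (r * \<xi> * x))) \<partial>lborel)"
    using assms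
    by (subst lborel_integral_real_affine[of r _ 0]) (simp_all add: mult_ac)
  then show ?thesis
    unfolding fourier_eq by (simp add: scaleR_conv_of_real mult_ac)
qed

lemma has_vector_derivative_if_quadratic:
  fixes F :: "real \<Rightarrow> 'a::real_normed_vector"
  assumes "\<And>y. norm (F y - F x - (y - x) *\<^sub>R D) \<le> C * (y - x)\<^sup>2"
  shows "(F has_vector_derivative D) (at x)"
  unfolding has_vector_derivative_def has_derivative_iff_norm
proof (intro conjI bounded_linear_scaleR_left)
  have "((\<lambda>y. C * \<bar>y - x\<bar>) \<longlongrightarrow> C * \<bar>x - x\<bar>) (at x)"
    by (intro tendsto_intros)
  then have lim: "((\<lambda>y. C * \<bar>y - x\<bar>) \<longlongrightarrow> 0) (at x)" by simp
  have "norm (norm (F y - F x - (y - x) *\<^sub>R D) / norm (y - x)) \<le> C * \<bar>y - x\<bar>" for y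
    using assms[of y] by (cases "y = x") (auto simp: divide_le_eq power2_eq_square mult.assoc)
  then have "eventually (\<lambda>y. norm (norm (F y - F x - (y - x) *\<^sub>R D) / norm (y - x)) \<le> C * \<bar>y - x\<bar>) (at x)"
    by (intro always_eventually allI)
  from Lim_null_comparison[OF this lim]
  show "((\<lambda>y. norm (F y - F x - (y - x) *\<^sub>R D) / norm (y - x)) \<longlongrightarrow> 0) (at x)" .
qed

text \<open>
  By Taylor's formula \<open>|e\<^sup>-\<^sup>i\<^sup>t - 1 + i t| \<le> t\<^sup>2 / 2\<close>, differentiating under the integral costs an
  error that is quadratic in the increment, with the second absolute moment of \<open>\<phi>\<close> as the factor.
\<close>

lemma fourier_has_vector_derivative:
  assumes 0: "integrable lborel \<phi>" and 1: "integrable lborel (\<lambda>x. of_real x * \<phi> x)"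
    and 2: "integrable lborel (\<lambda>x. of_real (x\<^sup>2) * \<phi> x)"
  shows "(fourier \<phi> has_vector_derivative fourier (\<lambda>x. - \<i> * of_real x * \<phi> x) \<xi>) (at \<xi>)"
proof (rule has_vector_derivative_if_quadratic)
  fix \<eta>
  let ?C = "(\<integral>x. norm (of_real (x\<^sup>2) * \<phi> x) \<partial>lborel)"
  let ?e = "\<lambda>\<xi> x. exp (- (\<i> * of_real (\<xi> * x)))"
  define r where "r x = \<phi> x * ?e \<eta> x - \<phi> x * ?e \<xi> x - of_real (\<eta> - \<xi>) * ((- \<i> * (of_real x * \<phi> x)) * ?e \<xi> x)" for x
  have i: "integrable lborel (\<lambda>x. (- \<i> * (of_real x * \<phi> x)) * ?e \<xi> x)"
    by (intro integrable_mult_exp_neg integrable_mult_right 1)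
  have diff3: "(\<integral>x. a x - b x - z * c x \<partial>lborel) = (\<integral>x. a x \<partial>lborel) - (\<integral>x. b x \<partial>lborel) - z * (\<integral>x. c x \<partial>lborel)"
    if "integrable lborel a" "integrable lborel b" "integrable lborel c" for a b c :: "real \<Rightarrow> complex" and z
    using that by simp
  have factor: "c * a - c * b - z * (c * d) = c * (a - b - z * d)" for a b c d z :: complex
    by (simp add: algebra_simps)
  have fourier_D: "fourier (\<lambda>x. - \<i> * of_real x * \<phi> x) \<xi>
      = (1 / (2 * pi)) * (\<integral>x. (- \<i> * (of_real x * \<phi> x)) * ?e \<xi> x \<partial>lborel)"
    unfolding fourier_eq by (simp only: mult.assoc)
  have r: "norm (r x) \<le> (\<eta> - \<xi>)\<^sup>2 * norm (of_real (x\<^sup>2) * \<phi> x)" for x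
  proof -
    have "r x = \<phi> x * ?e \<xi> x * (exp (\<i> * of_real (- ((\<eta> - \<xi>) * x))) - (1 + \<i> * of_real (- ((\<eta> - \<xi>) * x))))"
      unfolding r_def by (simp add: algebra_simps exp_add[symmetric])
    then have "norm (r x) = norm (\<phi> x) * norm (exp (\<i> * of_real (- ((\<eta> - \<xi>) * x))) - (1 + \<i> * of_real (- ((\<eta> - \<xi>) * x))))"
      by (simp only: norm_mult norm_exp_imaginary mult_1_right)
    also have "\<dots> \<le> norm (\<phi> x) * (\<bar>(\<eta> - \<xi>) * x\<bar>\<^sup>2 / 2)"
      using iexp_approx1[of "- ((\<eta> - \<xi>) * x)" 1]
      by (intro mult_left_mono) (simp_all add: power2_eq_square numeral_2_eq_2)
    also have "\<dots> \<le> (\<eta> - \<xi>)\<^sup>2 * norm (of_real (x\<^sup>2) * \<phi> x)"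
      by (simp add: norm_mult power_mult_distrib norm_power mult_ac)
    finally show ?thesis .
  qed
  have "fourier \<phi> \<eta> - fourier \<phi> \<xi> - (\<eta> - \<xi>) *\<^sub>R fourier (\<lambda>x. - \<i> * of_real x * \<phi> x) \<xi>
      = (1 / (2 * pi)) * (\<integral>x. r x \<partial>lborel)"
    unfolding fourier_eq[of \<phi>] fourier_D r_def
      diff3[OF integrable_mult_exp_neg[OF 0] integrable_mult_exp_neg[OF 0] i, of \<eta> \<xi> "of_real (\<eta> - \<xi>)"]
      scaleR_conv_of_real
    by (rule factor)
  also have "norm \<dots> \<le> norm (\<integral>x. r x \<partial>lborel)"
  proof -
    have "norm (1 / (2 * pi) :: complex) = 1 / (2 * pi)" by (simp add: norm_divide norm_mult)
    moreover have "1 / (2 * pi) \<le> 1" using pi_gt3 by simp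
    ultimately show ?thesis
      by (metis mult_right_mono mult_1 norm_ge_zero norm_mult)
  qed
  also have "\<dots> \<le> (\<integral>x. norm (r x) \<partial>lborel)" by (rule integral_norm_bound)
  also have "\<dots> \<le> (\<integral>x. (\<eta> - \<xi>)\<^sup>2 * norm (of_real (x\<^sup>2) * \<phi> x) \<partial>lborel)"
  proof (rule integral_mono[OF _ _ r])
    show "integrable lborel (\<lambda>x. norm (r x))"
      unfolding r_def
      by (rule integrable_norm Bochner_Integration.integrable_diff integrable_mult_right
          integrable_mult_exp_neg[OF 0] i)+
    show "integrable lborel (\<lambda>x. (\<eta> - \<xi>)\<^sup>2 * norm (of_real (x\<^sup>2) * \<phi> x))"
      by (intro integrable_mult_right integrable_norm 2)
  qed
  also have "\<dots> = ?C * (\<eta> - \<xi>)\<^sup>2" by simp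
  finally show "norm (fourier \<phi> \<eta> - fourier \<phi> \<xi> - (\<eta> - \<xi>) *\<^sub>R fourier (\<lambda>x. - \<i> * of_real x * \<phi> x) \<xi>) \<le> ?C * (\<eta> - \<xi>)\<^sup>2" .
qed

lemma fourier_continuous:
  assumes "integrable lborel \<phi>"
  shows "continuous_on UNIV (fourier \<phi>)"
  unfolding continuous_on_sequentially
proof (intro allI ballI impI)
  fix X :: "nat \<Rightarrow> real" and \<xi> :: real
  assume X: "(\<forall>n. X n \<in> UNIV) \<and> X \<longlonglongrightarrow> \<xi>"
  have "(\<lambda>n. \<integral>x. \<phi> x * exp (- (\<i> * of_real (X n * x))) \<partial>lborel)
      \<longlonglongrightarrow> (\<integral>x. \<phi> x * exp (- (\<i> * of_real (\<xi> * x))) \<partial>lborel)"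
  proof (rule integral_dominated_convergence)
    show "integrable lborel (\<lambda>x. norm (\<phi> x))" using assms by simp
    show "AE x in lborel. (\<lambda>n. \<phi> x * exp (- (\<i> * of_real (X n * x)))) \<longlonglongrightarrow> \<phi> x * exp (- (\<i> * of_real (\<xi> * x)))"
      using X by (intro AE_I2 tendsto_intros) auto
  qed (use borel_measurable_integrable[OF integrable_mult_exp_neg[OF assms]] in \<open>auto simp: norm_mult simp del: of_real_mult\<close>)
  then show "(fourier \<phi> \<circ> X) \<longlonglongrightarrow> fourier \<phi> \<xi>"
    unfolding o_def fourier_eq by (intro tendsto_intros)
qed

text \<open>
  Up to the factor \<open>1 / (2 \<pi>)\<close>, both sides are the double integral of \<open>\<phi>(x) \<psi>(y) e\<^sup>-\<^sup>i\<^sup>x\<^sup>y\<close>. This is the formula that turns the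
  transform of a distribution given by a function into the transform of that function.
\<close>

lemma integral_mult_fourier:
  assumes \<phi>: "integrable lborel \<phi>" and \<psi>: "integrable lborel \<psi>"
  shows "(\<integral>x. \<phi> x * fourier \<psi> x \<partial>lborel) = (\<integral>x. fourier \<phi> x * \<psi> x \<partial>lborel)"
proof -
  let ?k = "\<lambda>x y. \<phi> x * \<psi> y * exp (- (\<i> * of_real (x * y)))"
  have [measurable]: "\<phi> \<in> borel_measurable borel" "\<psi> \<in> borel_measurable borel"
    using \<phi> \<psi> by auto
  have "integrable (lborel \<Otimes>\<^sub>M lborel) (\<lambda>(x, y). ?k x y)"
  proof (rule lborel_pair.Fubini_integrable)
    show "(\<lambda>(x, y). ?k x y) \<in> borel_measurable (lborel \<Otimes>\<^sub>M lborel)"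
      unfolding split_beta' by measurable
    show "integrable lborel (\<lambda>x. \<integral>y. norm (case (x, y) of (x, y) \<Rightarrow> ?k x y) \<partial>lborel)"
      using \<phi> \<psi> by (simp add: norm_mult del: of_real_mult)
    show "AE x in lborel. integrable lborel (\<lambda>y. case (x, y) of (x, y) \<Rightarrow> ?k x y)"
      using integrable_mult_right[OF integrable_mult_exp_neg[OF \<psi>]]
      by (auto simp: mult.assoc simp del: of_real_mult)
  qed
  then have "(\<integral>y. (\<integral>x. ?k x y \<partial>lborel) \<partial>lborel) = (\<integral>x. (\<integral>y. ?k x y \<partial>lborel) \<partial>lborel)"
    by (rule lborel_pair.Fubini_integral)
  moreover have "(\<integral>x. ?k x y \<partial>lborel) = 2 * pi * (fourier \<phi> y * \<psi> y)" for y
  proof -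
    have "(\<integral>x. ?k x y \<partial>lborel) = (\<integral>x. (\<phi> x * exp (- (\<i> * of_real (y * x)))) * \<psi> y \<partial>lborel)"
      by (simp add: mult_ac)
    then show ?thesis
      by (simp add: fourier_eq del: of_real_mult)
  qed
  moreover have "(\<integral>y. ?k x y \<partial>lborel) = 2 * pi * (\<phi> x * fourier \<psi> x)" for x
    by (simp add: fourier_eq mult.assoc)
  ultimately show ?thesis by simp
qed

text \<open>
  The characteristic function of the standard normal distribution in the present normalisation.
\<close>

lemma fourier_gaussian: "fourier (\<lambda>x. of_real (sqrt (2 * pi) * std_normal_density x)) t = of_real (std_normal_density t)"
proof -
  have "(\<integral>x. std_normal_density x *\<^sub>R exp (\<i> * of_real (- t * x)) \<partial>lborel) = of_real (exp (- (t\<^sup>2) / 2))"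
    using fun_cong[OF char_std_normal_distribution, of "- t"] unfolding char_def
    by (subst (asm) integral_density) auto
  then have *: "(\<integral>x. of_real (sqrt (2 * pi) * std_normal_density x) * exp (- (\<i> * of_real (t * x))) \<partial>lborel)
      = of_real (sqrt (2 * pi) * exp (- (t\<^sup>2) / 2))"
    by (simp add: scaleR_conv_of_real mult.assoc)
  have "1 / (2 * pi) * (sqrt (2 * pi) * exp (- (t\<^sup>2) / 2)) = std_normal_density t"
  proof -
    have "sqrt (2 * pi) * sqrt (2 * pi) = 2 * pi" by simp
    then have "1 / (2 * pi) * sqrt (2 * pi) = 1 / sqrt (2 * pi)" by (simp add: field_simps)
    then show ?thesis unfolding std_normal_density_def by (metis mult.assoc)
  qed
  from this[symmetric] show ?thesis
    unfolding fourier_eq * by simp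
qed

text \<open>
  The integral is regularised by the factor \<open>e\<^sup>-\<^sup>(\<^sup>\<xi>\<^sup>/\<^sup>n\<^sup>)\<^sup>2\<^sup>/\<^sup>2\<close>. Moving the transform from \<open>\<phi>\<close> to the
  regularising factor turns the regularised integral into an average of \<open>\<phi>\<close> over a normal
  distribution around \<open>x\<close> of standard deviation \<open>1 / n\<close>, which tends to \<open>\<phi>(x)\<close>.
\<close>

theorem fourier_inversion:
  assumes int: "integrable lborel \<phi>" and cont: "continuous_on UNIV \<phi>" and bdd: "\<And>x. norm (\<phi> x) \<le> B"
    and int': "integrable lborel (fourier \<phi>)"
  shows "(\<integral>\<xi>. fourier \<phi> \<xi> * exp (\<i> * of_real (x * \<xi>)) \<partial>lborel) = \<phi> x"
proof -
  \<comment> \<open>the density without its normalising factor, so that \<open>G 0 = 1\<close>\<close>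
  define G where "G t = complex_of_real (sqrt (2 * pi) * std_normal_density t)" for t
  define J where "J n = (\<integral>\<xi>. fourier \<phi> \<xi> * (exp (\<i> * of_real (x * \<xi>)) * G (\<xi> / Suc n)) \<partial>lborel)" for n
  have G_exp: "G t = of_real (exp (- t\<^sup>2 / 2))" for t
    unfolding G_def std_normal_density_def by simp
  have G_le: "norm (G t) \<le> 1" for t unfolding G_exp by simp
  have [measurable]: "G \<in> borel_measurable borel" "\<phi> \<in> borel_measurable borel"
    "fourier \<phi> \<in> borel_measurable borel"
    unfolding G_def using int int' by auto
  have int_G: "integrable lborel G"
    unfolding G_def by (auto intro: integrable_mult_right integrable_normal_density)
  have "J \<longlonglongrightarrow> (\<integral>\<xi>. fourier \<phi> \<xi> * exp (\<i> * of_real (x * \<xi>)) \<partial>lborel)"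
    unfolding J_def
  proof (rule integral_dominated_convergence)
    show "integrable lborel (\<lambda>\<xi>. norm (fourier \<phi> \<xi>))" using int' by simp
    show "AE \<xi> in lborel. norm (fourier \<phi> \<xi> * (exp (\<i> * of_real (x * \<xi>)) * G (\<xi> / Suc n))) \<le> norm (fourier \<phi> \<xi>)" for n
      using G_le by (auto simp: norm_mult mult_left_le simp del: of_real_mult)
    show "AE \<xi> in lborel. (\<lambda>n. fourier \<phi> \<xi> * (exp (\<i> * of_real (x * \<xi>)) * G (\<xi> / Suc n)))
        \<longlonglongrightarrow> fourier \<phi> \<xi> * exp (\<i> * of_real (x * \<xi>))"
    proof (rule AE_I2)
      fix \<xi> :: real
      have "(\<lambda>n. \<xi> / Suc n) \<longlonglongrightarrow> 0" by (intro tendsto_divide_0[OF tendsto_const] filterlim_compose[OF filterlim_real_at_infinity_sequentially] filterlim_Suc)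
      then have "(\<lambda>n. G (\<xi> / Suc n)) \<longlonglongrightarrow> of_real (exp (- 0\<^sup>2 / 2))"
        unfolding G_exp by (intro tendsto_intros) auto
      then have "(\<lambda>n. fourier \<phi> \<xi> * (exp (\<i> * of_real (x * \<xi>)) * G (\<xi> / Suc n)))
        \<longlonglongrightarrow> fourier \<phi> \<xi> * (exp (\<i> * of_real (x * \<xi>)) * of_real (exp (- 0\<^sup>2 / 2)))"
        by (intro tendsto_intros)
      then show "(\<lambda>n. fourier \<phi> \<xi> * (exp (\<i> * of_real (x * \<xi>)) * G (\<xi> / Suc n)))
        \<longlonglongrightarrow> fourier \<phi> \<xi> * exp (\<i> * of_real (x * \<xi>))" by simp
    qed
  qed measurable
  moreover have "J n = (\<integral>s. \<phi> (x + s / Suc n) * of_real (std_normal_density s) \<partial>lborel)" for n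
  proof -
    let ?r = "real (Suc n)"
    have FG: "fourier (\<lambda>\<xi>. G (\<xi> / ?r)) y = ?r * of_real (std_normal_density (?r * y))" for y
      using fourier_dilation[of ?r G y] fourier_gaussian[of "?r * y"] by (simp add: G_def[abs_def])
    have int_Gr: "integrable lborel (\<lambda>\<xi>. G (\<xi> / ?r))"
      using lborel_integrable_real_affine[OF int_G, of "1 / ?r" 0] by (simp add: mult.commute)
    have "integrable lborel (\<lambda>\<xi>. exp (\<i> * of_real (x * \<xi>)) * G (\<xi> / ?r))"
      using integrable_mult_exp[OF int_Gr, of x] by (simp only: mult.commute)
    then have "J n = (\<integral>y. \<phi> y * fourier (\<lambda>\<xi>. exp (\<i> * of_real (x * \<xi>)) * G (\<xi> / ?r)) y \<partial>lborel)"
      unfolding J_def by (rule integral_mult_fourier[OF int, symmetric])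
    also have "\<dots> = (\<integral>y. \<phi> y * (?r * of_real (std_normal_density (?r * (y - x)))) \<partial>lborel)"
      unfolding fourier_modulation FG ..
    also have "\<dots> = (\<integral>s. \<phi> (x + s / ?r) * of_real (std_normal_density s) \<partial>lborel)"
      using of_nat_neq_0[of n, where 'a = complex]
      by (subst lborel_integral_real_affine[of "1 / ?r" _ x]) (simp_all add: scaleR_conv_of_real add.commute mult_ac)
    finally show ?thesis .
  qed
  then have "J = (\<lambda>n. \<integral>s. \<phi> (x + s / Suc n) * of_real (std_normal_density s) \<partial>lborel)" by blast
  moreover have "(\<lambda>n. \<integral>s. \<phi> (x + s / Suc n) * of_real (std_normal_density s) \<partial>lborel)
      \<longlonglongrightarrow> (\<integral>s. \<phi> x * of_real (std_normal_density s) \<partial>lborel)"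
  proof (rule integral_dominated_convergence)
    show "integrable lborel (\<lambda>s. B * std_normal_density s)"
      by (intro integrable_mult_right integrable_normal_density) simp
    show "AE s in lborel. norm (\<phi> (x + s / Suc n) * of_real (std_normal_density s)) \<le> B * std_normal_density s" for n
      using bdd by (auto simp: norm_mult intro!: mult_right_mono)
    show "AE s in lborel. (\<lambda>n. \<phi> (x + s / Suc n) * of_real (std_normal_density s))
        \<longlonglongrightarrow> \<phi> x * of_real (std_normal_density s)"
    proof (rule AE_I2)
      fix s :: real
      have "(\<lambda>n. x + s / Suc n) \<longlonglongrightarrow> x + 0"
        by (intro tendsto_intros tendsto_divide_0[OF tendsto_const] filterlim_compose[OF filterlim_real_at_infinity_sequentially] filterlim_Suc)
      then have "(\<lambda>n. \<phi> (x + s / Suc n)) \<longlonglongrightarrow> \<phi> x"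
        using continuous_on_tendsto_compose[OF cont] by auto
      then show "(\<lambda>n. \<phi> (x + s / Suc n) * of_real (std_normal_density s))
        \<longlonglongrightarrow> \<phi> x * of_real (std_normal_density s)" by (intro tendsto_intros)
    qed
  qed measurable
  moreover have "(\<integral>s. \<phi> x * of_real (std_normal_density s) \<partial>lborel) = \<phi> x"
    by (simp add: integral_normal_density)
  ultimately show ?thesis using LIMSEQ_unique by metis
qed

lemma integral_vector_derivative_eq_0:
  fixes F :: "real \<Rightarrow> complex"
  assumes "\<And>x. (F has_vector_derivative f x) (at x)" "continuous_on UNIV f" "integrable lborel f"
    and "(F \<longlongrightarrow> 0) at_top" "(F \<longlongrightarrow> 0) at_bot"
  shows "(\<integral>x. f x \<partial>lborel) = 0"
proof -
  have "(LBINT x=-\<infinity>..\<infinity>. f x) = 0 - 0"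
  proof (rule interval_integral_FTC_integrable)
    show "((F \<circ> real_of_ereal) \<longlongrightarrow> 0) (at_right (-\<infinity>))" "((F \<circ> real_of_ereal) \<longlongrightarrow> 0) (at_left \<infinity>)"
      using assms(4,5) by (simp_all add: ereal_tendsto_simps)
  qed (use assms in \<open>auto simp: continuous_on_eq_continuous_at set_integrable_def\<close>)
  then show ?thesis
    by (simp add: interval_lebesgue_integral_def einterval_def set_lebesgue_integral_def)
qed

lemma schwartz_tendsto_0:
  assumes "\<phi> \<in> schwartz"
  shows "(\<phi> \<longlongrightarrow> 0) at_top" "(\<phi> \<longlongrightarrow> 0) at_bot"
proof -
  have *: "norm (\<phi> x) \<le> norm (schwartz_seminorm 1 0 \<phi> / x)" if "x \<noteq> 0" for x
    using schwartz_seminorm_upper[OF assms, of x 1 0] that schwartz_seminorm_nonneg[OF assms, of 1 0]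
    by (simp add: field_simps)
  have "((\<lambda>x. norm (schwartz_seminorm 1 0 \<phi> / x)) \<longlongrightarrow> 0) F" if "F \<le> at_infinity" for F
    using that by (intro tendsto_norm_zero tendsto_divide_0[OF tendsto_const]) (simp add: filterlim_def filtermap_ident)
  note tendsto = this
  have "eventually (\<lambda>x::real. x \<noteq> 0) at_top" "eventually (\<lambda>x::real. x \<noteq> 0) at_bot"
    by (rule eventually_mono[OF eventually_gt_at_top[of "0::real"]], simp)
      (rule eventually_mono[OF eventually_gt_at_bot[of "0::real"]], simp)
  then show "(\<phi> \<longlongrightarrow> 0) at_top" "(\<phi> \<longlongrightarrow> 0) at_bot"
    by (blast intro: Lim_null_comparison[OF eventually_mono[OF _ *] tendsto]
        at_top_le_at_infinity at_bot_le_at_infinity)+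
qed

lemma fourier_vderiv:
  assumes "\<phi> \<in> schwartz"
  shows "fourier (vderiv \<phi>) \<xi> = \<i> * of_real \<xi> * fourier \<phi> \<xi>"
proof -
  let ?e = "\<lambda>x. exp (- (\<i> * of_real (\<xi> * x)))"
  let ?f = "\<lambda>x. \<phi> x * (- \<i> * of_real \<xi> * ?e x) + vderiv \<phi> x * ?e x"
  have e: "(?e has_vector_derivative - \<i> * of_real \<xi> * ?e x) (at x)" for x
  proof -
    have "((\<lambda>z. exp (- (\<i> * (of_real \<xi> * z)))) has_field_derivative - \<i> * of_real \<xi> * exp (- (\<i> * (of_real \<xi> * of_real x)))) (at (of_real x))"
      by (auto intro!: derivative_eq_intros)
    from field_vector_diff_chain_at[OF has_vector_derivative_of_real[OF DERIV_ident] this]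
    show ?thesis by (simp add: o_def)
  qed
  have v: "vderiv \<phi> \<in> schwartz" by (rule schwartz_vderiv[OF assms])
  have i1: "integrable lborel (\<lambda>x. - \<i> * of_real \<xi> * (\<phi> x * ?e x))"
    by (intro integrable_mult_right integrable_mult_exp_neg schwartz_integrable assms)
  have i2: "integrable lborel (\<lambda>x. vderiv \<phi> x * ?e x)"
    by (intro integrable_mult_exp_neg schwartz_integrable v)
  have "(\<integral>x. ?f x \<partial>lborel) = 0"
  proof (rule integral_vector_derivative_eq_0[where F = "\<lambda>x. \<phi> x * ?e x"])
    show "((\<lambda>x. \<phi> x * ?e x) has_vector_derivative ?f x) (at x)" for x
      by (intro has_vector_derivative_mult schwartz_has_vector_derivative assms e)
    show "continuous_on UNIV ?f"
      by (intro continuous_intros schwartz_continuous assms v)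
    show "integrable lborel ?f"
      using Bochner_Integration.integrable_add[OF i1 i2] by (simp add: mult_ac)
    show "((\<lambda>x. \<phi> x * ?e x) \<longlongrightarrow> 0) at_top" "((\<lambda>x. \<phi> x * ?e x) \<longlongrightarrow> 0) at_bot"
      using schwartz_tendsto_0[OF assms, THEN tendsto_norm_zero]
      by (auto simp: norm_mult simp del: of_real_mult intro!: tendsto_norm_zero_cancel[of "\<lambda>x. \<phi> x * ?e x"])
  qed
  then have "(\<integral>x. - \<i> * of_real \<xi> * (\<phi> x * ?e x) \<partial>lborel) + (\<integral>x. vderiv \<phi> x * ?e x \<partial>lborel) = 0"
    using Bochner_Integration.integral_add[OF i1 i2] by (simp add: mult_ac)
  then have "(\<integral>x. vderiv \<phi> x * ?e x \<partial>lborel) = \<i> * of_real \<xi> * (\<integral>x. \<phi> x * ?e x \<partial>lborel)"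
    by (simp add: add_eq_0_iff2)
  then show ?thesis unfolding fourier_eq by simp
qed

text \<open>
  Multiplication by \<open>\<xi>\<close> on the transform side is differentiation of the function.
\<close>

lemma schwartz_fourier_decay:
  assumes "\<phi> \<in> schwartz"
  shows "\<bar>\<xi>\<bar> ^ m * norm (fourier \<phi> \<xi>) \<le> (\<integral>x. norm ((vderiv ^^ m) \<phi> x) \<partial>lborel) / (2 * pi)"
proof -
  have "\<bar>\<xi>\<bar> ^ m * norm (fourier \<phi> \<xi>) = norm (fourier ((vderiv ^^ m) \<phi>) \<xi>) \<and> (vderiv ^^ m) \<phi> \<in> schwartz"
    by (induction m) (auto simp: assms schwartz_vderiv fourier_vderiv norm_mult)
  then show ?thesis using norm_fourier_le[of "(vderiv ^^ m) \<phi>" \<xi>] by simp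
qed

text \<open>
  Each derivative of the transform is the transform of the Schwartz function
  \<open>(- i x)\<^sup>n \<phi>(x)\<close>, and transforms of Schwartz functions decay faster than any power.
\<close>

lemma schwartz_fourier:
  assumes "\<phi> \<in> schwartz"
  shows "fourier \<phi> \<in> schwartz"
proof -
  define \<Phi> where "\<Phi> n = ((\<lambda>\<psi> x. - \<i> * (of_real x * \<psi> x)) ^^ n) \<phi>" for n
  have \<Phi>: "\<Phi> n \<in> schwartz" for n
    unfolding \<Phi>_def by (induction n) (auto simp: assms schwartz_cmult[OF schwartz_mult_id, of _ "-\<i>", simplified])
  have "fourier (\<Phi> 0) \<in> schwartz"
  proof (rule schwartzI[of "\<lambda>n. fourier (\<Phi> n)"])
    fix n x
    have "integrable lborel (\<lambda>x. of_real x * (of_real x * \<Phi> n x))"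
      by (intro schwartz_integrable schwartz_mult_id \<Phi>)
    then have "integrable lborel (\<lambda>x. of_real (x\<^sup>2) * \<Phi> n x)"
      by (simp add: power2_eq_square mult.assoc)
    then have "(fourier (\<Phi> n) has_vector_derivative fourier (\<lambda>x. - \<i> * of_real x * \<Phi> n x) x) (at x)"
      by (rule fourier_has_vector_derivative[OF schwartz_integrable[OF \<Phi>]
            schwartz_integrable[OF schwartz_mult_id[OF \<Phi>]]])
    then show "(fourier (\<Phi> n) has_vector_derivative fourier (\<Phi> (Suc n)) x) (at x)"
      by (simp add: \<Phi>_def mult.assoc)
  next
    fix m n :: nat
    show "\<exists>B. \<forall>x. \<bar>x\<bar> ^ m * norm (fourier (\<Phi> n) x) \<le> B"
      using schwartz_fourier_decay[OF \<Phi>[of n], where m = m] by blast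
  qed
  then show ?thesis by (simp add: \<Phi>_def)
qed

lemma schwartz_bound: "\<phi> \<in> schwartz \<Longrightarrow> norm (\<phi> x) \<le> schwartz_seminorm 0 0 \<phi>"
  using schwartz_seminorm_upper[of \<phi> x 0 0] by simp

lemma schwartz_fourier_inversion:
  assumes "\<phi> \<in> schwartz"
  shows "(\<integral>\<xi>. fourier \<phi> \<xi> * exp (\<i> * of_real (x * \<xi>)) \<partial>lborel) = \<phi> x"
  by (rule fourier_inversion[OF schwartz_integrable[OF assms] schwartz_continuous[OF assms]
        schwartz_bound[OF assms] schwartz_integrable[OF schwartz_fourier[OF assms]]])

section \<open>Bump functions\<close>

text \<open>
  For \<open>q = 1\<close> this is the standard smooth function that vanishes to infinite order at \<open>0\<close>. The
  polynomial factor makes the family closed under differentiation.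
\<close>

definition flat :: "real poly \<Rightarrow> real \<Rightarrow> complex" where
  "flat q x = (if 0 < x then of_real (poly q (1 / x) * exp (- (1 / x))) else 0)"

lemma poly_mult_exp_neg_bounded:
  fixes q :: "real poly"
  shows "\<exists>B. \<forall>t>0. \<bar>poly q t * exp (- t)\<bar> \<le> B"
proof -
  have pow: "t ^ n * exp (- t) \<le> real n ^ n" if "0 < t" for t :: real and n
  proof (cases "n = 0")
    case False
    have "(t / n) ^ n \<le> (1 + t / n) ^ n"
      using that by (intro power_mono) auto
    also have "\<dots> \<le> exp t"
      using False that by (intro exp_ge_one_plus_x_over_n_power_n) auto
    finally show ?thesis
      using False by (simp add: exp_minus field_simps power_divide)
  qed (use that in auto)
  have "\<bar>poly q t * exp (- t)\<bar> \<le> (\<Sum>i\<le>degree q. \<bar>coeff q i\<bar> * real i ^ i)" if "0 < t" for t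
  proof -
    have "poly q t * exp (- t) = (\<Sum>i\<le>degree q. coeff q i * (t ^ i * exp (- t)))"
      by (simp add: poly_altdef sum_distrib_right mult.assoc)
    also have "\<bar>\<dots>\<bar> \<le> (\<Sum>i\<le>degree q. \<bar>coeff q i\<bar> * real i ^ i)"
      using that by (intro order_trans[OF sum_abs] sum_mono) (auto simp: abs_mult intro!: mult_left_mono pow)
    finally show ?thesis .
  qed
  then show ?thesis by blast
qed

text \<open>
  At the origin the function is bounded by a multiple of \<open>x\<^sup>2\<close>, because \<open>e\<^sup>-\<^sup>t\<close> absorbs every
  polynomial in \<open>t = 1 / x\<close>.
\<close>

lemma flat_has_vector_derivative:
  "(flat q has_vector_derivative flat ([:0, 0, 1:] * (q - pderiv q)) x) (at x)"
proof -
  consider "0 < x" | "x < 0" | "x = 0" by linarith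
  then show ?thesis
  proof cases
    case 1
    have "((\<lambda>x. poly q (1 / x) * exp (- (1 / x))) has_real_derivative
        poly ([:0, 0, 1:] * (q - pderiv q)) (1 / x) * exp (- (1 / x))) (at x)"
      using 1 by (auto intro!: derivative_eq_intros simp: field_simps)
    from has_vector_derivative_of_real[OF this]
    show ?thesis
      by (rule has_vector_derivative_transform_within_open[where S = "{0<..}", THEN has_vector_derivative_eq_rhs])
        (use 1 in \<open>auto simp: flat_def\<close>)
  next
    case 2
    have "((\<lambda>x. 0) has_vector_derivative (0::complex)) (at x)" by simp
    then show ?thesis
      by (rule has_vector_derivative_transform_within_open[where S = "{..<0}", THEN has_vector_derivative_eq_rhs])
        (use 2 in \<open>auto simp: flat_def\<close>)
  next
    case 3
    obtain B where B: "\<And>t. 0 < t \<Longrightarrow> \<bar>poly ([:0, 0, 1:] * q) t * exp (- t)\<bar> \<le> B"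
      using poly_mult_exp_neg_bounded by blast
    have "0 \<le> B" using order_trans[OF abs_ge_zero B[of 1]] by simp
    have "(flat q has_vector_derivative 0) (at 0)"
    proof (rule has_vector_derivative_if_quadratic)
      fix y :: real
      show "norm (flat q y - flat q 0 - (y - 0) *\<^sub>R 0) \<le> B * (y - 0)\<^sup>2"
        using B[of "1 / y"] \<open>0 \<le> B\<close>
        by (auto simp: flat_def norm_mult abs_mult field_simps power2_eq_square)
    qed
    then show ?thesis using 3 by (simp add: flat_def)
  qed
qed

lemma smooth_flat: "smooth_on UNIV (flat q)"
  using smooth_onI[of "\<lambda>n. flat (((\<lambda>q. [:0, 0, 1:] * (q - pderiv q)) ^^ n) q)"] flat_has_vector_derivative
  by simp

text \<open>
  The product of two flat functions at \<open>- 1\<close> and \<open>1\<close>, scaled to the value \<open>1\<close> at its maximum \<open>0\<close>.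
\<close>

lemma bump_exists:
  obtains \<beta> :: "real \<Rightarrow> real" where "smooth_on UNIV (\<lambda>x. complex_of_real (\<beta> x))"
    "\<And>x. 0 \<le> \<beta> x" "\<And>x. \<beta> x \<le> 1" "\<beta> 0 = 1" "\<And>x. 1 \<le> \<bar>x\<bar> \<Longrightarrow> \<beta> x = 0"
proof
  define \<beta> where "\<beta> x = (if \<bar>x\<bar> < 1 then exp (2 - (1 / (1 + x) + 1 / (1 - x))) else 0)" for x :: real
  have exp_eq: "exp (2 - (a + b)) = exp (- a) * (exp 2 * exp (- b))" for a b :: real
    by (simp flip: exp_add)
  have "complex_of_real (\<beta> x) = flat 1 (1 * x + 1) * flat [:exp 2:] ((-1) * x + 1)" for x
    unfolding \<beta>_def flat_def exp_eq by (auto simp: abs_if add.commute)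
  then show "smooth_on UNIV (\<lambda>x. complex_of_real (\<beta> x))"
    by (simp only:) (intro smooth_mult smooth_affine smooth_flat)
  show "0 \<le> \<beta> x" "\<beta> 0 = 1" "1 \<le> \<bar>x\<bar> \<Longrightarrow> \<beta> x = 0" for x
    by (auto simp: \<beta>_def)
  show "\<beta> x \<le> 1" for x
  proof (cases "\<bar>x\<bar> < 1")
    case True
    have "2 * ((1 + x) * (1 - x)) \<le> 2" by (simp add: algebra_simps)
    moreover have "0 < 1 + x" "0 < 1 - x" using True by auto
    ultimately have "2 \<le> 1 / (1 + x) + 1 / (1 - x)"
      by (simp add: add_frac_eq pos_le_divide_eq)
    then show ?thesis using True by (simp add: \<beta>_def)
  qed (simp add: \<beta>_def)
qed

section \<open>The essential supremum of a continuous function\<close>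

lemma Linf_norm_le:
  assumes "F \<in> borel_measurable (lebesgue_on S)" "\<And>x. x \<in> S \<Longrightarrow> norm (F x) \<le> B"
  shows "Linf_norm S F \<le> ereal B"
  unfolding Linf_norm_def using assms
  by (intro esssup_I AE_I2) (auto simp: space_restrict_space)

lemma Linf_norm_UNIV_le:
  assumes "continuous_on UNIV F" "\<And>x. norm (F x) \<le> B"
  shows "Linf_norm UNIV F \<le> ereal B"
  using assms by (intro Linf_norm_le continuous_imp_measurable_on_sets_lebesgue) auto

lemma Linf_norm_interval_le:
  assumes "continuous_on {-1..1} F" "\<And>x. x \<in> {-1..1} \<Longrightarrow> norm (F x) \<le> B"
  shows "Linf_norm {-1..1} F \<le> ereal B"
  using assms by (intro Linf_norm_le continuous_imp_measurable_on_sets_lebesgue) auto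

text \<open>
  A closed set that contains almost every point of \<open>(- 1, 1)\<close> contains \<open>[- 1, 1]\<close>.
\<close>

lemma Linf_norm_interval_ge:
  fixes F :: "real \<Rightarrow> complex"
  assumes cont: "continuous_on {-1..1} F" and x: "x \<in> {-1..1}"
  shows "ereal (norm (F x)) \<le> Linf_norm {-1..1} F"
proof -
  define M where "M = Linf_norm {-1..1} F"
  define C where "C = {x \<in> {-1..1}. ereal (norm (F x)) \<le> M}"
  have "closed C"
  proof (cases M)
    case (real m)
    then have "C = {x \<in> {-1..1}. norm (F x) \<le> m}" by (auto simp: C_def)
    moreover have "closed {x \<in> {-1..1}. norm (F x) \<le> m}"
      by (intro continuous_on_closed_Collect_le continuous_on_norm continuous_on_const cont) simp
    ultimately show ?thesis by simp
  next
    case PInf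
    then have "C = {-1..1}" by (auto simp: C_def)
    then show ?thesis by simp
  qed (simp add: C_def)
  have "AE y in lebesgue_on {-1..1}. ereal (norm (F y)) \<le> M"
    unfolding M_def Linf_norm_def by (rule esssup_AE)
  then have "AE y in lebesgue. y \<in> {-1..1} \<longrightarrow> ereal (norm (F y)) \<le> M"
    by (subst (asm) AE_restrict_space_iff) auto
  then have "AE y \<in> {-1<..<1} in lebesgue. y \<in> C"
    by eventually_elim (auto simp: C_def)
  then have "{-1<..<1} \<subseteq> C"
    using mem_closed_if_AE_lebesgue_open[OF open_greaterThanLessThan \<open>closed C\<close>] by blast
  then have "closure {-1<..<1::real} \<subseteq> C"
    by (rule closure_minimal[OF _ \<open>closed C\<close>])
  then show ?thesis using x by (auto simp: C_def M_def closure_greaterThanLessThan)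
qed

lemma Linf_norm_attained:
  fixes F :: "real \<Rightarrow> complex"
  assumes "continuous_on {-1..1} F"
  obtains x\<^sub>0 where "x\<^sub>0 \<in> {-1..1}" "\<And>x. x \<in> {-1..1} \<Longrightarrow> norm (F x) \<le> norm (F x\<^sub>0)"
    "Linf_norm {-1..1} F = ereal (norm (F x\<^sub>0))"
proof -
  have "continuous_on {-1..1} (\<lambda>x. norm (F x))" by (intro continuous_intros assms)
  then obtain x\<^sub>0 where x\<^sub>0: "x\<^sub>0 \<in> {-1..1}" "\<And>x. x \<in> {-1..1} \<Longrightarrow> norm (F x) \<le> norm (F x\<^sub>0)"
    using continuous_attains_sup[of "{-1..1::real}" "\<lambda>x. norm (F x)"] by auto
  moreover have "Linf_norm {-1..1} F = ereal (norm (F x\<^sub>0))"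
    by (intro antisym Linf_norm_interval_le Linf_norm_interval_ge assms x\<^sub>0)
  ultimately show ?thesis using that by blast
qed

section \<open>The band of an admissible approximation\<close>

lemma fourier_dist_of_fun:
  assumes "\<phi> \<in> schwartz" "\<psi> \<in> schwartz"
  shows "fourier_dist (dist_of_fun \<phi>) \<psi> = (\<integral>\<xi>. fourier \<phi> \<xi> * \<psi> \<xi> \<partial>lborel)"
  unfolding fourier_dist_def dist_of_fun_def
  by (intro integral_mult_fourier schwartz_integrable assms)

lemma bandlimit_if_fourier_vanishes:
  assumes "\<phi> \<in> schwartz" "\<And>\<xi>. c < \<bar>\<xi>\<bar> \<Longrightarrow> fourier \<phi> \<xi> = 0"
  shows "bandlimit (dist_of_fun \<phi>) c"
proof -
  have "dist_vanishes_on (fourier_dist (dist_of_fun \<phi>)) (- {-c..c})"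
    unfolding dist_vanishes_on_def
  proof (intro ballI impI)
    fix \<psi> assume \<psi>: "\<psi> \<in> schwartz" "compact (supp \<psi>) \<and> supp \<psi> \<subseteq> - {- c..c}"
    have "fourier \<phi> \<xi> * \<psi> \<xi> = 0" for \<xi>
      using \<psi>(2) assms(2)[of \<xi>] closure_subset[of "{x. \<psi> x \<noteq> 0}"] unfolding supp_def
      by (cases "c < \<bar>\<xi>\<bar>") (auto simp: abs_le_iff subset_iff)
    then have "(\<lambda>\<xi>. fourier \<phi> \<xi> * \<psi> \<xi>) = (\<lambda>_. 0)" by (rule ext)
    then show "fourier_dist (dist_of_fun \<phi>) \<psi> = 0"
      unfolding fourier_dist_of_fun[OF assms(1) \<psi>(1)] by (simp only:) simp
  qed
  moreover have "open (- {-c..c})" by auto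
  ultimately show ?thesis unfolding bandlimit_def dist_support_def by blast
qed

text \<open>
  If the transform, a continuous function, were different from \<open>0\<close> at \<open>\<xi>\<close>, a constant multiple of it
  would have positive real part near \<open>\<xi>\<close>, and so would its integral against a narrow bump there. But
  this integral is \<open>0\<close>, because the distribution vanishes on a neighbourhood of \<open>\<xi>\<close>.
\<close>

lemma fourier_vanishes_if_bandlimit:
  assumes \<phi>: "\<phi> \<in> schwartz" and band: "bandlimit (dist_of_fun \<phi>) c" and \<xi>: "c < \<bar>\<xi>\<bar>"
  shows "fourier \<phi> \<xi> = 0"
proof (rule ccontr)
  define z where "z = fourier \<phi> \<xi>"
  define a where "a \<eta> = Re (cnj z * fourier \<phi> \<eta>)" for \<eta>
  assume "fourier \<phi> \<xi> \<noteq> 0"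
  then have a_pos: "0 < a \<xi>" by (auto simp: a_def z_def complex_eq_iff intro: sum_squares_gt_zero_iff[THEN iffD2])
  have cont: "continuous_on UNIV (fourier \<phi>)" by (intro fourier_continuous schwartz_integrable \<phi>)
  then have cont_a: "continuous_on UNIV a" unfolding a_def by (intro continuous_intros)
  have "\<xi> \<notin> {-c..c}" using \<xi> by auto
  then obtain U where U: "open U" "\<xi> \<in> U" "dist_vanishes_on (fourier_dist (dist_of_fun \<phi>)) U"
    using band unfolding bandlimit_def dist_support_def by blast
  have "open (U \<inter> {\<eta>. 0 < a \<eta>})"
    by (intro open_Int U open_Collect_less continuous_intros cont_a)
  then obtain r where r: "0 < r" "cball \<xi> r \<subseteq> U \<inter> {\<eta>. 0 < a \<eta>}"
    using a_pos U(2) open_contains_cball by blast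
  obtain \<beta> where \<beta>: "smooth_on UNIV (\<lambda>x. complex_of_real (\<beta> x))" "\<And>x. 0 \<le> \<beta> x" "\<And>x. \<beta> x \<le> 1" "\<beta> 0 = 1"
    "\<And>x. 1 \<le> \<bar>x\<bar> \<Longrightarrow> \<beta> x = 0" by (rule bump_exists) auto
  \<comment> \<open>a bump around \<open>\<xi>\<close> of radius \<open>r\<close>, on whose support the real part \<open>a\<close> is positive\<close>
  define \<psi> where "\<psi> \<eta> = \<beta> (1 / r * \<eta> + (- \<xi> / r))" for \<eta>
  have \<psi>_0: "\<psi> \<eta> = 0" if "\<eta> \<notin> cball \<xi> r" for \<eta>
  proof -
    have "r \<le> \<bar>\<eta> - \<xi>\<bar>" using that by (auto simp: dist_real_def)
    then have "1 \<le> \<bar>1 / r * \<eta> + (- \<xi> / r)\<bar>" using r(1) by (auto simp: abs_if field_simps split: if_splits)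
    then show ?thesis unfolding \<psi>_def by (rule \<beta>(5))
  qed
  have smooth: "smooth_on UNIV (\<lambda>\<eta>. complex_of_real (\<psi> \<eta>))"
    unfolding \<psi>_def by (rule smooth_affine[OF \<beta>(1)])
  have \<psi>: "(\<lambda>\<eta>. complex_of_real (\<psi> \<eta>)) \<in> schwartz"
  proof (rule schwartz_if_compact_support[OF smooth])
    show "complex_of_real (\<psi> \<eta>) = 0" if "\<bar>\<xi>\<bar> + r < \<bar>\<eta>\<bar>" for \<eta>
      using that by (auto simp: dist_real_def intro!: \<psi>_0)
  qed
  have supp: "supp (\<lambda>\<eta>. complex_of_real (\<psi> \<eta>)) \<subseteq> cball \<xi> r"
  proof -
    have "{\<eta>. complex_of_real (\<psi> \<eta>) \<noteq> 0} \<subseteq> cball \<xi> r"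
      using \<psi>_0 by (metis (mono_tags, lifting) mem_Collect_eq of_real_0 subsetI)
    then show ?thesis unfolding supp_def by (rule closure_minimal) simp
  qed
  then have "compact (supp (\<lambda>\<eta>. complex_of_real (\<psi> \<eta>)))"
    unfolding supp_def by (meson bounded_cball bounded_subset closed_closure compact_eq_bounded_closed)
  then have "fourier_dist (dist_of_fun \<phi>) (\<lambda>\<eta>. complex_of_real (\<psi> \<eta>)) = 0"
    using U(3) \<psi> supp r(2) unfolding dist_vanishes_on_def by blast
  then have int_0: "(\<integral>\<eta>. fourier \<phi> \<eta> * complex_of_real (\<psi> \<eta>) \<partial>lborel) = 0"
    by (simp add: fourier_dist_of_fun[OF \<phi> \<psi>])
  have "integrable lborel (\<lambda>\<eta>. fourier \<phi> \<eta> * complex_of_real (\<psi> \<eta>))"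
  proof (rule Bochner_Integration.integrable_bound[OF schwartz_integrable[OF schwartz_fourier[OF \<phi>]]])
    show "(\<lambda>\<eta>. fourier \<phi> \<eta> * complex_of_real (\<psi> \<eta>)) \<in> borel_measurable lborel"
      using continuous_measurable_lborel[OF cont] continuous_measurable_lborel[OF schwartz_continuous[OF \<psi>]]
      by simp
    show "AE \<eta> in lborel. norm (fourier \<phi> \<eta> * complex_of_real (\<psi> \<eta>)) \<le> norm (fourier \<phi> \<eta>)"
      using \<beta>(2,3) by (auto simp: norm_mult \<psi>_def intro!: mult_left_le)
  qed
  note int = integrable_mult_right[OF this, of "cnj z"]
  have a\<psi>: "a \<eta> * \<psi> \<eta> = Re (cnj z * (fourier \<phi> \<eta> * complex_of_real (\<psi> \<eta>)))" for \<eta>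
    by (simp add: a_def algebra_simps)
  have "integrable lborel (\<lambda>\<eta>. a \<eta> * \<psi> \<eta>)" "(\<integral>\<eta>. a \<eta> * \<psi> \<eta> \<partial>lborel) = 0"
    unfolding a\<psi> using integrable_Re[OF int] integral_Re[OF int] int_0 by simp_all
  moreover have "0 \<le> a \<eta> * \<psi> \<eta>" for \<eta>
    using r(2) \<beta>(2) \<psi>_0[of \<eta>] by (cases "\<eta> \<in> cball \<xi> r") (auto simp: \<psi>_def intro!: mult_nonneg_nonneg)
  ultimately have "AE \<eta> in lborel. a \<eta> * \<psi> \<eta> = 0"
    by (subst (asm) integral_nonneg_eq_0_iff_AE) auto
  then have "AE \<eta> in lebesgue. \<eta> \<in> {\<eta>. a \<eta> * \<psi> \<eta> = 0}"
    by (simp add: AE_completion)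
  moreover have "closed {\<eta>. a \<eta> * \<psi> \<eta> = 0}"
  proof -
    have "continuous_on UNIV (\<lambda>\<eta>. Re (complex_of_real (\<psi> \<eta>)))"
      by (intro continuous_intros schwartz_continuous[OF \<psi>])
    then show ?thesis by (intro closed_Collect_eq continuous_intros cont_a) simp
  qed
  ultimately have "a \<xi> * \<psi> \<xi> = 0" using mem_closed_if_AE_lebesgue by blast
  moreover have "\<psi> \<xi> = 1" using \<beta>(4) r(1) by (simp add: \<psi>_def)
  ultimately show False using a_pos by simp
qed

lemma integrable_const_indicator_Icc: "integrable lborel (\<lambda>x::real. B * indicator {a..b} x :: real)"
  by (intro integrable_mult_right integrable_real_indicator) (auto simp: emeasure_lborel_Icc_eq)

text \<open>
  At a point where \<open>|F|\<close> attains its maximum \<open>N\<close>, the approximation still has modulus at least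
  \<open>(1 - \<epsilon>) N\<close>. It is the integral of its transform, which is at most \<open>4 N\<close> and lives on \<open>[- c, c]\<close>,
  so its modulus is at most \<open>8 c N\<close>.
\<close>

lemma admissible_bandlimit_ge:
  assumes F: "continuous_on {-1..1} F" "x \<in> {-1..1}" "F x \<noteq> 0" and "0 < \<epsilon>" "0 < c"
    and Fb: "Fb \<in> schwartz" "bandlimit (dist_of_fun Fb) c"
    and close: "Linf_norm {-1..1} (\<lambda>x. F x - Fb x) \<le> ereal \<epsilon> * Linf_norm {-1..1} F"
    and hat: "Linf_norm UNIV (fourier Fb) \<le> 4 * Linf_norm {-1..1} F"
  shows "(1 - \<epsilon>) / 8 \<le> c"
proof -
  obtain x\<^sub>0 where x\<^sub>0: "x\<^sub>0 \<in> {-1..1}" "\<And>x. x \<in> {-1..1} \<Longrightarrow> norm (F x) \<le> norm (F x\<^sub>0)"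
    "Linf_norm {-1..1} F = ereal (norm (F x\<^sub>0))"
    using Linf_norm_attained[OF F(1)] by blast
  define N where "N = norm (F x\<^sub>0)"
  have N: "Linf_norm {-1..1} F = ereal N" "0 < N"
    using x\<^sub>0(3) x\<^sub>0(2)[OF F(2)] F(3) unfolding N_def by (auto intro: less_le_trans[of _ "norm (F x)"])
  have cont: "continuous_on {-1..1} (\<lambda>x. F x - Fb x)"
    by (intro continuous_intros F(1) continuous_on_subset[OF schwartz_continuous[OF Fb(1)]]) auto
  have "ereal (norm (F x\<^sub>0 - Fb x\<^sub>0)) \<le> ereal (\<epsilon> * N)"
    using order_trans[OF Linf_norm_interval_ge[OF cont x\<^sub>0(1)] close] N by simp
  then have 1: "(1 - \<epsilon>) * N \<le> norm (Fb x\<^sub>0)"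
    using norm_triangle_ineq2[of "F x\<^sub>0" "F x\<^sub>0 - Fb x\<^sub>0"] by (simp add: N_def algebra_simps)
  have "AE \<xi> in lebesgue. ereal (norm (fourier Fb \<xi>)) \<le> Linf_norm UNIV (fourier Fb)"
    unfolding Linf_norm_def lebesgue_on_UNIV_eq by (rule esssup_AE)
  then have "AE \<xi> in lebesgue. norm (fourier Fb \<xi>) \<le> 4 * N"
  proof eventually_elim
    case (elim \<xi>)
    also note hat
    finally show ?case using N(1) by simp
  qed
  then have AE: "AE \<xi> in lborel. norm (fourier Fb \<xi>) \<le> 4 * N"
    by (simp add: AE_completion_iff)
  have "norm (Fb x\<^sub>0) = norm (\<integral>\<xi>. fourier Fb \<xi> * exp (\<i> * of_real (x\<^sub>0 * \<xi>)) \<partial>lborel)"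
    using schwartz_fourier_inversion[OF Fb(1), of x\<^sub>0] by simp
  also have "\<dots> \<le> (\<integral>\<xi>. norm (fourier Fb \<xi> * exp (\<i> * of_real (x\<^sub>0 * \<xi>))) \<partial>lborel)"
    by (rule integral_norm_bound)
  also have "\<dots> = (\<integral>\<xi>. norm (fourier Fb \<xi>) \<partial>lborel)"
    by (simp add: norm_mult del: of_real_mult)
  also have "\<dots> \<le> (\<integral>\<xi>. 4 * N * indicator {-c..c} \<xi> \<partial>lborel)"
  proof (rule integral_mono_AE)
    show "integrable lborel (\<lambda>\<xi>. norm (fourier Fb \<xi>))"
      using schwartz_integrable[OF schwartz_fourier[OF Fb(1)]] by simp
    show "AE \<xi> in lborel. norm (fourier Fb \<xi>) \<le> 4 * N * indicator {-c..c} \<xi>"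
      using AE
    proof eventually_elim
      case (elim \<xi>)
      then show ?case using fourier_vanishes_if_bandlimit[OF Fb, of \<xi>]
        by (cases "c < \<bar>\<xi>\<bar>") (auto simp: indicator_def abs_le_iff)
    qed
  qed (rule integrable_const_indicator_Icc)
  also have "\<dots> = 8 * c * N" using \<open>0 < c\<close> by simp
  finally have "(1 - \<epsilon>) * N \<le> (8 * c) * N" using 1 by linarith
  then show ?thesis using N(2) by (simp add: mult_le_cancel_right)
qed


section \<open>Existence of admissible approximations\<close>

text \<open>
  Uniform continuity handles close arguments; for distant ones the difference of the values is
  bounded and hence at most a multiple of the distance. The resulting bound is linear in the
  distance, so that it can be integrated against a kernel with a finite first moment.
\<close>

lemma continuous_on_compact_modulus:
  fixes h :: "real \<Rightarrow> complex"
  assumes S: "compact S" and h: "continuous_on S h" and "0 < d"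
  obtains K where "0 \<le> K" "\<And>x y. x \<in> S \<Longrightarrow> y \<in> S \<Longrightarrow> norm (h x - h y) \<le> d + K * \<bar>x - y\<bar>"
proof -
  have "uniformly_continuous_on S h"
    by (rule compact_uniformly_continuous[OF h S])
  then obtain \<delta> where \<delta>: "0 < \<delta>" "\<And>x y. x \<in> S \<Longrightarrow> y \<in> S \<Longrightarrow> dist x y < \<delta> \<Longrightarrow> dist (h x) (h y) < d"
    unfolding uniformly_continuous_on_def using \<open>0 < d\<close> by metis
  have "bounded (h ` S)" by (intro compact_imp_bounded compact_continuous_image h S)
  then obtain N where N: "0 < N" "\<And>x. x \<in> S \<Longrightarrow> norm (h x) \<le> N"
    unfolding bounded_pos by auto
  have "norm (h x - h y) \<le> d + (2 * N / \<delta>) * \<bar>x - y\<bar>" if "x \<in> S" "y \<in> S" for x y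
  proof (cases "\<bar>x - y\<bar> < \<delta>")
    case True
    then have "norm (h x - h y) \<le> d"
      using \<delta>(2)[OF that] by (simp add: dist_norm)
    moreover have "0 \<le> (2 * N / \<delta>) * \<bar>x - y\<bar>" using N \<delta>(1) by simp
    ultimately show ?thesis by linarith
  next
    case False
    have "norm (h x - h y) \<le> 2 * N"
      using norm_triangle_ineq4[of "h x" "h y"] N(2)[of x] N(2)[of y] that by linarith
    also have "\<dots> \<le> (2 * N / \<delta>) * \<bar>x - y\<bar>"
      using False N(1) \<delta>(1) by (simp add: field_simps)
    finally show ?thesis using \<open>0 < d\<close> by linarith
  qed
  then show ?thesis using N(1) \<delta>(1) by (intro that[of "2 * N / \<delta>"]) auto
qed

text \<open>
  Outside \<open>[- 1, 1]\<close> the extension is the nearest boundary value of \<open>h\<close>, multiplied by a ramp that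
  descends to \<open>0\<close> at \<open>- 2\<close> and \<open>2\<close>; clamping and ramp are Lipschitz with constant \<open>1\<close>, and neither
  of them increases the supremum of \<open>|h|\<close>.
\<close>

lemma continuous_extension_compact_support:
  fixes h :: "real \<Rightarrow> complex"
  assumes h: "continuous_on {-1..1} h" and N: "\<And>x. x \<in> {-1..1} \<Longrightarrow> norm (h x) \<le> N" and "0 < d"
  obtains H K where "continuous_on UNIV H" "\<And>x. x \<in> {-1..1} \<Longrightarrow> H x = h x"
    "\<And>x. norm (H x) \<le> N * indicator {-2..2} x"
    "0 \<le> K" "\<And>x y. norm (H x - H y) \<le> d + K * \<bar>x - y\<bar>"
proof -
  obtain K where K: "0 \<le> K"
    "\<And>x y. x \<in> {-1..1} \<Longrightarrow> y \<in> {-1..1} \<Longrightarrow> norm (h x - h y) \<le> d + K * \<bar>x - y\<bar>"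
    using continuous_on_compact_modulus[OF compact_Icc h \<open>0 < d\<close>] by metis
  have "0 \<le> N" using order_trans[OF norm_ge_zero N[of 0]] by simp
  define c where "c x = max (-1) (min 1 x)" for x :: real
  define r where "r x = max 0 (min 1 (2 - \<bar>x\<bar>))" for x :: real
  define H where "H x = of_real (r x) * h (c x)" for x
  have c: "c x \<in> {-1..1}" for x by (simp add: c_def)
  have r: "0 \<le> r x" "r x \<le> 1" for x by (auto simp: r_def)
  have lip: "\<bar>c x - c y\<bar> \<le> \<bar>x - y\<bar>" "\<bar>r x - r y\<bar> \<le> \<bar>x - y\<bar>" for x y
    by (auto simp: c_def r_def max_def min_def abs_if)
  have cont: "continuous_on UNIV H"
    unfolding H_def
    by (intro continuous_intros continuous_on_compose2[OF h]) (auto simp: c_def r_def intro!: continuous_intros)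
  have H_eq: "H x = h x" if "x \<in> {-1..1}" for x
  proof -
    have "c x = x" "r x = 1" using that by (auto simp: c_def r_def)
    then show ?thesis by (simp add: H_def)
  qed
  have H_le: "norm (H x) \<le> N * indicator {-2..2} x" for x
  proof (cases "x \<in> {-2..2}")
    case True
    have "norm (H x) = r x * norm (h (c x))" using r by (simp add: H_def norm_mult)
    also have "\<dots> \<le> 1 * N" by (intro mult_mono r N c) auto
    finally show ?thesis using True by simp
  next
    case False
    then have "r x = 0" by (auto simp: r_def)
    then show ?thesis using False by (simp add: H_def)
  qed
  have H_lip: "norm (H x - H y) \<le> d + (K + N) * \<bar>x - y\<bar>" for x y
  proof -
    have "H x - H y = of_real (r x) * (h (c x) - h (c y)) + of_real (r x - r y) * h (c y)"
      by (simp add: H_def algebra_simps)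
    then have "norm (H x - H y) \<le> r x * norm (h (c x) - h (c y)) + \<bar>r x - r y\<bar> * norm (h (c y))"
      using r by (metis (no_types) abs_of_nonneg norm_mult norm_of_real norm_triangle_ineq)
    also have "\<dots> \<le> 1 * (d + K * \<bar>x - y\<bar>) + \<bar>x - y\<bar> * N"
    proof (intro add_mono mult_mono r lip N c)
      show "norm (h (c x) - h (c y)) \<le> d + K * \<bar>x - y\<bar>"
        using K(2)[OF c c, of x y] mult_left_mono[OF lip(1)[of x y] K(1)] by linarith
    qed auto
    finally show ?thesis by (simp add: algebra_simps)
  qed
  show ?thesis
    by (rule that[OF cont H_eq H_le _ H_lip]) (use K(1) \<open>0 \<le> N\<close> in auto)
qed

lemma
  fixes \<phi> :: "real \<Rightarrow> complex"
  assumes [measurable]: "\<phi> \<in> borel_measurable borel" and B: "\<And>x. norm (\<phi> x) \<le> B * indicator {-2..2} x"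
  shows integrable_if_supported_Icc: "integrable lborel \<phi>"
    and norm_fourier_le_if_supported_Icc: "norm (fourier \<phi> \<xi>) \<le> B"
proof -
  have int: "integrable lborel (\<lambda>x::real. B * indicator {-2..2} x)" by (rule integrable_const_indicator_Icc)
  show i: "integrable lborel \<phi>"
    using B by (intro Bochner_Integration.integrable_bound[OF int]) (auto intro: order_trans[OF _ abs_ge_self])
  have "(\<integral>x. norm (\<phi> x) \<partial>lborel) \<le> (\<integral>x. B * indicator {-2..2::real} x \<partial>lborel)"
    by (intro integral_mono integrable_norm i int B)
  also have "\<dots> = 4 * B" by simp
  finally have "norm (fourier \<phi> \<xi>) \<le> 4 * B / (2 * pi)"
    using norm_fourier_le[of \<phi> \<xi>] by (meson divide_right_mono dual_order.trans mult_nonneg_nonneg pi_ge_zero zero_le_numeral)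
  moreover have "4 * B / (2 * pi) \<le> B"
  proof -
    have "0 \<le> B" using order_trans[OF norm_ge_zero B[of 0]] by simp
    then have "4 * B \<le> B * (2 * pi)" using pi_gt3 mult_left_mono[of 4 "2 * pi" B] by simp
    then show ?thesis by (simp add: pos_divide_le_eq)
  qed
  ultimately show "norm (fourier \<phi> \<xi>) \<le> B" by linarith
qed

text \<open>
  Since \<open>|x| \<le> 2\<close> on the support, passing to the derivative of the transform, that is, multiplying
  \<open>H\<close> by \<open>- i x\<close>, at most doubles the bound. The bound itself stays below \<open>N\<close> because the length
  \<open>4\<close> of the interval is less than the factor \<open>2 \<pi>\<close> of the normalisation.
\<close>

lemma fourier_compact_support:
  assumes H: "continuous_on UNIV H" "\<And>x. norm (H x) \<le> N * indicator {-2..2} x"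
  shows "smooth_on UNIV (fourier H)" "norm (fourier H \<xi>) \<le> N"
    "norm (vderiv (fourier H) \<xi>) \<le> 2 * N"
proof -
  define D where "D n = (\<lambda>x. (- \<i> * of_real x) ^ n * H x)" for n :: nat
  have D_Suc: "D (Suc n) x = - \<i> * of_real x * D n x" for n x
    by (simp add: D_def mult.assoc)
  have sq: "i * i = - 1 \<Longrightarrow> y\<^sup>2 * w = - 1 * (- i * y * (- i * y * w))" for i y w :: complex
    by algebra
  have i_squared: "\<i> * \<i> = - 1" by simp
  have D_cont: "continuous_on UNIV (D n)" for n
    unfolding D_def by (intro continuous_intros H)
  have D_le: "norm (D n x) \<le> (2 ^ n * N) * indicator {-2..2} x" for n x
  proof (cases "x \<in> {-2..2}")
    case True
    then have "\<bar>x\<bar> ^ n * norm (H x) \<le> 2 ^ n * N"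
      using H(2)[of x] by (intro mult_mono power_mono) auto
    then show ?thesis using True by (simp add: D_def norm_mult norm_power)
  next
    case False
    then show ?thesis using H(2)[of x] by (simp add: D_def)
  qed
  have D_int: "integrable lborel (D n)" for n
    using continuous_measurable_lborel[OF D_cont] D_le by (rule integrable_if_supported_Icc)
  have deriv: "(fourier (D n) has_vector_derivative fourier (D (Suc n)) \<xi>) (at \<xi>)" for n \<xi>
  proof -
    have 1: "integrable lborel (\<lambda>x. of_real x * D n x)"
    proof -
      have "(\<lambda>x. of_real x * D n x) = (\<lambda>x. \<i> * D (Suc n) x)"
        by (simp add: D_def fun_eq_iff mult.assoc[symmetric])
      then show ?thesis using integrable_mult_right[OF D_int[of "Suc n"], of \<i>] by simp
    qed
    have 2: "integrable lborel (\<lambda>x. of_real (x\<^sup>2) * D n x)"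
    proof -
      have "(\<lambda>x. of_real (x\<^sup>2) * D n x) = (\<lambda>x. - 1 * D (Suc (Suc n)) x)"
        unfolding fun_eq_iff D_Suc of_real_power using sq[OF i_squared] by blast
      then show ?thesis using integrable_mult_right[OF D_int[of "Suc (Suc n)"], of "- 1"] by simp
    qed
    have "(\<lambda>x. - \<i> * of_real x * D n x) = D (Suc n)" by (simp add: D_def fun_eq_iff mult.assoc)
    then show ?thesis using fourier_has_vector_derivative[OF D_int 1 2, of \<xi>] by simp
  qed
  have D0: "D 0 = H" by (simp add: D_def)
  show "smooth_on UNIV (fourier H)"
    using smooth_onI[of "\<lambda>n. fourier (D n)", OF deriv] D0 by simp
  have "vderiv (fourier H) = fourier (D 1)"
    using vderiv_eqI[OF deriv[of 0]] D0 by simp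
  then show "norm (fourier H \<xi>) \<le> N" "norm (vderiv (fourier H) \<xi>) \<le> 2 * N"
    using norm_fourier_le_if_supported_Icc[OF continuous_measurable_lborel[OF D_cont] D_le, of 0 \<xi>]
      norm_fourier_le_if_supported_Icc[OF continuous_measurable_lborel[OF D_cont] D_le, of 1 \<xi>] D0
    by simp_all
qed

text \<open>
  The transform of a compactly supported extension \<open>H\<close> of \<open>F\<close> is cut off by the bump
  \<open>\<beta>(\<xi> / R)\<close>, and \<open>F\<^sub>b\<close> is the inverse transform of the product. It equals the average
  \<open>\<integral> H(x + s / R) k(s) ds\<close> with the kernel \<open>k\<close>, the transform of \<open>\<beta>\<close>, whose integral is
  \<open>\<beta>(0) = 1\<close>. As \<open>R\<close> grows the average approaches \<open>H\<close> uniformly, while the derivative of the cut-off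
  contributes only \<open>O(1 / R)\<close> to the derivative of the transform.
\<close>

lemma admissible_exists:
  fixes F :: "real \<Rightarrow> complex"
  assumes F: "continuous_on {-1..1} F" and \<epsilon>: "0 < \<epsilon>" "\<epsilon> < 1" and "0 < N"
    and N: "\<And>x. x \<in> {-1..1} \<Longrightarrow> norm (F x) \<le> N"
  obtains R Fb where "0 < R" "Fb \<in> schwartz" "bandlimit (dist_of_fun Fb) R"
    "\<And>x. x \<in> {-1..1} \<Longrightarrow> norm (F x - Fb x) \<le> \<epsilon> * N"
    "\<And>x. norm (Fb x) \<le> 4 * N" "\<And>\<xi>. norm (fourier Fb \<xi>) \<le> 4 * N"
    "continuous_on UNIV (vderiv (fourier Fb))" "\<And>\<xi>. norm (vderiv (fourier Fb) \<xi>) \<le> 4 * N"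
proof -
  obtain \<beta> where \<beta>: "smooth_on UNIV (\<lambda>x. complex_of_real (\<beta> x))" "\<And>x. 0 \<le> \<beta> x" "\<And>x. \<beta> x \<le> 1" "\<beta> 0 = 1"
    "\<And>x. 1 \<le> \<bar>x\<bar> \<Longrightarrow> \<beta> x = 0" by (rule bump_exists) auto
  define B where "B x = complex_of_real (\<beta> x)" for x
  have B: "B \<in> schwartz"
    unfolding B_def using \<beta>(1,5) by (intro schwartz_if_compact_support[of _ 1]) auto
  define k where "k = fourier B"
  have k: "k \<in> schwartz" unfolding k_def by (rule schwartz_fourier[OF B])
  define a b where "a = (\<integral>s. norm (k s) \<partial>lborel)" and "b = (\<integral>s. norm (of_real s * k s) \<partial>lborel)"
  have ab: "0 \<le> a" "0 \<le> b" unfolding a_def b_def by (auto intro!: integral_nonneg_AE)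
  \<comment> \<open>\<open>d a\<close> and, by the choice of \<open>R\<close>, \<open>K b / R\<close> are at most \<open>\<epsilon> N / 2\<close>;
    \<open>R \<ge> S\<close> bounds the derivative of the cut-off by \<open>1\<close>\<close>
  define d where "d = \<epsilon> * N / (2 * (a + 1))"
  have "0 < d" using \<epsilon> \<open>0 < N\<close> ab unfolding d_def by simp
  obtain H K where H: "continuous_on UNIV H" "\<And>x. x \<in> {-1..1} \<Longrightarrow> H x = F x"
    "\<And>x. norm (H x) \<le> N * indicator {-2..2} x"
    "0 \<le> K" "\<And>x y. norm (H x - H y) \<le> d + K * \<bar>x - y\<bar>"
    using continuous_extension_compact_support[OF F N \<open>0 < d\<close>] by metis
  have H_le: "norm (H x) \<le> N" for x
    using order_trans[OF H(3), of x N] \<open>0 < N\<close> by (auto simp: indicator_def split: if_splits)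
  have H_int: "integrable lborel H"
    by (rule integrable_if_supported_Icc[OF continuous_measurable_lborel[OF H(1)] H(3)])
  define S where "S = schwartz_seminorm 0 1 B"
  define R where "R = 1 + S + 2 * K * b / (\<epsilon> * N)"
  have S: "norm (vderiv B x) \<le> S" "0 \<le> S" for x
    using schwartz_seminorm_upper[OF B, of x 0 1] schwartz_seminorm_nonneg[OF B, of 0 1] by (auto simp: S_def)
  have R: "0 < R" "S \<le> R" "2 * K * b / (\<epsilon> * N) \<le> R"
    using S ab H(4) \<epsilon> \<open>0 < N\<close> by (auto simp: R_def add_pos_nonneg)
  define G where "G \<xi> = B (1 / R * \<xi> + 0) * fourier H \<xi>" for \<xi>
  note fH = fourier_compact_support[OF H(1,3)]
  have G_smooth: "smooth_on UNIV G"
    unfolding G_def B_def by (intro smooth_mult smooth_affine[of "\<lambda>x. complex_of_real (\<beta> x)"] \<beta> fH)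
  have G_0: "G \<xi> = 0" if "R < \<bar>\<xi>\<bar>" for \<xi>
    using that R(1) by (simp add: G_def B_def \<beta>(5) abs_mult)
  have G_refl: "(\<lambda>\<xi>. G ((-1) * \<xi> + 0)) \<in> schwartz"
    by (rule schwartz_if_compact_support[OF smooth_affine[OF G_smooth], of R]) (simp add: G_0)
  \<comment> \<open>the reflection turns the transform into its inverse\<close>
  define Fb where "Fb x = (2 * pi) * fourier (\<lambda>\<xi>. G ((-1) * \<xi> + 0)) x" for x
  have Fb: "Fb \<in> schwartz"
    unfolding Fb_def by (intro schwartz_cmult schwartz_fourier G_refl)
  have fourier_Fb: "fourier Fb = G"
  proof
    fix \<eta>
    have "fourier Fb \<eta> = (\<integral>x. fourier (\<lambda>\<xi>. G ((-1) * \<xi> + 0)) x * exp (\<i> * of_real ((- \<eta>) * x)) \<partial>lborel)"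
      unfolding Fb_def fourier_cmult by (subst fourier_eq) simp
    also have "\<dots> = G \<eta>" by (subst schwartz_fourier_inversion[OF G_refl]) simp
    finally show "fourier Fb \<eta> = G \<eta>" .
  qed
  have Fb_conv: "Fb x = (\<integral>s. H (x + s / R) * k s \<partial>lborel)" for x
  proof -
    have BR: "integrable lborel (\<lambda>\<xi>. B (\<xi> / R))"
      using lborel_integrable_real_affine[OF schwartz_integrable[OF B], of "1 / R" 0] R(1) by simp
    have "integrable lborel (\<lambda>\<xi>. exp (\<i> * of_real (x * \<xi>)) * B (\<xi> / R))"
      using integrable_mult_exp[OF BR, of x] by (simp only: mult.commute)
    note conv = integral_mult_fourier[OF H_int this]
    have "Fb x = (\<integral>\<xi>. G ((-1) * \<xi> + 0) * exp (- (\<i> * of_real (x * \<xi>))) \<partial>lborel)"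
      unfolding Fb_def fourier_eq by simp
    also have "\<dots> = (\<integral>\<xi>. G \<xi> * exp (\<i> * of_real (x * \<xi>)) \<partial>lborel)"
      by (subst (2) lborel_integral_real_affine[of "-1" _ 0]) simp_all
    also have "\<dots> = (\<integral>\<xi>. fourier H \<xi> * (exp (\<i> * of_real (x * \<xi>)) * B (\<xi> / R)) \<partial>lborel)"
      by (simp add: G_def mult_ac)
    also have "\<dots> = (\<integral>y. H y * (R * k (R * (y - x))) \<partial>lborel)"
      unfolding conv[symmetric] fourier_modulation fourier_dilation[OF R(1)] k_def ..
    also have "\<dots> = (\<integral>s. H (x + s / R) * k s \<partial>lborel)"
      using R(1)
      by (subst lborel_integral_real_affine[of "1 / R" _ x]) (simp_all add: scaleR_conv_of_real mult_ac)
    finally show ?thesis .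
  qed
  have k_1: "(\<integral>s. k s \<partial>lborel) = 1"
    using schwartz_fourier_inversion[OF B, of 0] \<beta>(4) by (simp add: k_def B_def)
  have close: "norm (Fb x - H x) \<le> \<epsilon> * N" for x
  proof -
    have [measurable]: "H \<in> borel_measurable borel" "k \<in> borel_measurable borel"
      using continuous_measurable_lborel H(1) schwartz_continuous[OF k] by auto
    have k_int: "integrable lborel k" "integrable lborel (\<lambda>s. of_real s * k s)"
      by (intro schwartz_integrable schwartz_mult_id k)+
    have i1: "integrable lborel (\<lambda>s. H (x + s / R) * k s)"
    proof (rule Bochner_Integration.integrable_bound)
      show "integrable lborel (\<lambda>s. of_real N * k s)" using k_int by simp
      show "AE s in lborel. norm (H (x + s / R) * k s) \<le> norm (of_real N * k s)"
        using H_le \<open>0 < N\<close> by (auto simp: norm_mult intro!: mult_right_mono)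
    qed measurable
    have i2: "integrable lborel (\<lambda>s. H x * k s)" using k_int by simp
    have "Fb x - H x = (\<integral>s. H (x + s / R) * k s - H x * k s \<partial>lborel)"
      using i1 i2 k_1 by (simp add: Fb_conv)
    also have "norm \<dots> \<le> (\<integral>s. norm (H (x + s / R) * k s - H x * k s) \<partial>lborel)"
      by (rule integral_norm_bound)
    also have "\<dots> \<le> (\<integral>s. d * norm (k s) + (K / R) * norm (of_real s * k s) \<partial>lborel)"
    proof (rule integral_mono)
      show "norm (H (x + s / R) * k s - H x * k s) \<le> d * norm (k s) + (K / R) * norm (of_real s * k s)" for s
      proof -
        have "norm (H (x + s / R) * k s - H x * k s) = norm (H (x + s / R) - H x) * norm (k s)"
          by (simp add: norm_mult[symmetric] left_diff_distrib)
        also have "\<dots> \<le> (d + K * \<bar>s / R\<bar>) * norm (k s)"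
          using H(5)[of "x + s / R" x] by (intro mult_right_mono) auto
        also have "\<dots> = d * norm (k s) + (K / R) * norm (of_real s * k s)"
          using R(1) by (simp add: norm_mult algebra_simps)
        finally show ?thesis .
      qed
    qed (use i1 i2 k_int in auto)
    also have "\<dots> = d * a + K * b / R"
      using k_int by (simp add: a_def b_def)
    also have "\<dots> \<le> \<epsilon> * N / 2 + \<epsilon> * N / 2"
    proof (rule add_mono)
      show "d * a \<le> \<epsilon> * N / 2"
        using ab \<epsilon> \<open>0 < N\<close> by (simp add: d_def field_simps)
      show "K * b / R \<le> \<epsilon> * N / 2"
        using R(1,3) \<epsilon> \<open>0 < N\<close> by (simp add: field_simps)
    qed
    finally show ?thesis by (simp add: mult.commute)
  qed
  have B_le: "norm (B x) \<le> 1" for x using \<beta>(2,3) by (simp add: B_def)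
  have G_deriv: "(G has_vector_derivative
      B (1 / R * \<xi> + 0) * vderiv (fourier H) \<xi> + ((1 / R) *\<^sub>R vderiv B (1 / R * \<xi> + 0)) * fourier H \<xi>) (at \<xi>)" for \<xi>
    unfolding G_def
  proof (intro has_vector_derivative_mult)
    have "((\<lambda>\<xi>. 1 / R * \<xi> + 0) has_real_derivative 1 / R) (at \<xi>)"
      using R(1) by (auto intro!: derivative_eq_intros)
    then have "((B \<circ> (\<lambda>\<xi>. 1 / R * \<xi> + 0)) has_vector_derivative (1 / R) *\<^sub>R vderiv B (1 / R * \<xi> + 0)) (at \<xi>)"
      by (intro vector_diff_chain_at schwartz_has_vector_derivative[OF B]
          has_real_derivative_iff_has_vector_derivative[THEN iffD1])
    then show "((\<lambda>\<xi>. B (1 / R * \<xi> + 0)) has_vector_derivative (1 / R) *\<^sub>R vderiv B (1 / R * \<xi> + 0)) (at \<xi>)"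
      by (simp add: o_def)
    show "(fourier H has_vector_derivative vderiv (fourier H) \<xi>) (at \<xi>)"
      using smooth_on_has_vector_derivative[OF fH(1), of \<xi> 0] by simp
  qed
  have G_deriv_le: "norm (vderiv G \<xi>) \<le> 4 * N" for \<xi>
  proof -
    have "norm (vderiv G \<xi>) \<le> norm (B (1 / R * \<xi> + 0)) * norm (vderiv (fourier H) \<xi>)
        + norm (vderiv B (1 / R * \<xi> + 0)) / R * norm (fourier H \<xi>)"
      unfolding vderiv_eqI[OF G_deriv] using R(1)
      by (intro order_trans[OF norm_triangle_ineq]) (simp add: norm_mult)
    also have "\<dots> \<le> 1 * (2 * N) + 1 * N"
    proof (intro add_mono mult_mono B_le fH)
      show "norm (vderiv B (1 / R * \<xi> + 0)) / R \<le> 1"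
        using order_trans[OF S(1) R(2)] R(1) by (simp add: divide_le_eq)
    qed auto
    finally show ?thesis using \<open>0 < N\<close> by linarith
  qed
  show ?thesis
  proof (rule that[OF R(1) Fb])
    show "bandlimit (dist_of_fun Fb) R"
      by (rule bandlimit_if_fourier_vanishes[OF Fb]) (simp add: fourier_Fb G_0)
    show "norm (F x - Fb x) \<le> \<epsilon> * N" if "x \<in> {-1..1}" for x
      using close[of x] H(2)[OF that] by (simp add: norm_minus_commute)
    show "norm (Fb x) \<le> 4 * N" for x
    proof -
      have "norm (Fb x) \<le> norm (H x) + norm (Fb x - H x)"
        using norm_triangle_ineq[of "H x" "Fb x - H x"] by simp
      also have "\<dots> \<le> N + 1 * N"
        using \<epsilon> \<open>0 < N\<close> close[of x] H_le[of x] mult_right_mono[of \<epsilon> 1 N] by linarith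
      finally show ?thesis using \<open>0 < N\<close> by linarith
    qed
    show "norm (fourier Fb \<xi>) \<le> 4 * N" for \<xi>
    proof -
      have "norm (fourier Fb \<xi>) \<le> 1 * N"
        unfolding fourier_Fb G_def norm_mult by (intro mult_mono B_le fH) auto
      then show ?thesis using \<open>0 < N\<close> by linarith
    qed
    show "continuous_on UNIV (vderiv (fourier Fb))"
      unfolding fourier_Fb by (intro smooth_imp_continuous smooth_on_vderiv G_smooth)
    show "norm (vderiv (fourier Fb) \<xi>) \<le> 4 * N" for \<xi>
      unfolding fourier_Fb by (rule G_deriv_le)
  qed
qed

text \<open>
  The existence part matters as much as the lower bound on the individual bands, since the
  infimum of an empty set of reals is an arbitrary number.
\<close>

theorem approx_band_ge:
  fixes F :: "real \<Rightarrow> complex"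
  assumes F: "continuous_on {-1..1} F" "x \<in> {-1..1}" "F x \<noteq> 0" and \<epsilon>: "0 < \<epsilon>" "\<epsilon> < 1"
  shows "(1 - \<epsilon>) / 8 \<le> approx_band F \<epsilon>"
  unfolding approx_band_def
proof (rule cInf_greatest)
  obtain x\<^sub>0 where x\<^sub>0: "x\<^sub>0 \<in> {-1..1}" "\<And>x. x \<in> {-1..1} \<Longrightarrow> norm (F x) \<le> norm (F x\<^sub>0)"
    "Linf_norm {-1..1} F = ereal (norm (F x\<^sub>0))"
    using Linf_norm_attained[OF F(1)] by blast
  have pos: "0 < norm (F x\<^sub>0)"
    using x\<^sub>0(2)[OF F(2)] F(3) by (auto intro: less_le_trans[of _ "norm (F x)"])
  obtain R Fb where Fb: "0 < R" "Fb \<in> schwartz" "bandlimit (dist_of_fun Fb) R"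
    "\<And>x. x \<in> {-1..1} \<Longrightarrow> norm (F x - Fb x) \<le> \<epsilon> * norm (F x\<^sub>0)"
    "\<And>x. norm (Fb x) \<le> 4 * norm (F x\<^sub>0)" "\<And>\<xi>. norm (fourier Fb \<xi>) \<le> 4 * norm (F x\<^sub>0)"
    "continuous_on UNIV (vderiv (fourier Fb))" "\<And>\<xi>. norm (vderiv (fourier Fb) \<xi>) \<le> 4 * norm (F x\<^sub>0)"
    using admissible_exists[OF F(1) \<epsilon> pos x\<^sub>0(2)] by blast
  have "Linf_norm {-1..1} (\<lambda>x. F x - Fb x) \<le> ereal (\<epsilon> * norm (F x\<^sub>0))"
    by (intro Linf_norm_interval_le Fb continuous_intros F(1)
        continuous_on_subset[OF schwartz_continuous[OF Fb(2)]]) auto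
  moreover have "Linf_norm UNIV Fb \<le> ereal (4 * norm (F x\<^sub>0))"
    by (intro Linf_norm_UNIV_le schwartz_continuous Fb)
  moreover have "Linf_norm UNIV (fourier Fb) \<le> ereal (4 * norm (F x\<^sub>0))"
    by (intro Linf_norm_UNIV_le schwartz_continuous schwartz_fourier Fb)
  moreover have "Linf_norm UNIV (vderiv (fourier Fb)) \<le> ereal (4 * norm (F x\<^sub>0))"
    by (intro Linf_norm_UNIV_le Fb)
  ultimately show "{c. 0 < c \<and> (\<exists>Fb\<in>schwartz. bandlimit (dist_of_fun Fb) c \<and>
     Linf_norm {-1..1} (\<lambda>x. F x - Fb x) \<le> ereal \<epsilon> * Linf_norm {-1..1} F \<and>
     Linf_norm UNIV Fb \<le> 4 * Linf_norm {-1..1} F \<and>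
     Linf_norm UNIV (fourier Fb) \<le> 4 * Linf_norm {-1..1} F \<and>
     Linf_norm UNIV (vderiv (fourier Fb)) \<le> 4 * Linf_norm {-1..1} F)} \<noteq> {}"
    using Fb(1-3) unfolding x\<^sub>0(3) by auto
qed (use admissible_bandlimit_ge[OF F \<epsilon>(1)] in blast)

section \<open>Exponential sums\<close>

definition exp_sum :: "nat \<Rightarrow> (nat \<Rightarrow> complex) \<Rightarrow> (nat \<Rightarrow> real) \<Rightarrow> complex \<Rightarrow> complex" where
  "exp_sum n a \<xi> z = (\<Sum>j\<le>n. a j * exp (\<i> * of_real (\<xi> j) * z))"

lemma exp_sum_holomorphic: "exp_sum n a \<xi> holomorphic_on UNIV"
  unfolding exp_sum_def by (intro holomorphic_intros)

lemma norm_exp_sum_le: "norm (exp_sum n a \<xi> (of_real x)) \<le> (\<Sum>j\<le>n. norm (a j))"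
  unfolding exp_sum_def
  by (intro order_trans[OF norm_sum] sum_mono) (simp add: norm_mult)

lemma exp_sum_has_vector_derivative:
  "((\<lambda>x. exp_sum n a \<xi> (of_real x)) has_vector_derivative
    exp_sum n (\<lambda>j. \<i> * of_real (\<xi> j) * a j) \<xi> (of_real x)) (at x within S)"
proof -
  have "(exp_sum n a \<xi> has_field_derivative exp_sum n (\<lambda>j. \<i> * of_real (\<xi> j) * a j) \<xi> z) (at z)" for z
    unfolding exp_sum_def by (auto intro!: derivative_eq_intros sum.cong)
  from field_vector_diff_chain_at[OF has_vector_derivative_of_real[OF DERIV_ident] this, of x]
  show ?thesis by (simp add: o_def has_vector_derivative_at_within)
qed

lemma exp_sum_continuous: "continuous_on S (\<lambda>x::real. exp_sum n a \<xi> (of_real x))"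
  unfolding exp_sum_def by (intro continuous_intros)

text \<open>
  Exponentials with frequencies in an arbitrarily short interval suffice: the coefficients may be
  as large as they need to be. For small \<open>\<eta>\<close> the function \<open>(e\<^sup>i\<^sup>\<eta>\<^sup>x - 1) / (i \<eta>)\<close> is close to \<open>x\<close>, so
  substituting it for \<open>x\<close> in an approximating polynomial \<open>q\<close> changes little and produces an
  exponential sum with the frequencies \<open>0, \<eta>, \<dots>, (deg q) \<eta>\<close>. Multiplication by
  \<open>e\<^sup>i\<^sup>\<alpha>\<^sup>x\<close> moves them into the prescribed interval.
\<close>

lemma exp_sum_dense:
  fixes h :: "real \<Rightarrow> complex"
  assumes h: "continuous_on {-1..1} h" and "0 < \<delta>" "\<alpha> < \<beta>"
  obtains n a \<xi> where "\<And>j. j \<le> n \<Longrightarrow> \<alpha> \<le> \<xi> j \<and> \<xi> j \<le> \<beta>"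
    "\<And>x. x \<in> {-1..1} \<Longrightarrow> norm (h x - exp_sum n a \<xi> (of_real x)) \<le> \<delta>"
proof -
  \<comment> \<open>shifts the target interval for the frequencies to \<open>[0, \<beta> - \<alpha>]\<close>\<close>
  define h' where "h' x = exp (- (\<i> * of_real (\<alpha> * x))) * h x" for x
  have h': "continuous_on {-1..1} h'" unfolding h'_def by (intro continuous_intros h)
  obtain gR where gR: "real_polynomial_function gR" "\<And>x. x \<in> {-1..1} \<Longrightarrow> \<bar>Re (h' x) - gR x\<bar> < \<delta> / 4"
    using Stone_Weierstrass_real_polynomial_function[of "{-1..1}" "\<lambda>x. Re (h' x)" "\<delta> / 4"] h' \<open>0 < \<delta>\<close>
    by (auto intro!: continuous_intros)
  obtain gI where gI: "real_polynomial_function gI" "\<And>x. x \<in> {-1..1} \<Longrightarrow> \<bar>Im (h' x) - gI x\<bar> < \<delta> / 4"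
    using Stone_Weierstrass_real_polynomial_function[of "{-1..1}" "\<lambda>x. Im (h' x)" "\<delta> / 4"] h' \<open>0 < \<delta>\<close>
    by (auto intro!: continuous_intros)
  obtain cR nR where cR: "gR = (\<lambda>x. \<Sum>i\<le>nR. cR i * x ^ i)"
    using gR(1) real_polynomial_function_iff_sum by blast
  obtain cI nI where cI: "gI = (\<lambda>x. \<Sum>i\<le>nI. cI i * x ^ i)"
    using gI(1) real_polynomial_function_iff_sum by blast
  define q :: "complex poly" where
    "q = (\<Sum>i\<le>nR. monom (of_real (cR i)) i) + (\<Sum>i\<le>nI. monom (\<i> * of_real (cI i)) i)"
  have q: "poly q (of_real x) = Complex (gR x) (gI x)" for x
    by (simp add: q_def poly_sum poly_monom cR cI Complex_eq sum_distrib_left mult.assoc)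
  have close1: "norm (h' x - poly q (of_real x)) \<le> \<delta> / 2" if "x \<in> {-1..1}" for x
  proof -
    have "norm (h' x - poly q (of_real x)) \<le> \<bar>Re (h' x - poly q (of_real x))\<bar> + \<bar>Im (h' x - poly q (of_real x))\<bar>"
      by (rule cmod_le)
    also have "\<dots> \<le> \<delta> / 2" using gR(2)[OF that] gI(2)[OF that] unfolding q by simp
    finally show ?thesis .
  qed
  have "uniformly_continuous_on (cball 0 2) (poly q)"
    by (intro compact_uniformly_continuous continuous_intros) auto
  then obtain \<eta>\<^sub>0 where \<eta>\<^sub>0: "0 < \<eta>\<^sub>0"
    "\<And>u v. u \<in> cball 0 2 \<Longrightarrow> v \<in> cball 0 2 \<Longrightarrow> dist u v < \<eta>\<^sub>0 \<Longrightarrow> dist (poly q u) (poly q v) < \<delta> / 2"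
    unfolding uniformly_continuous_on_def using \<open>0 < \<delta>\<close> by (metis half_gt_zero)
  define \<eta> where "\<eta> = min 1 (min \<eta>\<^sub>0 ((\<beta> - \<alpha>) / (degree q + 1)))"
  have \<eta>: "0 < \<eta>" "\<eta> \<le> 1" "\<eta> \<le> \<eta>\<^sub>0" using \<eta>\<^sub>0(1) \<open>\<alpha> < \<beta>\<close> by (auto simp: \<eta>_def)
  have \<eta>_deg: "real j * \<eta> \<le> \<beta> - \<alpha>" if "j \<le> degree q" for j
  proof -
    have "real j * \<eta> \<le> (degree q + 1) * ((\<beta> - \<alpha>) / (degree q + 1))"
      using that \<eta>(1) by (intro mult_mono) (auto simp: \<eta>_def)
    then show ?thesis by (simp add: add_pos_nonneg)
  qed
  define w where "w x = (exp (\<i> * of_real (\<eta> * x)) - 1) / (\<i> * of_real \<eta>)" for x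
  define r where "r = pcompose q [: - 1 / (\<i> * of_real \<eta>), 1 / (\<i> * of_real \<eta>) :]"
  have r: "poly r (exp (\<i> * of_real (\<eta> * x))) = poly q (w x)" for x
    unfolding r_def poly_pcompose w_def by (simp add: diff_divide_distrib)
  have deg_r: "degree r \<le> degree q"
    unfolding r_def using degree_pcompose_le[of q "[: - 1 / (\<i> * of_real \<eta>), 1 / (\<i> * of_real \<eta>) :]"] \<eta>(1)
    by simp
  have close2: "norm (poly q (of_real x) - poly q (w x)) \<le> \<delta> / 2" if x: "x \<in> {-1..1}" for x
  proof -
    have x1: "\<bar>x\<bar> \<le> 1" using x by auto
    have "norm (exp (\<i> * of_real (\<eta> * x)) - (1 + \<i> * of_real (\<eta> * x))) \<le> \<bar>\<eta> * x\<bar>\<^sup>2 / 2"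
      using iexp_approx1[of "\<eta> * x" 1] by (simp add: numeral_2_eq_2)
    also have "\<dots> \<le> \<eta>\<^sup>2 / 2"
      using x1 by (simp add: abs_mult power_mult_distrib mult_left_le abs_square_le_1)
    finally have "norm (exp (\<i> * of_real (\<eta> * x)) - (1 + \<i> * of_real (\<eta> * x))) \<le> \<eta>\<^sup>2 / 2" .
    moreover have "w x - of_real x = (exp (\<i> * of_real (\<eta> * x)) - (1 + \<i> * of_real (\<eta> * x))) / (\<i> * of_real \<eta>)"
      using \<eta>(1) by (simp add: w_def field_simps)
    ultimately have "norm (w x - of_real x) \<le> \<eta> / 2"
      using \<eta>(1) by (simp add: norm_divide norm_mult power2_eq_square divide_le_eq del: of_real_mult)
    moreover from this have "norm (w x) \<le> 2"
      using norm_triangle_ineq2[of "w x" "of_real x"] x1 \<eta>(2) by simp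
    ultimately have "dist (poly q (of_real x)) (poly q (w x)) < \<delta> / 2"
      using x1 \<eta> by (intro \<eta>\<^sub>0(2)) (auto simp: dist_norm norm_minus_commute)
    then show ?thesis by (simp add: dist_norm)
  qed
  define \<xi> where "\<xi> j = \<alpha> + real j * \<eta>" for j
  have sum_eq: "exp_sum (degree r) (coeff r) \<xi> (of_real x) = exp (\<i> * of_real (\<alpha> * x)) * poly q (w x)" for x
  proof -
    have E: "exp (\<i> * of_real (\<xi> j) * of_real x) = exp (\<i> * of_real (\<alpha> * x)) * exp (\<i> * of_real (\<eta> * x)) ^ j" for j
      unfolding exp_of_nat_mult[symmetric] exp_add[symmetric] by (simp add: \<xi>_def algebra_simps)
    show ?thesis
      unfolding exp_sum_def r[symmetric] poly_altdef[of r] sum_distrib_left E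
      by (intro sum.cong refl) (rule mult.left_commute)
  qed
  show ?thesis
  proof (rule that[of "degree r" \<xi> "coeff r"])
    show "\<alpha> \<le> \<xi> j \<and> \<xi> j \<le> \<beta>" if "j \<le> degree r" for j
      using \<eta>_deg[of j] that deg_r \<eta>(1) by (simp add: \<xi>_def)
    show "norm (h x - exp_sum (degree r) (coeff r) \<xi> (of_real x)) \<le> \<delta>" if x: "x \<in> {-1..1}" for x
    proof -
      have "h x = exp (\<i> * of_real (\<alpha> * x)) * h' x"
        unfolding h'_def mult.assoc[symmetric] exp_add[symmetric] by simp
      then have "h x - exp_sum (degree r) (coeff r) \<xi> (of_real x) = exp (\<i> * of_real (\<alpha> * x)) * (h' x - poly q (w x))"
        unfolding sum_eq by (simp add: right_diff_distrib)
      then have "norm (h x - exp_sum (degree r) (coeff r) \<xi> (of_real x)) = norm (h' x - poly q (w x))"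
        by (simp only: norm_mult norm_exp_imaginary mult_1)
      also have "\<dots> \<le> norm (h' x - poly q (of_real x)) + norm (poly q (of_real x) - poly q (w x))"
        by (rule norm_triangle_sub[THEN order_trans, OF order_refl, of "h' x - poly q (w x)" "h' x - poly q (of_real x)", simplified])
      also have "\<dots> \<le> \<delta>" using close1[OF x] close2[OF x] by linarith
      finally show ?thesis .
    qed
  qed
qed

section \<open>The Fourier transform of an exponential sum\<close>

lemma exp_sum_mult_integrable:
  assumes "integrable lborel \<phi>"
  shows "integrable lborel (\<lambda>x. exp_sum n a \<xi> (of_real x) * \<phi> x)"
proof (rule Bochner_Integration.integrable_bound[OF integrable_mult_right[OF assms, of "of_real (\<Sum>j\<le>n. norm (a j))"]])
  show "(\<lambda>x. exp_sum n a \<xi> (of_real x) * \<phi> x) \<in> borel_measurable lborel"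
    using borel_measurable_integrable[OF assms] continuous_measurable_lborel[OF exp_sum_continuous] by simp
  show "AE x in lborel. norm (exp_sum n a \<xi> (of_real x) * \<phi> x) \<le> norm (of_real (\<Sum>j\<le>n. norm (a j)) * \<phi> x)"
    by (auto simp: norm_mult sum_nonneg simp del: of_real_sum intro!: mult_right_mono norm_exp_sum_le)
qed

lemma tempered_function_exp_sum: "tempered_function (\<lambda>x. exp_sum n a \<xi> (of_real x))"
  unfolding tempered_function_def tempered_distribution_def
proof (intro conjI ballI allI)
  show int: "integrable lborel (\<lambda>x. exp_sum n a \<xi> (of_real x) * \<phi> x)" if "\<phi> \<in> schwartz" for \<phi>
    by (intro exp_sum_mult_integrable schwartz_integrable that)
  show "dist_of_fun (\<lambda>x. exp_sum n a \<xi> (of_real x)) (\<lambda>x. \<phi> x + \<psi> x)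
      = dist_of_fun (\<lambda>x. exp_sum n a \<xi> (of_real x)) \<phi> + dist_of_fun (\<lambda>x. exp_sum n a \<xi> (of_real x)) \<psi>"
    if "\<phi> \<in> schwartz" "\<psi> \<in> schwartz" for \<phi> \<psi>
    using int[OF that(1)] int[OF that(2)] by (simp add: dist_of_fun_def distrib_left)
  show "dist_of_fun (\<lambda>x. exp_sum n a \<xi> (of_real x)) (\<lambda>x. z * \<phi> x)
      = z * dist_of_fun (\<lambda>x. exp_sum n a \<xi> (of_real x)) \<phi>" for z \<phi>
    unfolding dist_of_fun_def by (simp add: mult.left_commute)
  define A where "A = (\<Sum>j\<le>n. norm (a j))"
  define J where "J = (\<integral>x. inverse (1 + (x::real)\<^sup>2) \<partial>lborel)"
  have "0 \<le> A" "0 \<le> J" unfolding A_def J_def by (auto intro!: sum_nonneg integral_nonneg_AE)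
  show "\<exists>C N. \<forall>\<phi>\<in>schwartz. norm (dist_of_fun (\<lambda>x. exp_sum n a \<xi> (of_real x)) \<phi>)
      \<le> C * (\<Sum>m\<le>N. \<Sum>n\<le>N. schwartz_seminorm m n \<phi>)"
  proof (intro exI ballI)
    fix \<phi> assume \<phi>: "\<phi> \<in> schwartz"
    have "norm (dist_of_fun (\<lambda>x. exp_sum n a \<xi> (of_real x)) \<phi>) \<le> (\<integral>x. norm (exp_sum n a \<xi> (of_real x) * \<phi> x) \<partial>lborel)"
      unfolding dist_of_fun_def by (rule integral_norm_bound)
    also have "\<dots> \<le> (\<integral>x. A * norm (\<phi> x) \<partial>lborel)"
      unfolding A_def norm_mult
      by (intro integral_mono mult_right_mono norm_exp_sum_le integrable_mult_right integrable_norm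
          schwartz_integrable \<phi> integrable_norm[OF int[OF \<phi>], unfolded norm_mult]) auto
    also have "\<dots> \<le> A * ((schwartz_seminorm 0 0 \<phi> + schwartz_seminorm 2 0 \<phi>) * J)"
      using schwartz_norm_integral_le[OF \<phi>] \<open>0 \<le> A\<close> by (simp add: J_def mult_left_mono)
    also have "\<dots> = (A * J) * (schwartz_seminorm 0 0 \<phi> + schwartz_seminorm 2 0 \<phi>)" by simp
    also have "\<dots> \<le> (A * J) * (\<Sum>m\<le>2. \<Sum>n\<le>2. schwartz_seminorm m n \<phi>)"
      using schwartz_seminorm_nonneg[OF \<phi>] \<open>0 \<le> A\<close> \<open>0 \<le> J\<close>
      by (intro mult_left_mono) (auto simp: numeral_2_eq_2 add_nonneg_nonneg)
    finally show "norm (dist_of_fun (\<lambda>x. exp_sum n a \<xi> (of_real x)) \<phi>)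
      \<le> (A * J) * (\<Sum>m\<le>2. \<Sum>n\<le>2. schwartz_seminorm m n \<phi>)" .
  qed
qed

text \<open>
  By Fourier inversion the transform of an exponential sum is a combination of point masses at the
  frequencies; everything below about support and order is read off from this.
\<close>

lemma fourier_dist_exp_sum:
  assumes "\<psi> \<in> schwartz"
  shows "fourier_dist (dist_of_fun (\<lambda>x. exp_sum n a \<xi> (of_real x))) \<psi> = (\<Sum>j\<le>n. a j * \<psi> (\<xi> j))"
proof -
  have int: "integrable lborel (\<lambda>x. a j * (fourier \<psi> x * exp (\<i> * of_real (\<xi> j * x))))" for j
    by (intro integrable_mult_right integrable_mult_exp schwartz_integrable schwartz_fourier assms)
  have "fourier_dist (dist_of_fun (\<lambda>x. exp_sum n a \<xi> (of_real x))) \<psi>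
      = (\<integral>x. (\<Sum>j\<le>n. a j * (fourier \<psi> x * exp (\<i> * of_real (\<xi> j * x)))) \<partial>lborel)"
  proof -
    have "exp_sum n a \<xi> (of_real x) * fourier \<psi> x
        = (\<Sum>j\<le>n. a j * (fourier \<psi> x * exp (\<i> * of_real (\<xi> j * x))))" for x
      unfolding exp_sum_def sum_distrib_right by (intro sum.cong refl) (simp add: mult_ac)
    then show ?thesis unfolding fourier_dist_def dist_of_fun_def by (simp only:)
  qed
  also have "\<dots> = (\<Sum>j\<le>n. \<integral>x. a j * (fourier \<psi> x * exp (\<i> * of_real (\<xi> j * x))) \<partial>lborel)"
    using int by (rule Bochner_Integration.integral_sum)
  also have "\<dots> = (\<Sum>j\<le>n. a j * \<psi> (\<xi> j))"
    by (intro sum.cong refl) (simp only: integral_mult_right_zero schwartz_fourier_inversion[OF assms])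
  finally show ?thesis .
qed

lemma tempered_distribution_fourier_exp_sum:
  "tempered_distribution (fourier_dist (dist_of_fun (\<lambda>x. exp_sum n a \<xi> (of_real x))))"
  unfolding tempered_distribution_def
proof (intro conjI ballI allI exI)
  show "norm (fourier_dist (dist_of_fun (\<lambda>x. exp_sum n a \<xi> (of_real x))) \<phi>)
      \<le> (\<Sum>j\<le>n. norm (a j)) * (\<Sum>m\<le>0. \<Sum>n\<le>0. schwartz_seminorm m n \<phi>)" if "\<phi> \<in> schwartz" for \<phi>
    unfolding fourier_dist_exp_sum[OF that]
    by (auto simp: sum_distrib_right norm_mult intro!: order_trans[OF norm_sum] sum_mono mult_left_mono
        schwartz_bound that)
qed (auto simp: fourier_dist_exp_sum schwartz_add schwartz_cmult distrib_left sum.distrib sum_distrib_left mult_ac)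

text \<open>
  The empty compact set is treated apart, since the supremum over it is an arbitrary number.
\<close>

lemma dist_order_fourier_exp_sum:
  "dist_order (fourier_dist (dist_of_fun (\<lambda>x. exp_sum n a \<xi> (of_real x)))) = 0"
proof -
  let ?T = "fourier_dist (dist_of_fun (\<lambda>x. exp_sum n a \<xi> (of_real x)))"
  have bound: "norm (?T \<psi>) \<le> (\<Sum>j\<le>n. norm (a j)) * (SUP k\<in>{0..0}. SUP x\<in>K. norm ((vderiv ^^ k) \<psi> x))"
    if K: "compact K" and \<psi>: "\<psi> \<in> schwartz" "supp \<psi> \<subseteq> K" and "K \<noteq> {}" for K \<psi>
  proof -
    have bdd: "bdd_above ((\<lambda>x. norm (\<psi> x)) ` K)"
      using schwartz_bound[OF \<psi>(1)] by (intro bdd_aboveI2)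
    have le: "norm (\<psi> x) \<le> (SUP x\<in>K. norm (\<psi> x))" for x
    proof (cases "x \<in> K")
      case True
      then show ?thesis by (rule cSUP_upper[OF _ bdd])
    next
      case False
      then have "\<psi> x = 0" using \<psi>(2) closure_subset[of "{x. \<psi> x \<noteq> 0}"] by (auto simp: supp_def)
      then show ?thesis using \<open>K \<noteq> {}\<close> cSUP_upper[OF _ bdd] by (force intro: order_trans[OF norm_ge_zero])
    qed
    have "norm (?T \<psi>) \<le> (\<Sum>j\<le>n. norm (a j) * (SUP x\<in>K. norm (\<psi> x)))"
      unfolding fourier_dist_exp_sum[OF \<psi>(1)]
      by (auto simp: norm_mult intro!: order_trans[OF norm_sum] sum_mono mult_left_mono le)
    then show ?thesis by (simp add: sum_distrib_right)
  qed
  have zero: "?T \<psi> = 0" if "\<psi> \<in> schwartz" "supp \<psi> \<subseteq> {}" for \<psi>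
  proof -
    have "\<psi> x = 0" for x using that(2) closure_subset[of "{x. \<psi> x \<noteq> 0}"] by (auto simp: supp_def)
    then show ?thesis by (simp add: fourier_dist_exp_sum[OF that(1)])
  qed
  have "\<forall>K. compact K \<longrightarrow> (\<exists>M. \<forall>\<psi>\<in>schwartz. supp \<psi> \<subseteq> K \<longrightarrow>
     norm (?T \<psi>) \<le> M * (SUP k\<in>{0..0}. SUP x\<in>K. norm ((vderiv ^^ k) \<psi> x)))"
  proof (intro allI impI)
    fix K :: "real set" assume K: "compact K"
    show "\<exists>M. \<forall>\<psi>\<in>schwartz. supp \<psi> \<subseteq> K \<longrightarrow>
       norm (?T \<psi>) \<le> M * (SUP k\<in>{0..0}. SUP x\<in>K. norm ((vderiv ^^ k) \<psi> x))"
    proof (cases "K = {}")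
      case True
      show ?thesis by (rule exI[of _ 0]) (use zero True in simp)
    next
      case False
      show ?thesis by (intro exI ballI impI) (rule bound[OF K _ _ False])
    qed
  qed
  then show ?thesis
    unfolding dist_order_def by (rule Least_eq_0)
qed

lemma dist_support_fourier_exp_sum:
  assumes "\<And>j. j \<le> n \<Longrightarrow> a j \<noteq> 0 \<Longrightarrow> \<bar>\<xi> j\<bar> \<le> c"
  shows "dist_support (fourier_dist (dist_of_fun (\<lambda>x. exp_sum n a \<xi> (of_real x)))) \<subseteq> {-c..c}"
proof -
  let ?T = "fourier_dist (dist_of_fun (\<lambda>x. exp_sum n a \<xi> (of_real x)))"
  have "dist_vanishes_on ?T (- {-c..c})"
    unfolding dist_vanishes_on_def
  proof (intro ballI impI)
    fix \<psi> assume \<psi>: "\<psi> \<in> schwartz" "compact (supp \<psi>) \<and> supp \<psi> \<subseteq> - {- c..c}"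
    have "a j * \<psi> (\<xi> j) = 0" if "j \<le> n" for j
      using \<psi>(2) assms[OF that] closure_subset[of "{x. \<psi> x \<noteq> 0}"] unfolding supp_def
      by (cases "a j = 0") (auto simp: abs_le_iff subset_iff)
    then show "?T \<psi> = 0" unfolding fourier_dist_exp_sum[OF \<psi>(1)] by (intro sum.neutral) auto
  qed
  moreover have "open (- {-c..c})" by auto
  ultimately show ?thesis unfolding dist_support_def by blast
qed

section \<open>The change of variables\<close>

lemma deriv_I_eqI:
  fixes F :: "real \<Rightarrow> 'a::euclidean_space"
  assumes "x \<in> {-1..1}" "(F has_vector_derivative D) (at x within {-1..1})"
  shows "deriv_I F x = D"
  unfolding deriv_I_def using assms by (intro vector_derivative_within_closed_interval) auto

text \<open>
  What the change of variables uses of the phase function: it is stated with the one-sided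
  derivatives on \<open>[- 1, 1]\<close> and is stable under scaling.
\<close>

definition nonstationary :: "(real \<Rightarrow> real) \<Rightarrow> bool" where
  "nonstationary g \<longleftrightarrow> continuous_on {-1..1} (deriv_I g) \<and>
     (\<forall>x\<in>{-1..1}. (g has_real_derivative deriv_I g x) (at x within {-1..1}) \<and> deriv_I g x \<noteq> 0)"

lemma nonstationaryI:
  assumes "continuous_on {-1..1} g'"
    and "\<And>x. x \<in> {-1..1} \<Longrightarrow> (g has_real_derivative g' x) (at x within {-1..1})"
    and "\<And>x. x \<in> {-1..1} \<Longrightarrow> g' x \<noteq> 0"
  shows "nonstationary g" "\<And>x. x \<in> {-1..1} \<Longrightarrow> deriv_I g x = g' x"
proof -
  show eq: "deriv_I g x = g' x" if "x \<in> {-1..1}" for x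
    using assms(2)[OF that] that by (intro deriv_I_eqI) (auto simp: has_real_derivative_iff_has_vector_derivative)
  show "nonstationary g"
    unfolding nonstationary_def using assms eq continuous_on_eq[OF assms(1), of "deriv_I g"] by auto
qed

lemma nonstationary_if_smooth:
  assumes "a < -1" "1 < b" "smooth_on {a<..<b} ge" "\<And>x. x \<in> {-1..1} \<Longrightarrow> ge x = g x"
    and "\<And>x. x \<in> {a<..<b} \<Longrightarrow> vderiv ge x \<noteq> 0"
  shows "nonstationary g"
proof (rule nonstationaryI)
  have sub: "{-1..1} \<subseteq> {a<..<b}" using assms(1,2) by auto
  show "continuous_on {-1..1} (vderiv ge)"
  proof (intro continuous_at_imp_continuous_on ballI)
    fix x :: real assume "x \<in> {-1..1}"
    then have "x \<in> {a<..<b}" using sub by blast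
    from has_vector_derivative_continuous[OF smooth_on_has_vector_derivative[OF assms(3) this, of 1]]
    show "isCont (vderiv ge) x" by simp
  qed
  fix x :: real assume x: "x \<in> {-1..1}"
  have "(ge has_real_derivative vderiv ge x) (at x within {-1..1})"
  proof -
    have "x \<in> {a<..<b}" using sub x by blast
    from smooth_on_has_vector_derivative[OF assms(3) this, of 0]
    show ?thesis
      by (simp add: has_real_derivative_iff_has_vector_derivative has_vector_derivative_at_within)
  qed
  then show "(g has_real_derivative vderiv ge x) (at x within {-1..1})"
    by (rule has_field_derivative_transform_within[OF _ zero_less_one x]) (use assms(4) in auto)
  show "vderiv ge x \<noteq> 0" using assms(5) sub x by auto
qed

lemma nonstationary_scale:
  assumes "nonstationary g" "l \<noteq> 0"
  shows "nonstationary (\<lambda>x. l * g x)"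
  using assms unfolding nonstationary_def[of g]
  by (intro nonstationaryI(1)[where g' = "\<lambda>x. l * deriv_I g x"])
    (auto intro!: continuous_intros derivative_eq_intros)

context
  fixes g :: "real \<Rightarrow> real"
  assumes g: "nonstationary g"
begin

lemma deriv_I_continuous: "continuous_on {-1..1} (deriv_I g)"
  and has_deriv_I: "x \<in> {-1..1} \<Longrightarrow> (g has_real_derivative deriv_I g x) (at x within {-1..1})"
  and deriv_I_nonzero: "x \<in> {-1..1} \<Longrightarrow> deriv_I g x \<noteq> 0"
  using g by (auto simp: nonstationary_def)

lemma integral_deriv_I:
  assumes "x \<in> {-1..1}"
  shows "integral {-1..x} (deriv_I g) = g x - g (-1)"
proof (rule integral_unique, rule fundamental_theorem_of_calculus)
  show "(g has_vector_derivative deriv_I g y) (at y within {-1..x})" if "y \<in> {-1..x}" for y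
    using has_deriv_I[of y] assms that
    by (auto simp: has_real_derivative_iff_has_vector_derivative intro: has_vector_derivative_within_subset)
qed (use assms in simp)

lemma mean_deriv_eq: "mean_deriv g = (g 1 - g (-1)) / 2"
  using integral_deriv_I[of 1] by (simp add: mean_deriv_def)

lemma mvt_deriv_I:
  assumes "x \<in> {-1..1}" "y \<in> {-1..1}" "x < y"
  obtains c where "c \<in> {-1..1}" "g y - g x = deriv_I g c * (y - x)"
proof -
  have "\<exists>c\<in>{x<..<y}. g y - g x = deriv_I g c * (y - x)"
  proof (rule mvt_simple[OF \<open>x < y\<close>])
    show "(g has_derivative (*) (deriv_I g c)) (at c within {x..y})" if "x \<le> c" "c \<le> y" for c
      using has_deriv_I[of c] assms that
      by (auto simp: has_field_derivative_def intro: has_derivative_subset)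
  qed
  then obtain c where c: "c \<in> {x<..<y}" "g y - g x = deriv_I g c * (y - x)" by blast
  moreover from c(1) assms have "c \<in> {-1..1}" by auto
  ultimately show ?thesis using that by blast
qed

lemma deriv_I_same_sign:
  assumes "x \<in> {-1..1}" "y \<in> {-1..1}"
  shows "0 < deriv_I g x * deriv_I g y"
proof (rule ccontr)
  assume "\<not> 0 < deriv_I g x * deriv_I g y"
  then have "deriv_I g x * deriv_I g y < 0"
    using deriv_I_nonzero assms by (simp add: less_le not_less)
  then have "deriv_I g x \<le> 0 \<and> 0 \<le> deriv_I g y \<or> deriv_I g y \<le> 0 \<and> 0 \<le> deriv_I g x"
    by (auto simp: mult_less_0_iff)
  moreover have "connected (deriv_I g ` {-1..1})"
    by (intro connected_continuous_image deriv_I_continuous connected_Icc)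
  ultimately have "0 \<in> deriv_I g ` {-1..1}"
    using assms by (auto intro: connectedD_interval[OF _ imageI imageI])
  then show False using deriv_I_nonzero by auto
qed

lemma mean_deriv_value:
  obtains c where "c \<in> {-1..1}" "mean_deriv g = deriv_I g c"
proof -
  obtain c where "c \<in> {-1..1}" "g 1 - g (-1) = deriv_I g c * (1 - (-1))"
    by (rule mvt_deriv_I[of "-1" 1]) auto
  then show ?thesis using that by (simp add: mean_deriv_eq)
qed

lemma mean_deriv_nonzero: "mean_deriv g \<noteq> 0"
proof -
  obtain c where "c \<in> {-1..1}" "mean_deriv g = deriv_I g c" by (rule mean_deriv_value)
  then show ?thesis using deriv_I_nonzero by simp
qed

lemma ratio_pos:
  assumes "x \<in> {-1..1}"
  shows "0 < deriv_I g x / mean_deriv g"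
proof -
  obtain c where "c \<in> {-1..1}" "mean_deriv g = deriv_I g c" by (rule mean_deriv_value)
  then show ?thesis
    using deriv_I_same_sign[OF assms, of c] by (simp add: zero_less_divide_iff zero_less_mult_iff)
qed

lemma min_deriv_bounds: "0 < min_deriv g" "min_deriv g \<le> \<bar>mean_deriv g\<bar>"
proof -
  have "continuous_on {-1..1} (\<lambda>x. \<bar>deriv_I g x\<bar>)" by (intro continuous_intros deriv_I_continuous)
  then obtain y where y: "y \<in> {-1..1}" "\<And>x. x \<in> {-1..1} \<Longrightarrow> \<bar>deriv_I g y\<bar> \<le> \<bar>deriv_I g x\<bar>"
    using continuous_attains_inf[of "{-1..1::real}" "\<lambda>x. \<bar>deriv_I g x\<bar>"] by auto
  then have min: "min_deriv g = \<bar>deriv_I g y\<bar>"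
    unfolding min_deriv_def by (intro cInf_eq_minimum) auto
  obtain c where c: "c \<in> {-1..1}" "mean_deriv g = deriv_I g c" by (rule mean_deriv_value)
  show "0 < min_deriv g" using min deriv_I_nonzero[OF y(1)] by simp
  show "min_deriv g \<le> \<bar>mean_deriv g\<bar>" unfolding min c(2) by (rule y(2)[OF c(1)])
qed

lemma phase_eq: "x \<in> {-1..1} \<Longrightarrow> phase g x = - 1 + (g x - g (-1)) / mean_deriv g"
  by (simp add: phase_def integral_deriv_I)

lemma phase_has_derivative:
  assumes "x \<in> {-1..1}"
  shows "(phase g has_real_derivative deriv_I g x / mean_deriv g) (at x within {-1..1})"
proof -
  have "((\<lambda>x. - 1 + (g x - g (-1)) / mean_deriv g) has_real_derivative deriv_I g x / mean_deriv g) (at x within {-1..1})"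
    using has_deriv_I[OF assms] mean_deriv_nonzero by (auto intro!: derivative_eq_intros)
  then show ?thesis
    by (rule has_field_derivative_transform_within[OF _ zero_less_one assms]) (simp add: phase_eq)
qed

lemma deriv_I_phase: "x \<in> {-1..1} \<Longrightarrow> deriv_I (phase g) x = deriv_I g x / mean_deriv g"
  using phase_has_derivative[of x]
  by (intro deriv_I_eqI) (auto simp: has_real_derivative_iff_has_vector_derivative)

lemma phase_continuous: "continuous_on {-1..1} (phase g)"
  using phase_has_derivative by (intro DERIV_continuous_on)

lemma phase_strict_mono:
  assumes "x \<in> {-1..1}" "y \<in> {-1..1}" "x < y"
  shows "phase g x < phase g y"
proof -
  obtain c where c: "c \<in> {-1..1}" "g y - g x = deriv_I g c * (y - x)"
    by (rule mvt_deriv_I[OF assms])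
  have "phase g y - phase g x = (g y - g x) / mean_deriv g"
    using assms by (simp add: phase_eq diff_divide_distrib)
  also have "\<dots> = deriv_I g c / mean_deriv g * (y - x)" by (simp add: c(2))
  also have "\<dots> > 0" using ratio_pos[OF c(1)] assms(3) by (intro mult_pos_pos) auto
  finally show ?thesis by simp
qed

lemma phase_ends: "phase g (-1) = -1" "phase g 1 = 1"
proof -
  show "phase g (-1) = -1" by (simp add: phase_eq)
  have "g 1 - g (-1) = 2 * mean_deriv g" using mean_deriv_eq by simp
  then show "phase g 1 = 1" using mean_deriv_nonzero by (simp add: phase_eq)
qed

lemma phase_bij: "bij_betw (phase g) {-1..1} {-1..1}"
proof (rule bij_betw_imageI)
  show inj: "inj_on (phase g) {-1..1}"
  proof (rule inj_onI)
    fix x y :: real assume "x \<in> {-1..1}" "y \<in> {-1..1}" "phase g x = phase g y"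
    then show "x = y"
      using phase_strict_mono[of x y] phase_strict_mono[of y x] by (cases x y rule: linorder_cases) auto
  qed
  have mono: "phase g x \<le> phase g y" if "x \<in> {-1..1}" "y \<in> {-1..1}" "x \<le> y" for x y
    using phase_strict_mono[of x y] that by (cases "x = y") auto
  have "phase g x \<in> {-1..1}" if "x \<in> {-1..1}" for x
    using mono[of "-1" x] mono[of x 1] that phase_ends by auto
  moreover have "z \<in> phase g ` {-1..1}" if "z \<in> {-1..1}" for z
    using IVT'[of "phase g" "-1" z 1] phase_continuous phase_ends that by auto
  ultimately show "phase g ` {-1..1} = {-1..1}" by blast
qed

lemma phase_in: "x \<in> {-1..1} \<Longrightarrow> phase g x \<in> {-1..1}"
  using phase_bij by (auto simp: bij_betw_def)

lemma phase_inv_in: "z \<in> {-1..1} \<Longrightarrow> phase_inv g z \<in> {-1..1}"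
  unfolding phase_inv_def using phase_bij by (intro inv_into_into) (auto simp: bij_betw_def)

lemma phase_phase_inv: "z \<in> {-1..1} \<Longrightarrow> phase g (phase_inv g z) = z"
  unfolding phase_inv_def using phase_bij by (intro f_inv_into_f) (auto simp: bij_betw_def)

lemma phase_inv_phase: "x \<in> {-1..1} \<Longrightarrow> phase_inv g (phase g x) = x"
  unfolding phase_inv_def using phase_bij by (intro inv_into_f_f) (auto simp: bij_betw_def)

lemma phase_inv_continuous: "continuous_on {-1..1} (phase_inv g)"
  using continuous_on_inv[OF phase_continuous compact_Icc, of "phase_inv g"] phase_inv_phase phase_bij
  by (auto simp: bij_betw_def)

lemma deriv_I_phase_inv:
  assumes z: "z \<in> {-1..1}"
  shows "deriv_I (phase_inv g) z = 1 / deriv_I (phase g) (phase_inv g z)"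
proof -
  define x where "x = phase_inv g z"
  have x: "x \<in> {-1..1}" "phase g x = z"
    using phase_inv_in[OF z] phase_phase_inv[OF z] by (auto simp: x_def)
  let ?d = "deriv_I g x / mean_deriv g"
  have d: "?d \<noteq> 0" using ratio_pos[OF x(1)] by (rule less_imp_neq[THEN not_sym])
  have image: "phase g ` {-1..1} = {-1..1}" using phase_bij by (simp add: bij_betw_def)
  have "(phase_inv g has_derivative (\<lambda>h. h / ?d)) (at (phase g x) within phase g ` {-1..1})"
  proof (rule has_derivative_inverse_within)
    show "(phase g has_derivative (*) ?d) (at x within {-1..1})"
      using phase_has_derivative[OF x(1)] by (simp add: has_field_derivative_def)
    show "continuous (at (phase g x) within phase g ` {-1..1}) (phase_inv g)"
      using phase_inv_continuous z by (simp add: image x(2) continuous_on_eq_continuous_within)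
    show "linear (\<lambda>h. h / ?d)" by (intro bounded_linear.linear bounded_linear_divide)
    show "(\<lambda>h. h / ?d) \<circ> (*) ?d = id" using d by (auto simp: fun_eq_iff)
  qed (use x phase_inv_phase in auto)
  then have "(phase_inv g has_vector_derivative 1 / ?d) (at z within {-1..1})"
    unfolding image x(2) has_vector_derivative_def by (simp add: divide_inverse)
  then have "deriv_I (phase_inv g) z = 1 / ?d" by (rule deriv_I_eqI[OF z])
  then show ?thesis using deriv_I_phase[OF x(1)] by (simp add: x_def)
qed

lemma transformed_eq:
  assumes "z \<in> {-1..1}"
  shows "transformed f g z = f (phase_inv g z) / of_real (deriv_I g (phase_inv g z) / mean_deriv g)"
  unfolding transformed_def deriv_I_phase[OF phase_inv_in[OF assms]] ..

lemma transformed_phase: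
  assumes "x \<in> {-1..1}"
  shows "f x = of_real (deriv_I g x / mean_deriv g) * transformed f g (phase g x)"
  using deriv_I_nonzero[OF assms] mean_deriv_nonzero unfolding transformed_eq[OF phase_in[OF assms]] phase_inv_phase[OF assms]
  by simp

lemma transformed_continuous:
  assumes "continuous_on {-1..1} f"
  shows "continuous_on {-1..1} (transformed f g)"
proof -
  have *: "continuous_on {-1..1} (\<lambda>z. F (phase_inv g z))" if "continuous_on {-1..1} F"
    for F :: "real \<Rightarrow> 'b::topological_space"
    using that by (rule continuous_on_compose2) (use phase_inv_continuous phase_inv_in in auto)
  have "continuous_on {-1..1} (\<lambda>z. f (phase_inv g z) / of_real (deriv_I g (phase_inv g z) / mean_deriv g))"
    using ratio_pos[OF phase_inv_in] mean_deriv_nonzero deriv_I_nonzero[OF phase_inv_in]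
    by (intro continuous_intros * assms deriv_I_continuous) auto
  then show ?thesis by (rule continuous_on_eq) (simp add: transformed_eq)
qed

end

text \<open>
  Scaling the phase function scales its derivative and the mean of the derivative alike, so the
  normalised phase and everything derived from it stay the same.
\<close>

lemma
  assumes g: "nonstationary g" and "l \<noteq> 0" and x: "x \<in> {-1..1}"
  shows deriv_I_scale: "deriv_I (\<lambda>x. l * g x) x = l * deriv_I g x"
    and mean_deriv_scale: "mean_deriv (\<lambda>x. l * g x) = l * mean_deriv g"
    and transformed_scale: "transformed f (\<lambda>x. l * g x) x = transformed f g x"
proof -
  note lg = nonstationary_scale[OF g \<open>l \<noteq> 0\<close>]
  have d: "deriv_I (\<lambda>x. l * g x) x = l * deriv_I g x" if "x \<in> {-1..1}" for x
    using has_deriv_I[OF g that] that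
    by (intro deriv_I_eqI) (auto simp flip: has_real_derivative_iff_has_vector_derivative intro!: derivative_eq_intros)
  show "deriv_I (\<lambda>x. l * g x) x = l * deriv_I g x" by (rule d[OF x])
  show m: "mean_deriv (\<lambda>x. l * g x) = l * mean_deriv g"
    unfolding mean_deriv_eq[OF g] mean_deriv_eq[OF lg] by (simp add: algebra_simps)
  have p: "phase (\<lambda>x. l * g x) x = phase g x" if "x \<in> {-1..1}" for x
    unfolding phase_eq[OF g that] phase_eq[OF lg that] m using \<open>l \<noteq> 0\<close>
    by (simp add: right_diff_distrib[symmetric])
  have "phase g (phase_inv (\<lambda>x. l * g x) x) = x"
    using phase_phase_inv[OF lg x] p[OF phase_inv_in[OF lg x]] by simp
  then have i: "phase_inv (\<lambda>x. l * g x) x = phase_inv g x"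
    using phase_inv_phase[OF g phase_inv_in[OF lg x]] by simp
  show "transformed f (\<lambda>x. l * g x) x = transformed f g x"
    unfolding transformed_eq[OF lg x] transformed_eq[OF g x] i m d[OF phase_inv_in[OF g x]]
    using \<open>l \<noteq> 0\<close> by simp
qed

section \<open>Solving the transformed equation\<close>

text \<open>
  With \<open>p = P \<circ> u\<close> the equation \<open>p' + i k' p = f\<close> becomes \<open>P' + i W P = h\<close> up to the factor \<open>u'\<close>. An
  exponential sum in place of \<open>h\<close> is solved coefficient by coefficient: the coefficient at
  frequency \<open>\<xi>\<^sub>j\<close> is divided by \<open>i (\<xi>\<^sub>j + W)\<close>. Frequencies of the same sign as \<open>W\<close> and of modulus at
  least \<open>m\<close> keep this divisor away from \<open>0\<close>: its modulus is at least \<open>m + |W|\<close>.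
\<close>

lemma exp_sum_solution:
  assumes k: "nonstationary k" and "0 < m"
    and \<xi>: "\<And>j. j \<le> n \<Longrightarrow> m \<le> sgn (mean_deriv k) * \<xi> j \<and> sgn (mean_deriv k) * \<xi> j \<le> 2 * m"
    and U: "\<And>x. x \<in> {-1..1} \<Longrightarrow> deriv_I k x / mean_deriv k \<le> U"
    and close: "\<And>z. z \<in> {-1..1} \<Longrightarrow> norm (transformed f k z - exp_sum n a \<xi> (of_real z)) \<le> \<delta>"
  defines "b \<equiv> \<lambda>j. a j / (\<i> * of_real (\<xi> j + mean_deriv k))"
    and "A \<equiv> \<Sum>j\<le>n. norm (a j)"
  defines "p \<equiv> \<lambda>x. exp_sum n b \<xi> (of_real (phase k x))"
  shows "\<And>x. x \<in> {-1..1} \<Longrightarrow> p differentiable (at x within {-1..1})"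
    and "continuous_on {-1..1} (deriv_I p)"
    and "\<And>x. x \<in> {-1..1} \<Longrightarrow> norm (deriv_I p x + \<i> * of_real (deriv_I k x) * p x - f x) \<le> U * \<delta>"
    and "\<And>x. x \<in> {-1..1} \<Longrightarrow> norm (p x) \<le> A / (m + \<bar>mean_deriv k\<bar>)"
    and "\<And>x. x \<in> {-1..1} \<Longrightarrow> norm (deriv_I p x) \<le> U * (2 * m * A / (m + \<bar>mean_deriv k\<bar>))"
proof -
  define W where "W = mean_deriv k"
  define u' where "u' x = deriv_I k x / W" for x
  define b' where "b' = (\<lambda>j. \<i> * of_real (\<xi> j) * b j)"
  have W: "W \<noteq> 0" unfolding W_def by (rule mean_deriv_nonzero[OF k])
  have u': "0 < u' x" "u' x \<le> U" if "x \<in> {-1..1}" for x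
    using ratio_pos[OF k that] U[OF that] by (auto simp: u'_def W_def)
  have denom: "m + \<bar>W\<bar> \<le> \<bar>\<xi> j + W\<bar>" "\<bar>\<xi> j\<bar> \<le> 2 * m" if "j \<le> n" for j
    using \<xi>[OF that] \<open>0 < m\<close> unfolding W_def[symmetric] by (auto simp: sgn_if abs_if split: if_splits)
  have b_le: "norm (b j) \<le> norm (a j) / (m + \<bar>W\<bar>)" if "j \<le> n" for j
    unfolding b_def W_def[symmetric] using denom(1)[OF that] \<open>0 < m\<close>
    by (auto simp: norm_divide norm_mult simp del: of_real_add intro!: divide_left_mono mult_pos_pos)
  have p_deriv: "(p has_vector_derivative of_real (u' x) * exp_sum n b' \<xi> (of_real (phase k x))) (at x within {-1..1})"
    if x: "x \<in> {-1..1}" for x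
  proof -
    have "(phase k has_vector_derivative u' x) (at x within {-1..1})"
      using phase_has_derivative[OF k x] by (simp add: u'_def W_def has_real_derivative_iff_has_vector_derivative)
    from vector_diff_chain_within[OF this exp_sum_has_vector_derivative[of n b \<xi>]]
    show ?thesis by (simp add: p_def o_def b'_def scaleR_conv_of_real)
  qed
  then show "\<And>x. x \<in> {-1..1} \<Longrightarrow> p differentiable (at x within {-1..1})"
    by (rule differentiableI_vector)
  have dp: "deriv_I p x = of_real (u' x) * exp_sum n b' \<xi> (of_real (phase k x))" if "x \<in> {-1..1}" for x
    by (rule deriv_I_eqI[OF that p_deriv[OF that]])
  have "continuous_on {-1..1} (\<lambda>x. of_real (u' x) * exp_sum n b' \<xi> (of_real (phase k x)))"
    unfolding u'_def using W
    by (intro continuous_intros deriv_I_continuous[OF k]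
        continuous_on_compose2[OF exp_sum_continuous[of UNIV] phase_continuous[OF k]]) auto
  then show "continuous_on {-1..1} (deriv_I p)" by (rule continuous_on_eq) (simp add: dp)
  have ode: "exp_sum n b' \<xi> z + \<i> * of_real W * exp_sum n b \<xi> z = exp_sum n a \<xi> z" for z
  proof -
    have "b' j + \<i> * of_real W * b j = a j" if "j \<le> n" for j
    proof -
      have "\<xi> j + W \<noteq> 0" using denom(1)[OF that] \<open>0 < m\<close> by auto
      then have "\<i> * of_real (\<xi> j + W) \<noteq> 0" by (simp del: of_real_add)
      moreover have "b' j + \<i> * of_real W * b j = \<i> * of_real (\<xi> j + W) * b j"
        by (simp add: b'_def algebra_simps)
      ultimately show ?thesis by (simp add: b_def W_def)
    qed
    then have "exp_sum n a \<xi> z = (\<Sum>j\<le>n. (b' j + \<i> * of_real W * b j) * exp (\<i> * of_real (\<xi> j) * z))"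
      unfolding exp_sum_def by (intro sum.cong) auto
    then show ?thesis
      by (simp add: exp_sum_def distrib_right sum.distrib sum_distrib_left mult.assoc)
  qed
  fix x :: real assume x: "x \<in> {-1..1}"
  have ku: "deriv_I k x = u' x * W" using W by (simp add: u'_def)
  have fx: "f x = of_real (u' x) * transformed f k (phase k x)"
    unfolding u'_def W_def by (rule transformed_phase[OF k x])
  have "deriv_I p x + \<i> * of_real (deriv_I k x) * p x - f x
      = of_real (u' x) * (exp_sum n b' \<xi> (of_real (phase k x)) + \<i> * of_real W * exp_sum n b \<xi> (of_real (phase k x)))
        - of_real (u' x) * transformed f k (phase k x)"
    unfolding dp[OF x] ku fx by (simp add: p_def algebra_simps)
  also have "\<dots> = of_real (u' x) * (exp_sum n a \<xi> (of_real (phase k x)) - transformed f k (phase k x))"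
    unfolding ode by (simp add: right_diff_distrib)
  also have "norm \<dots> = u' x * norm (transformed f k (phase k x) - exp_sum n a \<xi> (of_real (phase k x)))"
    using u'(1)[OF x] by (simp add: norm_mult norm_minus_commute)
  also have "\<dots> \<le> U * \<delta>"
    using u'[OF x] by (intro mult_mono close phase_in[OF k x]) auto
  finally show "norm (deriv_I p x + \<i> * of_real (deriv_I k x) * p x - f x) \<le> U * \<delta>" .
  have "(\<Sum>j\<le>n. norm (b j)) \<le> (\<Sum>j\<le>n. norm (a j) / (m + \<bar>W\<bar>))"
    by (intro sum_mono b_le) auto
  also have "\<dots> = A / (m + \<bar>W\<bar>)" by (simp add: A_def sum_divide_distrib)
  finally have sum_b: "(\<Sum>j\<le>n. norm (b j)) \<le> A / (m + \<bar>W\<bar>)" .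
  then show "norm (p x) \<le> A / (m + \<bar>mean_deriv k\<bar>)"
    unfolding p_def W_def using norm_exp_sum_le order_trans by blast
  have "(\<Sum>j\<le>n. norm (b' j)) \<le> (\<Sum>j\<le>n. 2 * m * norm (b j))"
    unfolding b'_def by (intro sum_mono) (auto simp: norm_mult intro!: mult_right_mono denom)
  also have "\<dots> \<le> 2 * m * (A / (m + \<bar>W\<bar>))"
    unfolding sum_distrib_left[symmetric] using \<open>0 < m\<close> sum_b by (intro mult_left_mono) auto
  finally have "norm (exp_sum n b' \<xi> (of_real (phase k x))) \<le> 2 * m * A / (m + \<bar>W\<bar>)"
    using norm_exp_sum_le[of n b' \<xi> "phase k x"] by simp
  then show "norm (deriv_I p x) \<le> U * (2 * m * A / (m + \<bar>mean_deriv k\<bar>))"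
    unfolding dp[OF x] norm_mult W_def[symmetric] using u'[OF x] by (intro mult_mono) auto
qed

text \<open>
  The parameter \<open>s\<close> is the sign of the frequencies. For \<open>f = 0\<close> the sum is taken to be identically
  \<open>0\<close>, so that neither the bounds nor the support of the transform impose anything.
\<close>

lemma approximating_exp_sum:
  fixes f :: "real \<Rightarrow> complex"
  assumes f: "continuous_on {-1..1} f" and g: "nonstationary g"
    and N: "\<And>x. x \<in> {-1..1} \<Longrightarrow> norm (f x) \<le> N" and "0 < \<delta> \<or> N = 0" "0 \<le> \<delta>" "0 < m" "s \<in> {1, -1}"
  shows "\<exists>n a \<xi>. (\<forall>j\<le>n. m \<le> s * \<xi> j \<and> s * \<xi> j \<le> 2 * m) \<and> (N = 0 \<longrightarrow> (\<forall>j. a j = 0)) \<and>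
    (\<forall>z\<in>{-1..1}. norm (transformed f g z - exp_sum n a \<xi> (of_real z)) \<le> \<delta>)"
proof (cases "N = 0")
  case True
  have "transformed f g z = 0" if "z \<in> {-1..1}" for z
    using N[OF phase_inv_in[OF g that]] True by (simp add: transformed_def)
  moreover have "s * (s * m) = m" using \<open>s \<in> {1, -1}\<close> by auto
  ultimately show ?thesis
    using \<open>0 < m\<close> \<open>0 \<le> \<delta>\<close> by (intro exI[of _ 0] exI[of _ "\<lambda>_. 0"] exI[of _ "\<lambda>_. s * m"]) (auto simp: exp_sum_def)
next
  case False
  define \<alpha> where "\<alpha> = (if s = 1 then m else - 2 * m)"
  have "0 < \<delta>" using False assms(4) by simp
  moreover have "\<alpha> < \<alpha> + m" using \<open>0 < m\<close> by simp
  ultimately obtain n a \<xi> where \<xi>: "\<And>j. j \<le> n \<Longrightarrow> \<alpha> \<le> \<xi> j \<and> \<xi> j \<le> \<alpha> + m"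
    and close: "\<And>z. z \<in> {-1..1} \<Longrightarrow> norm (transformed f g z - exp_sum n a \<xi> (of_real z)) \<le> \<delta>"
    using exp_sum_dense[OF transformed_continuous[OF g f]] by metis
  have "m \<le> s * \<xi> j \<and> s * \<xi> j \<le> 2 * m" if "j \<le> n" for j
    using \<xi>[OF that] \<open>s \<in> {1, -1}\<close> by (auto simp: \<alpha>_def)
  then show ?thesis using False close by blast
qed

theorem theorem4:
  fixes f :: "real \<Rightarrow> complex" and g :: "real \<Rightarrow> real"
  assumes f_smooth: "\<exists>fe a b. a < -1 \<and> 1 < b \<and> smooth_on {a<..<b} fe \<and> (\<forall>x\<in>{-1..1}. fe x = f x)"
    and g_smooth: "\<exists>ge a b. a < -1 \<and> 1 < b \<and> smooth_on {a<..<b} ge \<and> (\<forall>x\<in>{-1..1}. ge x = g x) \<and>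
      (\<forall>x\<in>{a<..<b}. vderiv ge x \<noteq> 0)"
  shows "bij_betw (phase g) {-1..1} {-1..1} \<and>
    (\<forall>z\<in>{-1..1}. transformed f g z = f (phase_inv g z) * of_real (deriv_I (phase_inv g) z)) \<and>
    (\<forall>\<epsilon>. 0 < \<epsilon> \<and> \<epsilon> < 1 \<longrightarrow>
      (\<exists>C::real. \<forall>k\<in>{\<lambda>x. l * g x | l::real. l \<noteq> 0}. \<exists>p :: real \<Rightarrow> complex.
        (\<exists>Q :: complex \<Rightarrow> complex.
           Q holomorphic_on UNIV \<and>
           (\<forall>z\<in>{-1..1}. p (phase_inv k z) = Q (of_real z)) \<and>
           tempered_function (\<lambda>x. Q (of_real x)) \<and>
           (let T = fourier_dist (dist_of_fun (\<lambda>x. Q (of_real x)));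
                c = approx_band (transformed f k) \<epsilon>
            in tempered_distribution T \<and> dist_order T \<le> 1 \<and> dist_support T \<subseteq> {-c..c})) \<and>
        (\<forall>x\<in>{-1..1}. p differentiable (at x within {-1..1})) \<and>
        (\<forall>x\<in>{-1..1}. ereal (norm (deriv_I p x + \<i> * of_real (deriv_I k x) * p x - f x))
           \<le> ereal (\<epsilon> * \<bar>mean_deriv k\<bar> / min_deriv k) * Linf_norm {-1..1} f) \<and>
        Linf_norm {-1..1} p
          \<le> ereal (C * (\<bar>mean_deriv k\<bar> / min_deriv k) * min 1 (1 / \<bar>mean_deriv k\<bar>)) * Linf_norm {-1..1} f \<and>
        Linf_norm {-1..1} (deriv_I p)
          \<le> ereal (C * (\<bar>mean_deriv k\<bar> / min_deriv k) * min 1 (1 / \<bar>mean_deriv k\<bar>)) * Linf_norm {-1..1} f))"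
proof (intro conjI allI impI)
  obtain ge a b where "a < -1" "1 < b" "smooth_on {a<..<b} ge" "\<forall>x\<in>{-1..1}. ge x = g x"
    "\<forall>x\<in>{a<..<b}. vderiv ge x \<noteq> 0"
    using g_smooth by blast
  then have g: "nonstationary g" using nonstationary_if_smooth[of a b ge g] by blast
  show "bij_betw (phase g) {-1..1} {-1..1}" by (rule phase_bij[OF g])
  show "\<forall>z\<in>{-1..1}. transformed f g z = f (phase_inv g z) * of_real (deriv_I (phase_inv g) z)"
    by (simp add: deriv_I_phase_inv[OF g] transformed_def)
  obtain fe a' b' where fe: "a' < -1" "1 < b'" "smooth_on {a'<..<b'} fe" "\<forall>x\<in>{-1..1}. fe x = f x"
    using f_smooth by blast
  have f: "continuous_on {-1..1} f"
  proof (rule continuous_on_eq)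
    show "continuous_on {-1..1} fe"
    proof (intro continuous_at_imp_continuous_on ballI)
      fix x :: real assume "x \<in> {-1..1}"
      then have "x \<in> {a'<..<b'}" using fe(1,2) by auto
      from has_vector_derivative_continuous[OF smooth_on_has_vector_derivative[OF fe(3) this, of 0]]
      show "isCont fe x" by simp
    qed
  qed (use fe in auto)
  obtain x\<^sub>0 where x\<^sub>0: "x\<^sub>0 \<in> {-1..1}" "\<And>x. x \<in> {-1..1} \<Longrightarrow> norm (f x) \<le> norm (f x\<^sub>0)"
    "Linf_norm {-1..1} f = ereal (norm (f x\<^sub>0))"
    using Linf_norm_attained[OF f] by blast
  define N where "N = norm (f x\<^sub>0)"
  have N: "0 \<le> N" "Linf_norm {-1..1} f = ereal N" using x\<^sub>0(3) by (auto simp: N_def)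
  have "compact ((\<lambda>x. deriv_I g x / mean_deriv g) ` {-1..1})"
    using mean_deriv_nonzero[OF g]
    by (intro compact_continuous_image continuous_intros deriv_I_continuous[OF g]) auto
  then obtain U where U: "0 < U" "\<forall>y\<in>(\<lambda>x. deriv_I g x / mean_deriv g) ` {-1..1}. norm y \<le> U"
    using compact_imp_bounded bounded_pos by blast
  have U_le: "deriv_I g x / mean_deriv g \<le> U" if "x \<in> {-1..1}" for x
    using U(2) that abs_ge_self[of "deriv_I g x / mean_deriv g"] by force
  fix \<epsilon> :: real assume \<epsilon>: "0 < \<epsilon> \<and> \<epsilon> < 1"
  \<comment> \<open>the upper end \<open>2 m\<close> of the range of frequencies is the lower bound for the band of \<open>h\<close>\<close>
  define m where "m = (1 - \<epsilon>) / 16"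
  \<comment> \<open>the residual gains a factor \<open>u' \<le> U\<close> on the way back to the original variable\<close>
  define \<delta> where "\<delta> = \<epsilon> * N / U"
  have m: "0 < m" using \<epsilon> by (simp add: m_def)
  have \<delta>: "0 < \<delta> \<or> N = 0" "0 \<le> \<delta>" using \<epsilon> N(1) U(1) by (auto simp: \<delta>_def)
  \<comment> \<open>one sum for each sign of \<open>W\<close>, both chosen before the scaling factor \<open>l\<close>\<close>
  have "\<forall>s\<in>{1, -1}. \<exists>n a \<xi>. (\<forall>j\<le>n. m \<le> s * \<xi> j \<and> s * \<xi> j \<le> 2 * m) \<and> (N = 0 \<longrightarrow> (\<forall>j. a j = 0)) \<and>
    (\<forall>z\<in>{-1..1}. norm (transformed f g z - exp_sum n a \<xi> (of_real z)) \<le> \<delta>)"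
    using approximating_exp_sum[OF f g x\<^sub>0(2)[folded N_def] \<delta> m] by blast
  then obtain n a \<xi> where sums: "\<And>s::real. s \<in> {1, -1} \<Longrightarrow> (\<forall>j\<le>n s. m \<le> s * \<xi> s j \<and> s * \<xi> s j \<le> 2 * m)"
    "\<And>s. s \<in> {1, -1} \<Longrightarrow> N = 0 \<longrightarrow> (\<forall>j. a s j = 0)"
    "\<And>s. s \<in> {1, -1} \<Longrightarrow> \<forall>z\<in>{-1..1}. norm (transformed f g z - exp_sum (n s) (a s) (\<xi> s) (of_real z)) \<le> \<delta>"
    by metis
  define A where "A s = (\<Sum>j\<le>n s. norm (a s j))" for s
  define D where "D = (1 + U * (2 * m)) * ((1 + 1 / m) * (A 1 + A (-1)))"
  have A: "0 \<le> A s" for s by (simp add: A_def sum_nonneg)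
  have D_0: "D = 0" if "N = 0" using sums(2) that by (simp add: D_def A_def)
  \<comment> \<open>for \<open>f = 0\<close> both \<open>D\<close> and the constant \<open>D / N\<close> are \<open>0\<close>\<close>
  show "\<exists>C::real. \<forall>k\<in>{\<lambda>x. l * g x | l::real. l \<noteq> 0}. \<exists>p :: real \<Rightarrow> complex.
        (\<exists>Q :: complex \<Rightarrow> complex.
           Q holomorphic_on UNIV \<and>
           (\<forall>z\<in>{-1..1}. p (phase_inv k z) = Q (of_real z)) \<and>
           tempered_function (\<lambda>x. Q (of_real x)) \<and>
           (let T = fourier_dist (dist_of_fun (\<lambda>x. Q (of_real x)));
                c = approx_band (transformed f k) \<epsilon>
            in tempered_distribution T \<and> dist_order T \<le> 1 \<and> dist_support T \<subseteq> {-c..c})) \<and>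
        (\<forall>x\<in>{-1..1}. p differentiable (at x within {-1..1})) \<and>
        (\<forall>x\<in>{-1..1}. ereal (norm (deriv_I p x + \<i> * of_real (deriv_I k x) * p x - f x))
           \<le> ereal (\<epsilon> * \<bar>mean_deriv k\<bar> / min_deriv k) * Linf_norm {-1..1} f) \<and>
        Linf_norm {-1..1} p
          \<le> ereal (C * (\<bar>mean_deriv k\<bar> / min_deriv k) * min 1 (1 / \<bar>mean_deriv k\<bar>)) * Linf_norm {-1..1} f \<and>
        Linf_norm {-1..1} (deriv_I p)
          \<le> ereal (C * (\<bar>mean_deriv k\<bar> / min_deriv k) * min 1 (1 / \<bar>mean_deriv k\<bar>)) * Linf_norm {-1..1} f"
  proof (intro exI[of _ "D / N"] ballI)
    fix k assume "k \<in> {\<lambda>x. l * g x | l::real. l \<noteq> 0}"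
    then obtain l where l: "l \<noteq> 0" "k = (\<lambda>x. l * g x)" by blast
    have k: "nonstationary k" unfolding l(2) by (rule nonstationary_scale[OF g l(1)])
    define W where "W = mean_deriv k"
    define s where "s = sgn W"
    define \<rho> where "\<rho> = \<bar>W\<bar> / min_deriv k"
    define \<mu> where "\<mu> = min 1 (1 / \<bar>W\<bar>)"
    have W: "W \<noteq> 0" using mean_deriv_nonzero[OF k] by (simp add: W_def)
    have s: "s \<in> {1, -1}" using W by (auto simp: s_def sgn_if)
    have \<rho>: "1 \<le> \<rho>" using min_deriv_bounds[OF k] by (simp add: \<rho>_def W_def)
    have \<mu>: "0 \<le> \<mu>" by (simp add: \<mu>_def)
    define b where "b = (\<lambda>j. a s j / (\<i> * of_real (\<xi> s j + mean_deriv k)))"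
    define p where "p = (\<lambda>x. exp_sum (n s) b (\<xi> s) (of_real (phase k x)))"
    have Uk: "deriv_I k x / mean_deriv k \<le> U" if "x \<in> {-1..1}" for x
      using U_le[OF that] l(1) unfolding l(2) deriv_I_scale[OF g l(1) that] mean_deriv_scale[OF g l(1) that] by simp
    have close: "norm (transformed f k z - exp_sum (n s) (a s) (\<xi> s) (of_real z)) \<le> \<delta>" if "z \<in> {-1..1}" for z
      using sums(3)[OF s] that unfolding l(2) transformed_scale[OF g l(1) that] by blast
    have freq: "m \<le> sgn (mean_deriv k) * \<xi> s j \<and> sgn (mean_deriv k) * \<xi> s j \<le> 2 * m" if "j \<le> n s" for j
      using sums(1)[OF s] that by (simp add: s_def W_def)
    have solution:
      "\<And>x. x \<in> {-1..1} \<Longrightarrow> p differentiable (at x within {-1..1})"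
      "continuous_on {-1..1} (deriv_I p)"
      "\<And>x. x \<in> {-1..1} \<Longrightarrow> norm (deriv_I p x + \<i> * of_real (deriv_I k x) * p x - f x) \<le> U * \<delta>"
      "\<And>x. x \<in> {-1..1} \<Longrightarrow> norm (p x) \<le> A s / (m + \<bar>W\<bar>)"
      "\<And>x. x \<in> {-1..1} \<Longrightarrow> norm (deriv_I p x) \<le> U * (2 * m * A s / (m + \<bar>W\<bar>))"
      unfolding p_def b_def A_def W_def
      by (rule exp_sum_solution[OF k m freq Uk close]; assumption)+
    have p_cont: "continuous_on {-1..1} p"
      using solution(1) by (simp add: continuous_on_eq_continuous_within differentiable_imp_continuous_within)
    have decay: "A s / (m + \<bar>W\<bar>) \<le> (1 + 1 / m) * (A 1 + A (-1)) * \<mu>"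
    proof -
      have "1 / (m + \<bar>W\<bar>) \<le> (1 + 1 / m) * \<mu>"
      proof (cases "\<bar>W\<bar> \<le> 1")
        case True
        then have "\<mu> = 1" using W by (simp add: \<mu>_def)
        moreover have "1 / (m + \<bar>W\<bar>) \<le> 1 / m" using m by (simp add: frac_le)
        ultimately show ?thesis by simp
      next
        case False
        then have "\<mu> = 1 / \<bar>W\<bar>" by (simp add: \<mu>_def)
        then have "(1 + 1 / m) * \<mu> = 1 / \<bar>W\<bar> + 1 / m * (1 / \<bar>W\<bar>)" by (simp only: distrib_right mult_1)
        moreover have "1 / (m + \<bar>W\<bar>) \<le> 1 / \<bar>W\<bar>" using m W by (simp add: frac_le)
        moreover have "0 \<le> 1 / m * (1 / \<bar>W\<bar>)" using m by simp
        ultimately show ?thesis by linarith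
      qed
      moreover have "A s \<le> A 1 + A (-1)" using s A[of 1] A[of "-1"] by auto
      ultimately have "A s * (1 / (m + \<bar>W\<bar>)) \<le> (A 1 + A (-1)) * ((1 + 1 / m) * \<mu>)"
        using A m by (intro mult_mono) (auto intro!: add_nonneg_nonneg)
      then show ?thesis by (simp add: mult_ac)
    qed
    have E: "0 \<le> (1 + 1 / m) * (A 1 + A (-1)) * \<mu>" using m \<mu> A by simp
    have D_split: "D * \<mu> = (1 + U * (2 * m)) * ((1 + 1 / m) * (A 1 + A (-1)) * \<mu>)" by (simp add: D_def)
    have p_le: "norm (p x) \<le> D * \<mu>" if "x \<in> {-1..1}" for x
    proof -
      have "norm (p x) \<le> (1 + 1 / m) * (A 1 + A (-1)) * \<mu>" using solution(4)[OF that] decay by linarith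
      also have "\<dots> \<le> D * \<mu>"
        unfolding D_split using U(1) m mult_right_mono[OF _ E, of 1 "1 + U * (2 * m)"] by simp
      finally show ?thesis .
    qed
    have dp_le: "norm (deriv_I p x) \<le> D * \<mu>" if "x \<in> {-1..1}" for x
    proof -
      have "norm (deriv_I p x) \<le> U * (2 * m) * (A s / (m + \<bar>W\<bar>))" using solution(5)[OF that] by (simp add: mult.assoc)
      also have "\<dots> \<le> U * (2 * m) * ((1 + 1 / m) * (A 1 + A (-1)) * \<mu>)"
        using U(1) m by (intro mult_left_mono decay) simp
      also have "\<dots> \<le> D * \<mu>"
        unfolding D_split using mult_right_mono[OF _ E, of "U * (2 * m)" "1 + U * (2 * m)"] by simp
      finally show ?thesis .
    qed
    have D_le: "D * \<mu> \<le> (D / N * \<rho> * \<mu>) * N"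
    proof (cases "N = 0")
      case False
      have "0 \<le> D" using U(1) m A by (simp add: D_def)
      then have "(D * \<mu>) * 1 \<le> (D * \<mu>) * \<rho>" using \<rho> \<mu> by (intro mult_left_mono) auto
      then show ?thesis using False by (simp add: mult_ac)
    qed (simp add: D_0)
    have band: "\<bar>\<xi> s j\<bar> \<le> approx_band (transformed f k) \<epsilon>" if "j \<le> n s" "b j \<noteq> 0" for j
    proof -
      have "N \<noteq> 0" using sums(2)[OF s] that(2) by (auto simp: b_def)
      then have "transformed f k (phase k x\<^sub>0) \<noteq> 0"
        using transformed_phase[OF k x\<^sub>0(1), of f] by (auto simp: N_def)
      then have "(1 - \<epsilon>) / 8 \<le> approx_band (transformed f k) \<epsilon>"
        using approx_band_ge[OF transformed_continuous[OF k f] phase_in[OF k x\<^sub>0(1)]] \<epsilon> by blast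
      moreover have "\<bar>\<xi> s j\<bar> \<le> 2 * m"
        using sums(1)[OF s] that(1) s m by (auto simp: abs_if)
      ultimately show ?thesis by (simp add: m_def)
    qed
    have resid: "norm (deriv_I p x + \<i> * of_real (deriv_I k x) * p x - f x) \<le> \<epsilon> * \<rho> * N" if "x \<in> {-1..1}" for x
    proof -
      have "U * \<delta> = \<epsilon> * N" using U(1) by (simp add: \<delta>_def)
      also have "\<dots> \<le> \<epsilon> * N * \<rho>" using \<rho> \<epsilon> N(1) mult_left_mono[OF \<rho>, of "\<epsilon> * N"] by simp
      finally show ?thesis using solution(3)[OF that] by (simp add: mult_ac)
    qed
    show "\<exists>p :: real \<Rightarrow> complex.
        (\<exists>Q :: complex \<Rightarrow> complex.
           Q holomorphic_on UNIV \<and>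
           (\<forall>z\<in>{-1..1}. p (phase_inv k z) = Q (of_real z)) \<and>
           tempered_function (\<lambda>x. Q (of_real x)) \<and>
           (let T = fourier_dist (dist_of_fun (\<lambda>x. Q (of_real x)));
                c = approx_band (transformed f k) \<epsilon>
            in tempered_distribution T \<and> dist_order T \<le> 1 \<and> dist_support T \<subseteq> {-c..c})) \<and>
        (\<forall>x\<in>{-1..1}. p differentiable (at x within {-1..1})) \<and>
        (\<forall>x\<in>{-1..1}. ereal (norm (deriv_I p x + \<i> * of_real (deriv_I k x) * p x - f x))
           \<le> ereal (\<epsilon> * \<bar>mean_deriv k\<bar> / min_deriv k) * Linf_norm {-1..1} f) \<and>
        Linf_norm {-1..1} p
          \<le> ereal (D / N * (\<bar>mean_deriv k\<bar> / min_deriv k) * min 1 (1 / \<bar>mean_deriv k\<bar>)) * Linf_norm {-1..1} f \<and>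
        Linf_norm {-1..1} (deriv_I p)
          \<le> ereal (D / N * (\<bar>mean_deriv k\<bar> / min_deriv k) * min 1 (1 / \<bar>mean_deriv k\<bar>)) * Linf_norm {-1..1} f"
    proof (intro exI[of _ p] conjI ballI exI[of _ "exp_sum (n s) b (\<xi> s)"])
      show "exp_sum (n s) b (\<xi> s) holomorphic_on UNIV" by (rule exp_sum_holomorphic)
      show "p (phase_inv k z) = exp_sum (n s) b (\<xi> s) (of_real z)" if "z \<in> {-1..1}" for z
        by (simp add: p_def phase_phase_inv[OF k that])
      show "tempered_function (\<lambda>x. exp_sum (n s) b (\<xi> s) (of_real x))" by (rule tempered_function_exp_sum)
      show "let T = fourier_dist (dist_of_fun (\<lambda>x. exp_sum (n s) b (\<xi> s) (of_real x)));
                c = approx_band (transformed f k) \<epsilon>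
            in tempered_distribution T \<and> dist_order T \<le> 1 \<and> dist_support T \<subseteq> {-c..c}"
        unfolding Let_def dist_order_fourier_exp_sum
        using tempered_distribution_fourier_exp_sum dist_support_fourier_exp_sum[OF band] by simp
      show "p differentiable (at x within {-1..1})" if "x \<in> {-1..1}" for x by (rule solution(1)[OF that])
      show "ereal (norm (deriv_I p x + \<i> * of_real (deriv_I k x) * p x - f x))
           \<le> ereal (\<epsilon> * \<bar>mean_deriv k\<bar> / min_deriv k) * Linf_norm {-1..1} f" if "x \<in> {-1..1}" for x
        using resid[OF that] by (simp add: N(2) \<rho>_def W_def)
      show "Linf_norm {-1..1} p
          \<le> ereal (D / N * (\<bar>mean_deriv k\<bar> / min_deriv k) * min 1 (1 / \<bar>mean_deriv k\<bar>)) * Linf_norm {-1..1} f"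
        unfolding N(2) times_ereal.simps(1) \<rho>_def[unfolded W_def, symmetric] \<mu>_def[unfolded W_def, symmetric]
        by (intro Linf_norm_interval_le p_cont order_trans[OF p_le D_le])
      show "Linf_norm {-1..1} (deriv_I p)
          \<le> ereal (D / N * (\<bar>mean_deriv k\<bar> / min_deriv k) * min 1 (1 / \<bar>mean_deriv k\<bar>)) * Linf_norm {-1..1} f"
        unfolding N(2) times_ereal.simps(1) \<rho>_def[unfolded W_def, symmetric] \<mu>_def[unfolded W_def, symmetric]
        by (intro Linf_norm_interval_le solution(2) order_trans[OF dp_le D_le])
    qed
  qed
qed

end
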